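(* Let $T>0$, $I:=[0,T]$, let $D\subset\mathbb{R}^d$ be a bounded Lipschitz domain, and $Q:=(0,T)\times D$. Let $b\in L^\infty(\bar Q;\mathbb{R}^d)$ and let $X\colon\bar Q\to\bar D$ be a map such that: (i) for all $t\in I$, the map $x\mapsto X(t,x)$ is Borel measurable; (ii) for all $x\in\bar D$, the map $t\mapsto X(t,x)$ is a Filippov solution of $\dot\gamma(t)=b(t,\gamma(t))$ for $t\in I$, $\gamma(0)=x$; (iii) the flow lines are forward untangled: for $s\in I$ and $x_1,x_2\in\bar D$, if $X(s,x_1)=X(s,x_2)$, then $X(t,x_1)=X(t,x_2)$ for all $s\le t\le T$. For $t\in I$ let $\varrho(t,\cdot):=X(t,\cdot)\#(\mathcal{L}^d\llcorner D)$ and let $\sigma(dz,dt):=\varrho(t,dz)\,dt$ be the associated space-time measure on $\bar Q$. Let $c\in L^\infty(\bar Q,\sigma)$ with $c\ge0$ $\sigma$-a.e., $f\in L^2(\bar Q,\sigma)$, and $\bar u\in L^2(D)$. Then there exists a unique flow-solution $u\in L^2(\bar Q,\sigma)$ of the initial value problem $$\partial_t u+b\cdot\nabla u+cu=f\ \text{ in }\bar Q,\qquad u(0,\cdot)=\bar u\ \text{ in }D.$$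
   Context: $\mathcal{L}^d\llcorner D$ is Lebesgue measure restricted to $D$; $\#$ denotes push-forward of measures. Filippov solution (with $\Omega:=\bar D$): $b$ is a concrete measurable function. For $(t,x)\in I\times\Omega$ let $$F(t,x):=\bigcap_{\xi\in\mathcal{S}^{d-1}}\{v\in\mathbb{R}^d:\ \xi\cdot v\le h(t,x,\xi)\},\quad h(t,x,\xi):=\lim_{\delta\to0}\ \operatorname*{ess\,sup}_{y\in B_\delta(x)\cap\Omega}\big(\xi\cdot b(t,y)\big),$$ with ess sup taken with respect to $\mathcal{L}^d$ and $\mathcal{S}^{d-1}$ the unit sphere. A Filippov solution of $\dot\gamma=b(t,\gamma)$, $\gamma(0)=x$, is an absolutely continuous $\gamma\colon[0,T]\to\Omega$ with $\gamma(0)=x$ and $\dot\gamma(t)\in F(t,\gamma(t))$ for a.e. $t$. Variational solution: given $C\in L^\infty(Q)$ with $C\ge0$, $F\in L^2(Q)$, $\bar U\in L^2(D)$ (here $F$ is a function on $Q$, not the set-valued map above), consider $$\partial_tU+CU=F\ \text{ in }Q,\qquad U(0,\cdot)=\bar U\ \text{ in }D.$$ Let $\mathcal{C}^1_+(Q):=\{V\in \mathcal{C}(\bar Q)\cap \mathcal{C}^1(Q):\ V(T,\cdot)=0\}$, where only $V$ for which the following norm is finite are considered, and for such $V$ set $\mathcal{B}_\circ^*V:=-\partial_tV+CV$ and $\|V\|_*:=\|\mathcal{B}_\circ^*V\|_{L^2(Q)}$, which is a norm. Let $\mathscr{Y}$ be the closure (completion) of $\mathcal{C}^1_+(Q)$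 with respect to $\|\cdot\|_*$, and $\mathcal{B}^*\colon\mathscr{Y}\to L^2(Q)$ the continuous extension of $\mathcal{B}_\circ^*$. Elements $V\in\mathscr{Y}$ have a strong $L^2(D)$-trace $V_0$ on $\{0\}\times D$. A function $U\in L^2(Q)$ is a variational solution if $$\langle U,\mathcal{B}^*V\rangle_{L^2(Q)}=\langle F,V\rangle_{L^2(Q)}+\int_D\bar U(x)V_0(x)\,dx\quad\text{for all }V\in\mathscr{Y}.$$ Flow-solution: $u\in L^2(\bar Q,\sigma)$ is a flow-solution of $\partial_tu+b\cdot\nabla u+cu=f$, $u(0,\cdot)=\bar u$ (with respect to the given flow $X$) if for all $\varphi\in \mathcal{C}(\bar Q)$ $$\iint_{\bar Q}u(t,z)\varphi(t,z)\,\varrho(t,dz)\,dt=\iint_QU(t,x)\,\varphi\big(t,X(t,x)\big)\,dx\,dt,$$ where $U\in L^2(Q)$ is a variational solution of $\partial_tU+CU=F$, $U(0,\cdot)=\bar U$ with $$C(t,x):=c(t,X(t,x)),\quad F(t,x):=f(t,X(t,x)),\quad \bar U(x):=\bar u(x)\quad\text{for }(t,x)\in Q.$$ *)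

theory Defs
  imports "HOL-Probability.Essential_Supremum"
begin

section \<open>Domains, Lebesgue spaces, absolute continuity\<close>

text \<open>
  Near each boundary point, \<open>D\<close> is the strict epigraph of a Lipschitz function over the
  hyperplane orthogonal to a unit vector \<open>\<nu>\<close>.
\<close>
definition bounded_Lipschitz_domain :: "'a::euclidean_space set \<Rightarrow> bool" where
  "bounded_Lipschitz_domain D \<longleftrightarrow>
     open D \<and> connected D \<and> D \<noteq> {} \<and> bounded D \<and>
     (\<forall>x\<in>frontier D. \<exists>r>0. \<exists>\<nu> g L. norm \<nu> = 1 \<and> L-lipschitz_on {y. y \<bullet> \<nu> = 0} g \<and>
        D \<inter> ball x r = {y \<in> ball x r. g (y - (y \<bullet> \<nu>) *\<^sub>R \<nu>) < y \<bullet> \<nu>})"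

text \<open>Elements of Lebesgue spaces are represented by functions; equality is equality a.e.\<close>

definition Linfty :: "'b measure \<Rightarrow> ('b \<Rightarrow> 'c::{real_normed_vector, second_countable_topology}) set" where
  "Linfty M = {f. f \<in> borel_measurable M \<and> (\<exists>K::real. AE z in M. norm (f z) \<le> K)}"

definition L2 :: "'b measure \<Rightarrow> ('b \<Rightarrow> real) set" where
  "L2 M = {f. f \<in> borel_measurable M \<and> integrable M (\<lambda>z. (f z)\<^sup>2)}"

definition L2_inner :: "'b measure \<Rightarrow> ('b \<Rightarrow> real) \<Rightarrow> ('b \<Rightarrow> real) \<Rightarrow> real" where
  "L2_inner M f g = (LINT z|M. f z * g z)"

definition L2_norm :: "'b measure \<Rightarrow> ('b \<Rightarrow> real) \<Rightarrow> real" where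
  "L2_norm M f = sqrt (L2_inner M f f)"

definition L2_lim :: "'b measure \<Rightarrow> (nat \<Rightarrow> 'b \<Rightarrow> real) \<Rightarrow> 'b \<Rightarrow> real" where
  "L2_lim M fs = (SOME f. f \<in> L2 M \<and> (\<lambda>n. L2_norm M (\<lambda>z. fs n z - f z)) \<longlonglongrightarrow> 0)"

definition absolutely_continuous_curve :: "real \<Rightarrow> real \<Rightarrow> (real \<Rightarrow> 'a::metric_space) \<Rightarrow> bool" where
  "absolutely_continuous_curve a b \<gamma> \<longleftrightarrow>
     (\<forall>\<epsilon>>0. \<exists>\<delta>>0. \<forall>J::(real \<times> real) set.
        finite J \<and> (\<forall>(p, q)\<in>J. a \<le> p \<and> p \<le> q \<and> q \<le> b) \<and>
        disjoint_family_on (\<lambda>(p, q). {p<..<q}) J \<and> (\<Sum>(p, q)\<in>J. q - p) < \<delta> \<longrightarrow>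
        (\<Sum>(p, q)\<in>J. dist (\<gamma> p) (\<gamma> q)) < \<epsilon>)"

section \<open>Filippov solutions\<close>

text \<open>
  The essential supremum is taken in the extended reals: it may be infinite, and
  \<^const>\<open>esssup\<close> is \<open>\<infinity>\<close> where \<open>b(t, \<cdot>)\<close> fails to be measurable.  For a vector field in
  \<open>L\<^sup>\<infinity>\<close> either happens only for a null set of times \<open>t\<close>.
\<close>
definition Filippov_support ::
  "'a::euclidean_space set \<Rightarrow> (real \<times> 'a \<Rightarrow> 'a) \<Rightarrow> real \<Rightarrow> 'a \<Rightarrow> 'a \<Rightarrow> ereal" where
  "Filippov_support \<Omega> b t x \<xi> =
     Lim (at_right 0) (\<lambda>\<delta>. esssup (lebesgue_on (ball x \<delta> \<inter> \<Omega>)) (\<lambda>y. ereal (\<xi> \<bullet> b (t, y))))"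

definition Filippov_set ::
  "'a::euclidean_space set \<Rightarrow> (real \<times> 'a \<Rightarrow> 'a) \<Rightarrow> real \<Rightarrow> 'a \<Rightarrow> 'a set" where
  "Filippov_set \<Omega> b t x = (\<Inter>\<xi>\<in>sphere 0 1. {v. ereal (\<xi> \<bullet> v) \<le> Filippov_support \<Omega> b t x \<xi>})"

definition Filippov_solution ::
  "real \<Rightarrow> 'a::euclidean_space set \<Rightarrow> (real \<times> 'a \<Rightarrow> 'a) \<Rightarrow> 'a \<Rightarrow> (real \<Rightarrow> 'a) \<Rightarrow> bool" where
  "Filippov_solution T \<Omega> b x \<gamma> \<longleftrightarrow>
     absolutely_continuous_curve 0 T \<gamma> \<and> \<gamma> ` {0..T} \<subseteq> \<Omega> \<and> \<gamma> 0 = x \<and>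
     (AE t in lebesgue_on {0..T}.
        \<exists>v. (\<gamma> has_vector_derivative v) (at t within {0..T}) \<and> v \<in> Filippov_set \<Omega> b t (\<gamma> t))"

definition forward_untangled ::
  "real \<Rightarrow> 'a::euclidean_space set \<Rightarrow> (real \<Rightarrow> 'a \<Rightarrow> 'a) \<Rightarrow> bool" where
  "forward_untangled T \<Omega> X \<longleftrightarrow>
     (\<forall>s\<in>{0..T}. \<forall>x\<^sub>1\<in>\<Omega>. \<forall>x\<^sub>2\<in>\<Omega>. X s x\<^sub>1 = X s x\<^sub>2 \<longrightarrow> (\<forall>t\<in>{s..T}. X t x\<^sub>1 = X t x\<^sub>2))"

section \<open>The space-time cylinder and the measure transported by the flow\<close>

definition cylinder :: "real \<Rightarrow> 'a::euclidean_space set \<Rightarrow> (real \<times> 'a) set" where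
  "cylinder T D = {0<..<T} \<times> D"

definition pushforward_density ::
  "'a::euclidean_space set \<Rightarrow> (real \<Rightarrow> 'a \<Rightarrow> 'a) \<Rightarrow> real \<Rightarrow> 'a measure" where
  "pushforward_density D X t = distr (lebesgue_on D) borel (X t)"

text \<open>
  The measure \<open>\<sigma>(dz, dt) = \<rho>(t, dz) dt\<close> on the Borel sets of the closed cylinder, that is
  \<open>\<sigma>(A) = \<integral>\<^sub>I \<rho>(t, A\<^sub>t) dt\<close> with time slices \<open>A\<^sub>t\<close>.  The set function passed to
  \<^const>\<open>measure_of\<close> is countably additive because \<open>X\<close> is continuous in \<open>t\<close> and Borel in \<open>x\<close>, so
  that \<open>t \<mapsto> \<rho>(t, A\<^sub>t)\<close> is measurable.
\<close>
definition spacetime_measure ::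
  "real \<Rightarrow> 'a::euclidean_space set \<Rightarrow> (real \<Rightarrow> 'a \<Rightarrow> 'a) \<Rightarrow> (real \<times> 'a) measure" where
  "spacetime_measure T D X =
     measure_of (closure (cylinder T D)) (sets (restrict_space borel (closure (cylinder T D))))
       (\<lambda>A. \<integral>\<^sup>+ t. emeasure (pushforward_density D X t) (Pair t -` A) \<partial>lebesgue_on {0..T})"

section \<open>Variational solutions\<close>

definition C1_on :: "(real \<times> 'a::euclidean_space) set \<Rightarrow> (real \<times> 'a \<Rightarrow> real) \<Rightarrow> bool" where
  "C1_on S V \<longleftrightarrow> (\<exists>V' :: real \<times> 'a \<Rightarrow> (real \<times> 'a) \<Rightarrow>\<^sub>L real.
     (\<forall>z\<in>S. (V has_derivative blinfun_apply (V' z)) (at z)) \<and> continuous_on S V')"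

definition Bstar0 :: "(real \<times> 'a::euclidean_space \<Rightarrow> real) \<Rightarrow> (real \<times> 'a \<Rightarrow> real) \<Rightarrow> real \<times> 'a \<Rightarrow> real" where
  "Bstar0 C V = (\<lambda>(t, x). - deriv (\<lambda>s. V (s, x)) t + C (t, x) * V (t, x))"

definition star_norm ::
  "real \<Rightarrow> 'a::euclidean_space set \<Rightarrow> (real \<times> 'a \<Rightarrow> real) \<Rightarrow> (real \<times> 'a \<Rightarrow> real) \<Rightarrow> real" where
  "star_norm T D C V = L2_norm (lebesgue_on (cylinder T D)) (Bstar0 C V)"

text \<open>Finiteness of the norm is membership of \<open>B\<^sup>*\<^sub>\<circ> V\<close> in \<open>L\<^sup>2(Q)\<close>.\<close>
definition C1_plus ::
  "real \<Rightarrow> 'a::euclidean_space set \<Rightarrow> (real \<times> 'a \<Rightarrow> real) \<Rightarrow> (real \<times> 'a \<Rightarrow> real) set" where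
  "C1_plus T D C = {V. continuous_on (closure (cylinder T D)) V \<and> C1_on (cylinder T D) V \<and>
     (\<forall>x\<in>closure D. V (T, x) = 0) \<and> Bstar0 C V \<in> L2 (lebesgue_on (cylinder T D))}"

text \<open>
  The completion of \<^const>\<open>C1_plus\<close> with respect to \<^const>\<open>star_norm\<close>, given by its Cauchy
  sequences.  The quotient by sequences whose difference tends to zero is not formed: the three
  maps on the completion defined below (the inclusion into \<open>L\<^sup>2(Q)\<close>, the extended operator and
  the trace) are the continuous extensions of \<open>V \<mapsto> V\<close>, \<open>V \<mapsto> B\<^sup>*\<^sub>\<circ> V\<close> and \<open>V \<mapsto> V(0, \<cdot>)\<close>,
  so they agree a.e. on equivalent sequences.
\<close>
definition Yspace ::
  "real \<Rightarrow> 'a::euclidean_space set \<Rightarrow> (real \<times> 'a \<Rightarrow> real) \<Rightarrow> (nat \<Rightarrow> real \<times> 'a \<Rightarrow> real) set" where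
  "Yspace T D C = {Vs. (\<forall>n. Vs n \<in> C1_plus T D C) \<and>
     (\<forall>\<epsilon>>0. \<exists>N. \<forall>m\<ge>N. \<forall>n\<ge>N. star_norm T D C (\<lambda>z. Vs m z - Vs n z) < \<epsilon>)}"

definition Y_embed ::
  "real \<Rightarrow> 'a::euclidean_space set \<Rightarrow> (nat \<Rightarrow> real \<times> 'a \<Rightarrow> real) \<Rightarrow> real \<times> 'a \<Rightarrow> real" where
  "Y_embed T D Vs = L2_lim (lebesgue_on (cylinder T D)) Vs"

definition Bstar ::
  "real \<Rightarrow> 'a::euclidean_space set \<Rightarrow> (real \<times> 'a \<Rightarrow> real) \<Rightarrow> (nat \<Rightarrow> real \<times> 'a \<Rightarrow> real) \<Rightarrow> real \<times> 'a \<Rightarrow> real" where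
  "Bstar T D C Vs = L2_lim (lebesgue_on (cylinder T D)) (\<lambda>n. Bstar0 C (Vs n))"

definition Y_trace :: "'a::euclidean_space set \<Rightarrow> (nat \<Rightarrow> real \<times> 'a \<Rightarrow> real) \<Rightarrow> 'a \<Rightarrow> real" where
  "Y_trace D Vs = L2_lim (lebesgue_on D) (\<lambda>n x. Vs n (0, x))"

definition variational_solution ::
  "real \<Rightarrow> 'a::euclidean_space set \<Rightarrow> (real \<times> 'a \<Rightarrow> real) \<Rightarrow> (real \<times> 'a \<Rightarrow> real) \<Rightarrow> ('a \<Rightarrow> real) \<Rightarrow>
     (real \<times> 'a \<Rightarrow> real) \<Rightarrow> bool" where
  "variational_solution T D C F U\<^sub>0 U \<longleftrightarrow>
     U \<in> L2 (lebesgue_on (cylinder T D)) \<and>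
     (\<forall>V\<in>Yspace T D C.
        L2_inner (lebesgue_on (cylinder T D)) U (Bstar T D C V) =
        L2_inner (lebesgue_on (cylinder T D)) F (Y_embed T D V) +
        (LINT x|lebesgue_on D. U\<^sub>0 x * Y_trace D V x))"

section \<open>Flow-solutions\<close>

definition flow_solution ::
  "real \<Rightarrow> 'a::euclidean_space set \<Rightarrow> (real \<Rightarrow> 'a \<Rightarrow> 'a) \<Rightarrow> (real \<times> 'a \<Rightarrow> real) \<Rightarrow> (real \<times> 'a \<Rightarrow> real) \<Rightarrow>
     ('a \<Rightarrow> real) \<Rightarrow> (real \<times> 'a \<Rightarrow> real) \<Rightarrow> bool" where
  "flow_solution T D X c f u\<^sub>0 u \<longleftrightarrow>
     u \<in> L2 (spacetime_measure T D X) \<and>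
     (\<exists>U. variational_solution T D (\<lambda>(t, x). c (t, X t x)) (\<lambda>(t, x). f (t, X t x)) u\<^sub>0 U \<and>
        (\<forall>\<phi>. continuous_on (closure (cylinder T D)) \<phi> \<longrightarrow>
           (LINT z|spacetime_measure T D X. u z * \<phi> z) =
           (LINT (t, x)|lebesgue_on (cylinder T D). U (t, x) * \<phi> (t, X t x))))"

end

theory Submission
  imports Defs
begin

text \<open>
  \<^bold>\<open>Reduction to the cylinder.\<close>
  Let \<open>\<Phi>(t, x) = (t, X(t, x))\<close>.  Filippov solutions are continuous in \<open>t\<close>, and \<open>X\<close> is Borel in \<open>x\<close>,
  so \<open>\<Phi>\<close> is Borel and \<open>\<sigma>\<close> is the image of Lebesgue measure on \<open>Q\<close> under \<open>\<Phi>\<close>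
  (\<open>Caratheodory_measurable\<close>, \<open>spacetime_measure_eq\<close>).  The identity that defines a flow-solution
  then says that \<open>u \<circ> \<Phi>\<close> is the conditional expectation of \<open>U\<close> given \<open>\<Phi>\<close>.  Such a \<open>u\<close> exists in
  \<open>L\<^sup>2(\<sigma>)\<close> by the Radon-Nikodym theorem (\<open>pushforward_conditional_expectation\<close>), and it is
  determined \<open>\<sigma>\<close>-a.e. by \<open>U\<close>, because a function orthogonal to all polynomials on a bounded set
  vanishes a.e. (\<open>AE_zero_if_orthogonal_to_polynomials\<close>).  It remains to show that the variational
  problem for \<open>U\<close> has exactly one solution up to null sets.

  \<^bold>\<open>The variational problem.\<close>
  The equation \<open>\<partial>\<^sub>t U + C U = F\<close> contains no derivative in \<open>x\<close>.  For almost every \<open>x\<close> it is the Volterra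
  equation
    \<open>U(t, x) = U\<^sub>0(x) + \<integral>\<^sub>0\<^sup>t F(s, x) ds - \<integral>\<^sub>0\<^sup>t C(s, x) U(s, x) ds\<close>
  with bounded \<open>C\<close>.  Its Neumann series converges because the integral operator halves the norm with
  weight \<open>exp (- 2 M t)\<close>, where \<open>M\<close> is a bound for \<open>\<bar>C\<bar>\<close>; this gives a solution that depends measurably on \<open>x\<close> and
  is bounded in \<open>L\<^sup>2(Q)\<close> by the data (\<open>Volterra_sol_family\<close>).  Integration by parts in \<open>t\<close> turns the
  integral equation into the variational identity for test functions of class \<open>C\<^sup>1\<close> (\<open>weak_solution\<close>).

  The same identity, with \<open>F = V\<close> and \<open>U\<^sub>0 = V(0, \<cdot>)\<close> as data, bounds \<open>V\<close> and its trace by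
  \<open>\<parallel>B\<^sup>* V\<parallel>\<close> (\<open>energy_estimate\<close>).  Hence the inclusion into \<open>L\<^sup>2(Q)\<close> and the trace extend to the
  completion, and the identity passes to the limit along Cauchy sequences
  (\<open>variational_solution_exists\<close>).  For uniqueness, the difference \<open>W\<close> of two solutions is orthogonal
  to the range of \<open>B\<^sup>*\<close>.  Test functions \<open>\<eta>(t) q(x)\<close> with \<open>- \<eta>'(t) = t\<^sup>k\<close>, \<open>\<eta>(T) = 0\<close> and a polynomial \<open>q\<close>
  show that \<open>W(t, x) + \<integral>\<^sub>0\<^sup>t C W ds\<close> is orthogonal to all monomials in \<open>t\<close>, for almost every \<open>x\<close>.  So \<open>W\<close> solves
  a homogeneous Volterra equation, and \<open>W = 0\<close> (\<open>orthogonal_to_range_zero\<close>).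
\<close>

section \<open>The space of square-integrable functions\<close>

lemma L2_measurable: "f \<in> L2 M \<Longrightarrow> f \<in> borel_measurable M"
  by (simp add: L2_def)

lemma L2_square_integrable: "f \<in> L2 M \<Longrightarrow> integrable M (\<lambda>x. (f x)\<^sup>2)"
  by (simp add: L2_def)

lemma L2_mult_integrable:
  assumes "f \<in> L2 M" "g \<in> L2 M"
  shows "integrable M (\<lambda>x. f x * g x)"
proof (rule Bochner_Integration.integrable_bound)
  show "integrable M (\<lambda>x. (f x)\<^sup>2 + (g x)\<^sup>2)"
    using assms by (simp add: L2_def)
  show "(\<lambda>x. f x * g x) \<in> borel_measurable M"
    using assms by (auto simp: L2_def)
  show "AE x in M. norm (f x * g x) \<le> norm ((f x)\<^sup>2 + (g x)\<^sup>2)"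
  proof (rule AE_I2)
    fix x
    have "2 * \<bar>f x * g x\<bar> \<le> (f x)\<^sup>2 + (g x)\<^sup>2"
      using sum_squares_bound[of "\<bar>f x\<bar>" "\<bar>g x\<bar>"] by (simp add: abs_mult)
    then show "norm (f x * g x) \<le> norm ((f x)\<^sup>2 + (g x)\<^sup>2)"
      by simp
  qed
qed

lemma L2_add:
  assumes "f \<in> L2 M" "g \<in> L2 M"
  shows "(\<lambda>x. f x + g x) \<in> L2 M"
  using assms L2_mult_integrable[OF assms]
  by (auto simp: L2_def power2_sum mult.assoc)

lemma L2_cmult: "f \<in> L2 M \<Longrightarrow> (\<lambda>x. a * f x) \<in> L2 M"
  by (auto simp: L2_def power_mult_distrib)

lemma L2_diff:
  assumes "f \<in> L2 M" "g \<in> L2 M"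
  shows "(\<lambda>x. f x - g x) \<in> L2 M"
  using L2_add[OF assms(1) L2_cmult[OF assms(2), of "-1"]] by simp

lemma (in finite_measure) L2_bounded:
  assumes "f \<in> borel_measurable M" "AE x in M. \<bar>f x\<bar> \<le> B"
  shows "f \<in> L2 M"
proof -
  have "integrable M (\<lambda>x. (f x)\<^sup>2)"
  proof (rule integrable_const_bound)
    show "AE x in M. norm ((f x)\<^sup>2) \<le> B\<^sup>2"
      using assms(2)
    proof eventually_elim
      case (elim x)
      then show ?case using power_mono[OF elim, of 2] by simp
    qed
    show "(\<lambda>x. (f x)\<^sup>2) \<in> borel_measurable M" using assms(1) by simp
  qed
  then show ?thesis using assms by (simp add: L2_def)
qed

lemma L2_mult_bounded:
  assumes "f \<in> L2 M" "g \<in> borel_measurable M" "AE x in M. \<bar>g x\<bar> \<le> B"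
  shows "(\<lambda>x. g x * f x) \<in> L2 M"
proof -
  have m: "f \<in> borel_measurable M" using assms(1) by (rule L2_measurable)
  have "integrable M (\<lambda>x. (g x * f x)\<^sup>2)"
  proof (rule Bochner_Integration.integrable_bound)
    show "integrable M (\<lambda>x. B\<^sup>2 * (f x)\<^sup>2)" using assms by (simp add: L2_def)
    show "AE x in M. norm ((g x * f x)\<^sup>2) \<le> norm (B\<^sup>2 * (f x)\<^sup>2)"
      using assms(3)
    proof eventually_elim
      case (elim x)
      then have "(g x)\<^sup>2 \<le> B\<^sup>2" using power_mono[OF elim, of 2] by simp
      then show ?case by (simp add: power_mult_distrib mult_right_mono)
    qed
    show "(\<lambda>x. (g x * f x)\<^sup>2) \<in> borel_measurable M" using assms m by simp
  qed
  then show ?thesis using assms m by (simp add: L2_def)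
qed

lemma L2_cong_AE:
  assumes "f \<in> L2 M" "g \<in> borel_measurable M" "AE x in M. f x = g x"
  shows "g \<in> L2 M"
proof -
  have [measurable]: "f \<in> borel_measurable M" "g \<in> borel_measurable M"
    using assms by (simp_all add: L2_def)
  have "integrable M (\<lambda>x. (g x)\<^sup>2)"
    using assms(1,3)
    by (subst integrable_cong_AE[where g="\<lambda>x. (f x)\<^sup>2"]) (auto simp: L2_def)
  then show ?thesis using assms by (simp add: L2_def)
qed

lemma (in finite_measure) L2_integrable:
  assumes "f \<in> L2 M"
  shows "integrable M f"
  using L2_mult_integrable[OF assms L2_bounded[of "\<lambda>_. 1" 1]] by simp

lemma L2_norm_nonneg: "0 \<le> L2_norm M f"
  by (simp add: L2_norm_def L2_inner_def)

lemma L2_norm_square: "(L2_norm M f)\<^sup>2 = (LINT x|M. (f x)\<^sup>2)"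
  by (simp add: L2_norm_def L2_inner_def power2_eq_square)

lemma L2_Cauchy_Schwarz:
  assumes "f \<in> L2 M" "g \<in> L2 M"
  shows "\<bar>L2_inner M f g\<bar> \<le> L2_norm M f * L2_norm M g"
proof -
  define a b c where "a = (LINT x|M. (f x)\<^sup>2)" and "b = (LINT x|M. f x * g x)"
    and "c = (LINT x|M. (g x)\<^sup>2)"
  have int: "integrable M (\<lambda>x. (f x)\<^sup>2)" "integrable M (\<lambda>x. (g x)\<^sup>2)" "integrable M (\<lambda>x. f x * g x)"
    using assms L2_mult_integrable[OF assms] by (simp_all add: L2_def)
  have quad: "0 \<le> a + s * (2 * b) + s\<^sup>2 * c" for s
  proof -
    have "0 \<le> (LINT x|M. (f x + s * g x)\<^sup>2)" by simp
    also have "\<dots> = (LINT x|M. (f x)\<^sup>2 + s * 2 * (f x * g x) + s\<^sup>2 * (g x)\<^sup>2)"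
      by (rule Bochner_Integration.integral_cong) (auto simp: power2_eq_square algebra_simps)
    also have "\<dots> = a + s * (2 * b) + s\<^sup>2 * c"
      using int by (simp add: a_def b_def c_def)
    finally show ?thesis .
  qed
  have "a \<ge> 0" "c \<ge> 0" by (simp_all add: a_def c_def)
  have "b\<^sup>2 \<le> a * c"
  proof (cases "c = 0")
    case True
    have "b = 0"
    proof (rule ccontr)
      assume "b \<noteq> 0"
      \<comment> \<open>If \<open>g\<close> has norm zero, the quadratic in \<open>s\<close> is affine; this \<open>s\<close> gives it the value \<open>-1\<close>.\<close>
      then show False using quad[of "- (a + 1) / (2 * b)"] True by simp
    qed
    then show ?thesis using True by simp
  next
    case False
    then have "c > 0" using \<open>c \<ge> 0\<close> by simp
    have "a + (- b / c) * (2 * b) + (- b / c)\<^sup>2 * c = a - b\<^sup>2 / c"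
      using \<open>c > 0\<close> by (simp add: field_simps power2_eq_square)
    then have "b\<^sup>2 / c \<le> a" using quad[of "- b / c"] by simp
    then show ?thesis using \<open>c > 0\<close> by (simp add: field_simps)
  qed
  then have "\<bar>b\<bar> \<le> sqrt (a * c)" by (rule real_le_rsqrt[of "\<bar>b\<bar>", simplified])
  then show ?thesis
    by (simp add: a_def b_def c_def real_sqrt_mult L2_norm_def L2_inner_def power2_eq_square)
qed

lemma L2_inner_tendsto:
  assumes "f \<in> L2 M" "\<And>n. gs n \<in> L2 M" "g \<in> L2 M"
    and "(\<lambda>n. L2_norm M (\<lambda>x. gs n x - g x)) \<longlonglongrightarrow> 0"
  shows "(\<lambda>n. L2_inner M f (gs n)) \<longlonglongrightarrow> L2_inner M f g"
proof -
  have "(\<lambda>n. L2_inner M f (gs n) - L2_inner M f g) \<longlonglongrightarrow> 0"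
  proof (rule tendsto_0_le[where K="L2_norm M f"])
    show "(\<lambda>n. L2_norm M (\<lambda>x. gs n x - g x)) \<longlonglongrightarrow> 0" by fact
    have "norm (L2_inner M f (gs n) - L2_inner M f g) \<le> norm (L2_norm M (\<lambda>x. gs n x - g x)) * L2_norm M f" for n
    proof -
      have "L2_inner M f (gs n) - L2_inner M f g = L2_inner M f (\<lambda>x. gs n x - g x)"
        using L2_mult_integrable[OF assms(1) assms(2)[of n]] L2_mult_integrable[OF assms(1,3)]
        by (simp add: L2_inner_def right_diff_distrib)
      then show ?thesis
        using L2_Cauchy_Schwarz[OF assms(1) L2_diff[OF assms(2)[of n] assms(3)]]
        by (simp add: L2_norm_nonneg mult.commute)
    qed
    then show "\<forall>\<^sub>F n in sequentially. norm (L2_inner M f (gs n) - L2_inner M f g) \<le> norm (L2_norm M (\<lambda>x. gs n x - g x)) * L2_norm M f"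
      by simp
  qed
  then show ?thesis by (simp add: LIM_zero_iff)
qed

text \<open>
  The nonnegative integral makes sense before integrability is known; this form of the norm bound is
  what Fatou's lemma delivers.
\<close>
lemma L2_norm_le_iff:
  assumes "f \<in> borel_measurable M" "0 \<le> e"
  shows "(\<integral>\<^sup>+x. ennreal ((f x)\<^sup>2) \<partial>M) \<le> ennreal (e\<^sup>2) \<longleftrightarrow> f \<in> L2 M \<and> L2_norm M f \<le> e"
proof
  assume *: "(\<integral>\<^sup>+x. ennreal ((f x)\<^sup>2) \<partial>M) \<le> ennreal (e\<^sup>2)"
  have i: "integrable M (\<lambda>x. (f x)\<^sup>2)"
    using assms(1) le_less_trans[OF *] by (intro integrableI_nonneg) auto
  then have "(LINT x|M. (f x)\<^sup>2) \<le> e\<^sup>2"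
    using * by (simp add: nn_integral_eq_integral)
  then show "f \<in> L2 M \<and> L2_norm M f \<le> e"
    using assms i L2_norm_square[of M f] power2_le_imp_le[of "L2_norm M f" e] by (simp add: L2_def)
next
  assume *: "f \<in> L2 M \<and> L2_norm M f \<le> e"
  then have "(L2_norm M f)\<^sup>2 \<le> e\<^sup>2" by (simp add: L2_norm_nonneg power_mono)
  then show "(\<integral>\<^sup>+x. ennreal ((f x)\<^sup>2) \<partial>M) \<le> ennreal (e\<^sup>2)"
    using * by (simp add: L2_norm_square L2_def nn_integral_eq_integral)
qed

text \<open>
  The Riesz-Fischer theorem.  On a finite measure space the \<open>L\<^sup>2\<close>-norm dominates the \<open>L\<^sup>1\<close>-norm up to a constant, so
  the increments of a fast Cauchy subsequence are absolutely summable a.e.; this yields a pointwise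
  limit \<open>f\<close>.  Fatou's lemma, applied to \<open>(fs n - fs (r j))\<^sup>2\<close> as \<open>j \<rightarrow> \<infinity>\<close>, bounds the distance of \<open>fs n\<close> to \<open>f\<close>.
\<close>
lemma (in finite_measure) L2_complete:
  assumes fs: "\<And>n. fs n \<in> L2 M"
    and Cauchy: "\<forall>\<epsilon>>0. \<exists>N. \<forall>m\<ge>N. \<forall>n\<ge>N. L2_norm M (\<lambda>x. fs m x - fs n x) < \<epsilon>"
  shows "\<exists>f\<in>L2 M. (\<lambda>n. L2_norm M (\<lambda>x. fs n x - f x)) \<longlonglongrightarrow> 0"
proof -
  have [measurable]: "fs n \<in> borel_measurable M" for n using fs by (rule L2_measurable)
  have "\<forall>k. \<exists>N. \<forall>m\<ge>N. \<forall>n\<ge>N. L2_norm M (\<lambda>x. fs m x - fs n x) < (1/2)^k"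
    using Cauchy by simp
  then obtain N where N: "\<And>k m n. m \<ge> N k \<Longrightarrow> n \<ge> N k \<Longrightarrow> L2_norm M (\<lambda>x. fs m x - fs n x) < (1/2)^k"
    by metis
  \<comment> \<open>Partial sums make the index sequence monotone and put \<open>r j\<close> beyond every \<open>N k\<close> with \<open>k \<le> j\<close>.\<close>
  define r where "r k = (\<Sum>i\<le>k. N i)" for k :: nat
  have rN: "N k \<le> r j" if "k \<le> j" for k j
    unfolding r_def using that by (intro member_le_sum) auto
  define d where "d k x = fs (r (Suc k)) x - fs (r k) x" for k x
  have [measurable]: "d k \<in> borel_measurable M" for k by (simp add: d_def[abs_def])
  define R where "R = L2_norm M (\<lambda>_. 1)"
  have dL2: "d k \<in> L2 M" for k
    unfolding d_def[abs_def] by (intro L2_diff fs)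
  have d1: "(\<integral>\<^sup>+x. ennreal \<bar>d k x\<bar> \<partial>M) \<le> ennreal (R * (1/2)^k)" for k
  proof -
    have abs: "(\<lambda>x. \<bar>d k x\<bar>) \<in> L2 M"
      using dL2[of k] by (simp add: L2_def)
    have "(LINT x|M. \<bar>d k x\<bar>) = \<bar>L2_inner M (\<lambda>_. 1) (\<lambda>x. \<bar>d k x\<bar>)\<bar>"
      by (simp add: L2_inner_def)
    also have "\<dots> \<le> R * L2_norm M (\<lambda>x. \<bar>d k x\<bar>)"
      unfolding R_def by (rule L2_Cauchy_Schwarz[OF L2_bounded[of _ 1] abs]) auto
    also have "L2_norm M (\<lambda>x. \<bar>d k x\<bar>) = L2_norm M (d k)"
      by (simp add: L2_norm_def L2_inner_def)
    also have "L2_norm M (d k) \<le> (1/2)^k"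
      unfolding d_def[abs_def] using N[of k "r (Suc k)" "r k"] rN by (simp add: less_imp_le)
    finally have "(LINT x|M. \<bar>d k x\<bar>) \<le> R * (1/2)^k"
      using L2_norm_nonneg[of M "\<lambda>_. 1"] by (simp add: R_def mult_left_mono)
    then show ?thesis
      using L2_integrable[OF abs] by (subst nn_integral_eq_integral) (auto intro: ennreal_leI)
  qed
  have "(\<integral>\<^sup>+x. (\<Sum>k. ennreal \<bar>d k x\<bar>) \<partial>M) = (\<Sum>k. \<integral>\<^sup>+x. ennreal \<bar>d k x\<bar> \<partial>M)"
    by (rule nn_integral_suminf) simp
  also have "\<dots> \<le> (\<Sum>k. ennreal (R * (1/2)^k))"
    by (intro suminf_le d1) auto
  also have "\<dots> = ennreal (\<Sum>k. R * (1/2)^k)"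
    using L2_norm_nonneg[of M "\<lambda>_. 1"] by (intro suminf_ennreal2) (auto simp: R_def intro!: summable_mult)
  also have "\<dots> < \<infinity>" by simp
  finally have "AE x in M. (\<Sum>k. ennreal \<bar>d k x\<bar>) \<noteq> \<infinity>"
    by (intro nn_integral_noteq_infinite) auto
  then have ae: "AE x in M. summable (\<lambda>k. d k x)"
  proof eventually_elim
    case (elim x)
    then have "summable (\<lambda>k. \<bar>d k x\<bar>)"
      by (intro summable_suminf_not_top) auto
    then show ?case by (rule summable_rabs_cancel)
  qed
  define f where "f x = fs (r 0) x + (\<Sum>k. d k x)" for x
  have [measurable]: "f \<in> borel_measurable M" unfolding f_def by measurable
  have lim: "AE x in M. (\<lambda>k. fs (r k) x) \<longlonglongrightarrow> f x"
    using ae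
  proof eventually_elim
    case (elim x)
    have "(\<lambda>n. fs (r 0) x + (\<Sum>k<n. d k x)) \<longlonglongrightarrow> f x"
      unfolding f_def by (intro tendsto_intros summable_LIMSEQ elim)
    then show ?case by (simp add: d_def sum_lessThan_telescope[where f="\<lambda>k. fs (r k) x"])
  qed
  have close: "(\<lambda>x. fs n x - f x) \<in> L2 M \<and> L2_norm M (\<lambda>x. fs n x - f x) \<le> (1/2)^k"
    if n: "n \<ge> N k" for n k
  proof -
    have "(\<integral>\<^sup>+x. ennreal ((fs n x - f x)\<^sup>2) \<partial>M)
        = (\<integral>\<^sup>+x. liminf (\<lambda>j. ennreal ((fs n x - fs (r j) x)\<^sup>2)) \<partial>M)"
    proof (rule nn_integral_cong_AE)
      show "AE x in M. ennreal ((fs n x - f x)\<^sup>2) = liminf (\<lambda>j. ennreal ((fs n x - fs (r j) x)\<^sup>2))"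
        using lim
      proof eventually_elim
        case (elim x)
        have "(\<lambda>j. ennreal ((fs n x - fs (r j) x)\<^sup>2)) \<longlonglongrightarrow> ennreal ((fs n x - f x)\<^sup>2)"
          by (intro tendsto_intros tendsto_ennrealI elim)
        then show ?case by (rule lim_imp_Liminf[OF sequentially_bot, symmetric])
      qed
    qed
    also have "\<dots> \<le> liminf (\<lambda>j. \<integral>\<^sup>+x. ennreal ((fs n x - fs (r j) x)\<^sup>2) \<partial>M)"
      by (rule nn_integral_liminf) simp
    also have "\<dots> \<le> liminf (\<lambda>j. ennreal (((1/2)^k)\<^sup>2))"
    proof (rule Liminf_mono)
      show "\<forall>\<^sub>F j in sequentially. (\<integral>\<^sup>+x. ennreal ((fs n x - fs (r j) x)\<^sup>2) \<partial>M) \<le> ennreal (((1/2)^k)\<^sup>2)"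
        using eventually_ge_at_top[of k]
      proof eventually_elim
        case (elim j)
        have "L2_norm M (\<lambda>x. fs n x - fs (r j) x) \<le> (1/2)^k"
          using N[of k n "r j"] n rN[OF elim] by simp
        then show ?case
          using L2_diff[OF fs fs, of n "r j"] by (subst L2_norm_le_iff) auto
      qed
    qed
    finally have "(\<integral>\<^sup>+x. ennreal ((fs n x - f x)\<^sup>2) \<partial>M) \<le> ennreal (((1/2)^k)\<^sup>2)"
      by (simp only: Liminf_const[OF trivial_limit_sequentially])
    then show ?thesis by (subst (asm) L2_norm_le_iff) auto
  qed
  have "f \<in> L2 M"
    using L2_diff[OF fs[of "N 0"] conjunct1[OF close[of 0 "N 0"]]] by simp
  moreover have "(\<lambda>n. L2_norm M (\<lambda>x. fs n x - f x)) \<longlonglongrightarrow> 0"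
  proof (rule LIMSEQ_I)
    fix e :: real assume "0 < e"
    then obtain k where k: "(1/2)^k < e" using real_arch_pow_inv[of e "1/2"] by auto
    have "norm (L2_norm M (\<lambda>x. fs n x - f x) - 0) < e" if "n \<ge> N k" for n
      using close[OF that] k L2_norm_nonneg[of M "\<lambda>x. fs n x - f x"] by simp
    then show "\<exists>no. \<forall>n\<ge>no. norm (L2_norm M (\<lambda>x. fs n x - f x) - 0) < e" by blast
  qed
  ultimately show ?thesis by blast
qed

lemma (in finite_measure) L2_lim_Cauchy:
  assumes "\<And>n. fs n \<in> L2 M"
    and "\<forall>\<epsilon>>0. \<exists>N. \<forall>m\<ge>N. \<forall>n\<ge>N. L2_norm M (\<lambda>x. fs m x - fs n x) < \<epsilon>"
  shows "L2_lim M fs \<in> L2 M" "(\<lambda>n. L2_norm M (\<lambda>x. fs n x - L2_lim M fs x)) \<longlonglongrightarrow> 0"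
proof -
  have "\<exists>f. f \<in> L2 M \<and> (\<lambda>n. L2_norm M (\<lambda>x. fs n x - f x)) \<longlonglongrightarrow> 0"
    using L2_complete[OF assms] by blast
  from someI_ex[OF this]
  show "L2_lim M fs \<in> L2 M" "(\<lambda>n. L2_norm M (\<lambda>x. fs n x - L2_lim M fs x)) \<longlonglongrightarrow> 0"
    unfolding L2_lim_def by blast+
qed

lemma L2_norm_zero_AE:
  assumes "f \<in> L2 M" "L2_norm M f = 0"
  shows "AE x in M. f x = 0"
proof -
  have "(LINT x|M. (f x)\<^sup>2) = 0" using assms(2) L2_norm_square[of M f] by simp
  then have "AE x in M. (f x)\<^sup>2 = 0"
    using assms(1) by (subst (asm) integral_nonneg_eq_0_iff_AE) (auto simp: L2_def)
  then show ?thesis by simp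
qed

lemma (in finite_measure) L2_lim_const:
  assumes "f \<in> L2 M"
  shows "L2_lim M (\<lambda>n. f) \<in> L2 M" "AE x in M. L2_lim M (\<lambda>n. f) x = f x"
proof -
  have c: "\<forall>\<epsilon>>0. \<exists>N. \<forall>m\<ge>N. \<forall>n\<ge>N. L2_norm M (\<lambda>x. f x - f x) < \<epsilon>"
    by (simp add: L2_norm_def L2_inner_def)
  note * = L2_lim_Cauchy[of "\<lambda>n. f", OF assms c]
  show "L2_lim M (\<lambda>n. f) \<in> L2 M" by fact
  have "L2_norm M (\<lambda>x. f x - L2_lim M (\<lambda>n. f) x) = 0"
    using *(2) by (simp add: LIMSEQ_const_iff)
  from L2_norm_zero_AE[OF L2_diff[OF assms *(1)] this]
  show "AE x in M. L2_lim M (\<lambda>n. f) x = f x" by eventually_elim simp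
qed

section \<open>Density of polynomials\<close>

text \<open>
  Stone-Weierstrass extends the orthogonality from polynomials to continuous functions on the compact
  closure of \<open>S\<close>, dominated convergence to indicators of closed sets, and Dynkin's lemma to
  all Borel sets.  The lemma serves three measures: Lebesgue measure on the time interval and on the
  spatial domain, and \<open>\<sigma>\<close>.
\<close>
lemma AE_zero_if_orthogonal_to_polynomials:
  fixes M :: "'b::euclidean_space measure" and f :: "'b \<Rightarrow> real"
  assumes S: "bounded S" and sets: "sets M = sets (restrict_space borel S)"
    and f: "integrable M f"
    and orth: "\<And>p. real_polynomial_function p \<Longrightarrow> (LINT x|M. f x * p x) = 0"
  shows "AE x in M. f x = 0"
proof -
  have space: "space M = S"
    using sets_eq_imp_space_eq[OF sets] by (simp add: space_restrict_space)
  have meas: "\<phi> \<in> borel_measurable M" if "\<phi> \<in> borel_measurable borel" for \<phi> :: "'b \<Rightarrow> real"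
    using measurable_restrict_space1[OF that, of S] by (simp cong: measurable_cong_sets add: measurable_cong_sets[OF sets refl])
  have contm: "\<phi> \<in> borel_measurable M" if "continuous_on UNIV \<phi>" for \<phi> :: "'b \<Rightarrow> real"
    using that by (intro meas borel_measurable_continuous_onI)
  have K: "compact (closure S)" using S by simp
  have cont0: "(LINT x|M. f x * \<phi> x) = 0" if \<phi>: "continuous_on UNIV \<phi>" for \<phi> :: "'b \<Rightarrow> real"
  proof -
    have int: "integrable M (\<lambda>x. f x * g x)" if "continuous_on UNIV g" for g :: "'b \<Rightarrow> real"
    proof -
      have "bounded (g ` closure S)"
        using that K by (intro compact_imp_bounded compact_continuous_image) (auto intro: continuous_on_subset)
      then obtain B where B: "\<And>x. x \<in> closure S \<Longrightarrow> \<bar>g x\<bar> \<le> B"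
        unfolding bounded_iff by auto
      show ?thesis
      proof (rule Bochner_Integration.integrable_bound)
        show "integrable M (\<lambda>x. B * f x)" using f by simp
        show "(\<lambda>x. f x * g x) \<in> borel_measurable M"
          using f contm[OF that] by auto
        show "AE x in M. norm (f x * g x) \<le> norm (B * f x)"
        proof (rule AE_I2)
          fix x assume "x \<in> space M"
          then have "\<bar>g x\<bar> \<le> B" using B closure_subset space by blast
          then have "\<bar>g x\<bar> \<le> \<bar>B\<bar>" by linarith
          then show "norm (f x * g x) \<le> norm (B * f x)"
            by (simp add: abs_mult mult.commute[of "\<bar>B\<bar>"] mult_left_mono)
        qed
      qed
    qed
    have "\<bar>LINT x|M. f x * \<phi> x\<bar> \<le> e" if "0 < e" for e
    proof -
      define I where "I = (LINT x|M. \<bar>f x\<bar>)"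
      have "I \<ge> 0" by (simp add: I_def)
      then have "0 < e / (I + 1)" using that by simp
      then obtain p where p: "real_polynomial_function p" "\<And>x. x \<in> closure S \<Longrightarrow> \<bar>\<phi> x - p x\<bar> < e / (I + 1)"
        using Stone_Weierstrass_real_polynomial_function[OF K continuous_on_subset[OF \<phi>]] by blast
      have pc: "continuous_on UNIV p"
        using p(1) by (simp add: continuous_on_polymonial_function real_polynomial_function_eq)
      have "(LINT x|M. f x * \<phi> x) = (LINT x|M. f x * \<phi> x) - (LINT x|M. f x * p x)"
        using orth[OF p(1)] by simp
      also have "\<dots> = (LINT x|M. f x * (\<phi> x - p x))"
        using int[OF \<phi>] int[OF pc] by (simp add: right_diff_distrib)
      also have "\<bar>\<dots>\<bar> \<le> (LINT x|M. \<bar>f x * (\<phi> x - p x)\<bar>)"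
        by (rule integral_abs_bound)
      also have "\<dots> \<le> (LINT x|M. \<bar>f x\<bar> * (e / (I + 1)))"
      proof (rule integral_mono)
        show "integrable M (\<lambda>x. \<bar>f x * (\<phi> x - p x)\<bar>)"
          using int[OF continuous_on_diff[OF \<phi> pc]] by simp
        show "integrable M (\<lambda>x. \<bar>f x\<bar> * (e / (I + 1)))" using f by simp
        fix x assume "x \<in> space M"
        then have "x \<in> closure S" using closure_subset space by blast
        from p(2)[OF this] show "\<bar>f x * (\<phi> x - p x)\<bar> \<le> \<bar>f x\<bar> * (e / (I + 1))"
          by (simp only: abs_mult) (intro mult_left_mono, auto)
      qed
      also have "\<dots> = e * (I / (I + 1))" by (simp add: I_def)
      also have "\<dots> \<le> e * 1"
        using \<open>I \<ge> 0\<close> that by (intro mult_left_mono) auto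
      finally show ?thesis by simp
    qed
    then show ?thesis by (meson abs_le_zero_iff dense_ge)
  qed
  have closed0: "(LINT x|M. f x * indicator A x) = 0" if A: "closed A" for A
  proof (cases "A = {}")
    case False
    \<comment> \<open>Continuous functions decreasing to the indicator of the closed set \<open>A\<close>.\<close>
    define \<phi> where "\<phi> n x = max 0 (1 - real n * infdist x A)" for n x
    have \<phi>: "continuous_on UNIV (\<phi> n)" for n
      unfolding \<phi>_def by (intro continuous_intros)
    have "(\<lambda>n. LINT x|M. f x * \<phi> n x) \<longlonglongrightarrow> (LINT x|M. f x * indicator A x)"
    proof (rule integral_dominated_convergence[where w="\<lambda>x. \<bar>f x\<bar>"])
      show "(\<lambda>x. f x * indicat_real A x) \<in> borel_measurable M"
        using f A by (intro borel_measurable_times[OF borel_measurable_integrable meas]) auto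
      show "(\<lambda>x. f x * \<phi> n x) \<in> borel_measurable M" for n
        using f contm[OF \<phi>] by auto
      show "integrable M (\<lambda>x. \<bar>f x\<bar>)" using f by simp
      show "AE x in M. norm (f x * \<phi> n x) \<le> \<bar>f x\<bar>" for n
        by (rule AE_I2) (auto simp: \<phi>_def abs_mult infdist_nonneg intro!: mult_left_le)
      show "AE x in M. (\<lambda>n. f x * \<phi> n x) \<longlonglongrightarrow> f x * indicat_real A x"
      proof (rule AE_I2, intro tendsto_intros)
        fix x
        show "(\<lambda>n. \<phi> n x) \<longlonglongrightarrow> indicat_real A x"
        proof (cases "x \<in> A")
          case True
          then show ?thesis by (simp add: \<phi>_def)
        next
          case x: False
          then have pos: "infdist x A > 0"
            using A False by (simp add: infdist_pos_not_in_closed)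
          obtain N where N: "1 < real N * infdist x A"
            using reals_Archimedean3[OF pos] by blast
          have "\<phi> n x = 0" if "n \<ge> N" for n
          proof -
            have "real N * infdist x A \<le> real n * infdist x A"
              using that pos by (intro mult_right_mono) auto
            then show ?thesis using N by (simp add: \<phi>_def)
          qed
          then have "\<forall>\<^sub>F n in sequentially. \<phi> n x = 0"
            using eventually_at_top_linorder by blast
          then show ?thesis using x by (simp add: tendsto_eventually)
        qed
      qed
    qed
    then show ?thesis by (simp add: cont0[OF \<phi>] LIMSEQ_const_iff)
  qed simp
  have setint: "set_integrable M A f" if "A \<in> sets M" for A
    unfolding set_integrable_def by (rule integrable_mult_indicator[OF that f])
  have setsB: "B \<inter> S \<in> sets M" if "B \<in> sets borel" for B
    using that by (auto simp: sets sets_restrict_space)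
  have all0: "(LINT x:B \<inter> S|M. f x) = 0" if "B \<in> sets borel" for B
  proof -
    have "Int_stable (Collect closed :: 'b set set)" by (auto simp: Int_stable_def)
    moreover have "Collect closed \<subseteq> Pow (UNIV :: 'b set)" by simp
    moreover have "B \<in> sigma_sets UNIV (Collect closed)"
      using that by (simp add: borel_eq_closed)
    ultimately show ?thesis
    proof (induction rule: sigma_sets_induct_disjoint)
      case (basic A)
      have "(LINT x:A \<inter> S|M. f x) = (LINT x|M. f x * indicator A x)"
        unfolding set_lebesgue_integral_def
        by (rule Bochner_Integration.integral_cong) (auto simp: space indicator_def)
      then show ?case using closed0 basic by simp
    next
      case empty
      then show ?case by (simp add: set_lebesgue_integral_def)
    next
      case (compl A)
      have A: "A \<in> sets borel" using compl(1) by (simp add: borel_eq_closed)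
      have "(LINT x:(A \<inter> S) \<union> ((UNIV - A) \<inter> S)|M. f x) = (LINT x:A \<inter> S|M. f x) + (LINT x:(UNIV - A) \<inter> S|M. f x)"
        using A by (intro set_integral_Un setint setsB) auto
      moreover have "(LINT x:(A \<inter> S) \<union> ((UNIV - A) \<inter> S)|M. f x) = (LINT x|M. f x * indicator UNIV x)"
        unfolding set_lebesgue_integral_def
        by (rule Bochner_Integration.integral_cong) (auto simp: space indicator_def)
      ultimately show ?case using compl(2) closed0[of UNIV] by simp
    next
      case (union A)
      have A: "A i \<in> sets borel" for i using union(2) by (auto simp: borel_eq_closed)
      have "(LINT x:(\<Union>i. A i \<inter> S)|M. f x) = (\<Sum>i. (LINT x:(A i \<inter> S)|M. f x))"
        using union(1) A
        by (intro lebesgue_integral_countable_add setint sets.countable_UN) (auto simp: setsB disjoint_family_on_def)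
      then show ?case using union(3) by simp
    qed
  qed
  have "(LINT x:A|M. f x) = (LINT x:A|M. 0)" if "A \<in> sets M" for A
  proof -
    have "A \<in> (\<inter>) S ` sets borel" using that by (simp add: sets sets_restrict_space)
    then obtain B where "B \<in> sets borel" "A = B \<inter> S" by (auto simp: Int_commute)
    then show ?thesis using all0[of B] by (simp add: set_lebesgue_integral_def)
  qed
  then show ?thesis using f by (intro density_unique_real) auto
qed

section \<open>Volterra equations on an interval\<close>

definition interval_measure :: "real \<Rightarrow> real measure" where
  "interval_measure T = restrict_space lborel {0<..<T}"

lemma space_interval_measure [simp]: "space (interval_measure T) = {0<..<T}"
  by (simp add: interval_measure_def space_restrict_space)

lemma measurable_interval_measure_ident [measurable]: "(\<lambda>x. x) \<in> interval_measure T \<rightarrow>\<^sub>M borel"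
  unfolding interval_measure_def by (rule measurable_restrict_space1) simp

lemma borel_measurable_interval_measure:
  "f \<in> borel_measurable borel \<Longrightarrow> f \<in> borel_measurable (interval_measure T)"
  by (rule measurable_compose[OF measurable_interval_measure_ident])

lemma finite_interval_measure: "finite_measure (interval_measure T)"
proof (cases "0 \<le> T")
  case True
  then show ?thesis
  by (intro finite_measureI) (simp add: interval_measure_def emeasure_restrict_space space_restrict_space)
qed (auto intro!: finite_measureI simp: interval_measure_def emeasure_restrict_space space_restrict_space)

lemma interval_measure_exp_le:
  assumes "0 < r" "t \<in> {0<..<T}"
  shows "(LINT s|interval_measure T. (if s < t then exp (r * s) else 0)) \<le> exp (r * t) / r"
proof -
  have F: "has_bochner_integral lborel (\<lambda>s. exp (r * s) * indicator {0..t} s) (exp (r * t) / r - exp (r * 0) / r)"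
    using assms
    by (intro has_bochner_integral_FTC_Icc_nonneg) (auto intro!: derivative_eq_intros continuous_intros)
  have "(LINT s|interval_measure T. (if s < t then exp (r * s) else 0)) =
    (LINT s|lborel. indicator {0<..<T} s * (if s < t then exp (r * s) else 0))"
    unfolding interval_measure_def by (subst integral_restrict_space) auto
  also have "\<dots> \<le> (LINT s|lborel. exp (r * s) * indicator {0..t} s)"
  proof (rule integral_mono')
    show "integrable lborel (\<lambda>s. exp (r * s) * indicator {0..t} s)"
      using F by (simp add: has_bochner_integral_iff)
  qed (auto simp: indicator_def)
  also have "\<dots> \<le> exp (r * t) / r"
    using has_bochner_integral_integral_eq[OF F] assms by simp
  finally show ?thesis .
qed

text \<open>
  In the norm with weight \<open>exp (- 2 M t)\<close> the operator \<open>f \<mapsto> \<integral>\<^sub>0\<^sup>t c f ds\<close> has norm at most \<open>1/2\<close>, since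
  \<open>\<integral>\<^sub>0\<^sup>t M exp (2 M s) ds \<le> exp (2 M t) / 2\<close>.  This single estimate gives both convergence of the Neumann
  series and uniqueness.
\<close>
lemma Volterra_contraction:
  fixes c f :: "real \<Rightarrow> real"
  assumes M: "0 < M" and c: "\<And>s. s \<in> {0<..<T} \<Longrightarrow> \<bar>c s\<bar> \<le> M"
    and f: "\<And>s. s \<in> {0<..<T} \<Longrightarrow> \<bar>f s\<bar> \<le> B * exp (2 * M * s)"
    and t: "t \<in> {0<..<T}"
  shows "\<bar>LINT s|interval_measure T. (if s < t then c s * f s else 0)\<bar> \<le> B / 2 * exp (2 * M * t)"
proof -
  interpret finite_measure "interval_measure T" by (rule finite_interval_measure)
  have B: "0 \<le> B"
    using order_trans[OF abs_ge_zero f[OF t]] by (simp add: zero_le_mult_iff)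
  have "\<bar>LINT s|interval_measure T. (if s < t then c s * f s else 0)\<bar> \<le>
     (LINT s|interval_measure T. \<bar>if s < t then c s * f s else 0\<bar>)"
    by (rule integral_abs_bound)
  also have "\<dots> \<le> (LINT s|interval_measure T. (M * B) * (if s < t then exp (2 * M * s) else 0))"
  proof (rule integral_mono')
    show "integrable (interval_measure T) (\<lambda>s. (M * B) * (if s < t then exp (2 * M * s) else 0))"
    proof (intro integrable_mult_right integrable_const_bound[where B="exp (2 * M * t)"])
      show "(\<lambda>s. if s < t then exp (2 * M * s) else 0) \<in> borel_measurable (interval_measure T)"
        by (rule borel_measurable_interval_measure) measurable
    qed (use M in auto)
    fix s assume "s \<in> space (interval_measure T)"
    then have s: "s \<in> {0<..<T}" by simp
    have "\<bar>c s\<bar> * \<bar>f s\<bar> \<le> M * (B * exp (2 * M * s))"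
      using c[OF s] f[OF s] M by (intro mult_mono) auto
    then show "\<bar>if s < t then c s * f s else 0\<bar> \<le> (M * B) * (if s < t then exp (2 * M * s) else 0)"
      by (simp add: abs_mult mult.assoc)
  qed (use M B in auto)
  also have "\<dots> = (M * B) * (LINT s|interval_measure T. (if s < t then exp (2 * M * s) else 0))"
    by simp
  also have "\<dots> \<le> (M * B) * (exp (2 * M * t) / (2 * M))"
    using interval_measure_exp_le[of "2 * M" t T] M B t by (intro mult_left_mono) auto
  also have "\<dots> = B / 2 * exp (2 * M * t)"
    using M by simp
  finally show ?thesis .
qed

text \<open>The terms \<open>(- A)\<^sup>n h\<close> of the Neumann series for \<open>u + A u = h\<close>, where \<open>A u (t) = \<integral>\<^sub>0\<^sup>t c u ds\<close>.\<close>
primrec Volterra_term :: "real \<Rightarrow> (real \<Rightarrow> real) \<Rightarrow> (real \<Rightarrow> real) \<Rightarrow> nat \<Rightarrow> real \<Rightarrow> real" where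
  "Volterra_term T c h 0 t = h t"
| "Volterra_term T c h (Suc n) t =
     - (LINT s|interval_measure T. (if s < t then c s * Volterra_term T c h n s else 0))"

definition Volterra_sol :: "real \<Rightarrow> (real \<Rightarrow> real) \<Rightarrow> (real \<Rightarrow> real) \<Rightarrow> real \<Rightarrow> real" where
  "Volterra_sol T c h t = (\<Sum>n. Volterra_term T c h n t)"

lemma Volterra_term_le:
  assumes M: "0 < M" and c: "\<And>s. s \<in> {0<..<T} \<Longrightarrow> \<bar>c s\<bar> \<le> M"
    and h: "\<And>s. s \<in> {0<..<T} \<Longrightarrow> \<bar>h s\<bar> \<le> B"
    and t: "t \<in> {0<..<T}"
  shows "\<bar>Volterra_term T c h n t\<bar> \<le> B * exp (2 * M * T) * (1/2)^n"
proof -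
  have B: "0 \<le> B"
    using order_trans[OF abs_ge_zero h[OF t]] .
  have "\<bar>Volterra_term T c h n t\<bar> \<le> B * (1/2)^n * exp (2 * M * t)"
    using t
  proof (induction n arbitrary: t)
    case 0
    have "\<bar>h t\<bar> \<le> B * 1" using h 0 by simp
    also have "\<dots> \<le> B * exp (2 * M * t)" using M B 0 by (intro mult_left_mono) auto
    finally show ?case by simp
  next
    case (Suc n)
    then show ?case
      using Volterra_contraction[OF M c, where f="Volterra_term T c h n" and B="B * (1/2)^n" and t=t]
      by simp
  qed
  also have "\<dots> \<le> B * (1/2)^n * exp (2 * M * T)"
    using M B t by (intro mult_left_mono) auto
  finally show ?thesis by (simp add: mult.commute mult.left_commute)
qed

lemma
  assumes M: "0 < M" and c: "\<And>s. s \<in> {0<..<T} \<Longrightarrow> \<bar>c s\<bar> \<le> M"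
    and h: "\<And>s. s \<in> {0<..<T} \<Longrightarrow> \<bar>h s\<bar> \<le> B"
    and t: "t \<in> {0<..<T}"
  shows Volterra_summable: "summable (\<lambda>n. Volterra_term T c h n t)"
    and Volterra_sol_le: "\<bar>Volterra_sol T c h t\<bar> \<le> 2 * exp (2 * M * T) * B"
proof -
  note le = Volterra_term_le[where c=c and h=h, OF M c h t]
  have g: "(\<lambda>n. B * exp (2 * M * T) * (1/2)^n) sums (B * exp (2 * M * T) * 2)"
    using sums_mult[OF geometric_sums[of "1/2 :: real"], of "B * exp (2 * M * T)"] by simp
  have abs: "summable (\<lambda>n. \<bar>Volterra_term T c h n t\<bar>)"
    by (rule summable_comparison_test'[OF sums_summable[OF g], of 0]) (use le in simp)
  show "summable (\<lambda>n. Volterra_term T c h n t)"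
    using abs by (rule summable_rabs_cancel)
  have "\<bar>Volterra_sol T c h t\<bar> \<le> (\<Sum>n. \<bar>Volterra_term T c h n t\<bar>)"
    unfolding Volterra_sol_def by (rule summable_rabs[OF abs])
  also have "\<dots> \<le> (\<Sum>n. B * exp (2 * M * T) * (1/2)^n)"
    by (intro suminf_le le abs sums_summable[OF g])
  also have "\<dots> = 2 * exp (2 * M * T) * B"
    using sums_unique[OF g] by (simp add: mult.commute)
  finally show "\<bar>Volterra_sol T c h t\<bar> \<le> 2 * exp (2 * M * T) * B" .
qed

lemma interval_measure_cut_measurable:
  fixes f :: "real \<Rightarrow> real"
  assumes [measurable]: "f \<in> borel_measurable (interval_measure T)"
  shows "(\<lambda>s. if s < t then f s else 0) \<in> borel_measurable (interval_measure T)"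
    "(\<lambda>s. if t < s then f s else 0) \<in> borel_measurable (interval_measure T)"
  by measurable

lemma Volterra_sol_eq:
  assumes M: "0 < M" and c: "\<And>s. s \<in> {0<..<T} \<Longrightarrow> \<bar>c s\<bar> \<le> M"
    and h: "\<And>s. s \<in> {0<..<T} \<Longrightarrow> \<bar>h s\<bar> \<le> B"
    and t: "t \<in> {0<..<T}"
    and cm: "c \<in> borel_measurable (interval_measure T)"
    and tm: "\<And>n. Volterra_term T c h n \<in> borel_measurable (interval_measure T)"
  shows "Volterra_sol T c h t = h t - (LINT s|interval_measure T. (if s < t then c s * Volterra_sol T c h s else 0))"
proof -
  interpret finite_measure "interval_measure T" by (rule finite_interval_measure)
  note [measurable] = cm tm
  have le: "\<bar>Volterra_term T c h n s\<bar> \<le> B * exp (2 * M * T) * (1/2)^n" if "s \<in> {0<..<T}" for n s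
    using Volterra_term_le[where c=c and h=h, OF M c h that] .
  have B: "0 \<le> B" using order_trans[OF abs_ge_zero h[OF t]] .
  let ?g = "\<lambda>n s. if s < t then c s * Volterra_term T c h n s else 0"
  let ?D = "M * (B * exp (2 * M * T))"
  have g: "summable (\<lambda>n. ?D * (1/2)^n)" by (intro summable_mult summable_geometric) simp
  have gle: "\<bar>?g n s\<bar> \<le> ?D * (1/2)^n" if "s \<in> {0<..<T}" for n s
  proof -
    have "\<bar>c s\<bar> * \<bar>Volterra_term T c h n s\<bar> \<le> M * (B * exp (2 * M * T) * (1/2)^n)"
      using c[OF that] le[OF that, of n] M by (intro mult_mono) auto
    moreover have "0 \<le> M * (B * exp (2 * M * T) * (1/2)^n)" using M B by simp
    ultimately show ?thesis by (simp add: abs_mult mult.assoc)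
  qed
  have gm: "?g n \<in> borel_measurable (interval_measure T)" for n
    by measurable
  have gi: "integrable (interval_measure T) (?g n)" for n
    by (rule integrable_const_bound[OF _ gm, where B="?D * (1/2)^n"]) (rule AE_I2, use gle[where n=n] in simp)
  have "(LINT s|interval_measure T. (\<Sum>n. ?g n s)) = (\<Sum>n. LINT s|interval_measure T. ?g n s)"
  proof (rule integral_suminf[OF gi])
    show "AE s in interval_measure T. summable (\<lambda>n. norm (?g n s))"
      by (intro AE_I2 summable_comparison_test'[OF g, of 0]) (use gle in auto)
    show "summable (\<lambda>n. LINT s|interval_measure T. norm (?g n s))"
    proof (rule summable_comparison_test'[of "\<lambda>n. (?D * (1/2)^n) * measure (interval_measure T) {0<..<T}" 0])
      show "summable (\<lambda>n. (?D * (1/2)^n) * measure (interval_measure T) {0<..<T})"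
        using g by (rule summable_mult2)
      fix n :: nat
      have "(LINT s|interval_measure T. norm (?g n s)) \<le> (LINT s|interval_measure T. ?D * (1/2)^n)"
        by (rule integral_mono) (use gi gle in auto)
      then show "norm (LINT s|interval_measure T. norm (?g n s)) \<le> (?D * (1/2)^n) * measure (interval_measure T) {0<..<T}"
        by (simp add: ac_simps)
    qed
  qed
  also have "(LINT s|interval_measure T. (\<Sum>n. ?g n s)) =
      (LINT s|interval_measure T. (if s < t then c s * Volterra_sol T c h s else 0))"
  proof (rule Bochner_Integration.integral_cong)
    fix s assume "s \<in> space (interval_measure T)"
    then have "summable (\<lambda>n. Volterra_term T c h n s)"
      using Volterra_summable[where c=c and h=h, OF M c h] by simp
    then show "(\<Sum>n. ?g n s) = (if s < t then c s * Volterra_sol T c h s else 0)"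
      by (simp add: Volterra_sol_def suminf_mult)
  qed simp
  finally have eq: "(LINT s|interval_measure T. (if s < t then c s * Volterra_sol T c h s else 0)) =
      (\<Sum>n. - Volterra_term T c h (Suc n) t)" by simp
  have sm: "summable (\<lambda>n. Volterra_term T c h n t)"
    by (rule Volterra_summable[where c=c and h=h, OF M c h t])
  then have "summable (\<lambda>n. Volterra_term T c h (Suc n) t)"
    by (rule iffD2[OF summable_Suc_iff])
  from suminf_minus[OF this] suminf_split_head[OF sm] eq show ?thesis
    by (simp add: Volterra_sol_def del: Volterra_term.simps(2))
qed

text \<open>A solution of \<open>v = - A v\<close> equals every term of its own Neumann series, and these tend to zero.\<close>
lemma Volterra_homogeneous_zero:
  fixes c v :: "real \<Rightarrow> real"
  assumes M: "0 < M" and c: "\<And>s. s \<in> {0<..<T} \<Longrightarrow> \<bar>c s\<bar> \<le> M"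
    and v: "\<And>s. s \<in> {0<..<T} \<Longrightarrow> \<bar>v s\<bar> \<le> B"
    and eq: "\<And>t. t \<in> {0<..<T} \<Longrightarrow> v t = - (LINT s|interval_measure T. (if s < t then c s * v s else 0))"
    and t: "t \<in> {0<..<T}"
  shows "v t = 0"
proof -
  have "Volterra_term T c v n s = v s" if "s \<in> {0<..<T}" for n s
    using that
  proof (induction n arbitrary: s)
    case (Suc n)
    have "(LINT r|interval_measure T. (if r < s then c r * Volterra_term T c v n r else 0)) =
      (LINT r|interval_measure T. (if r < s then c r * v r else 0))"
      using Suc.IH by (intro Bochner_Integration.integral_cong) auto
    then show ?case using eq[OF Suc.prems] by simp
  qed simp
  then have le: "\<bar>v t\<bar> \<le> B * exp (2 * M * T) * (1/2)^n" for n
    using Volterra_term_le[where c=c and h=v and n=n, OF M c v t] t by simp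
  have "(\<lambda>n. B * exp (2 * M * T) * (1/2)^n) \<longlonglongrightarrow> B * exp (2 * M * T) * 0"
    by (intro tendsto_intros LIMSEQ_power_zero) simp
  from LIMSEQ_le_const[OF this, of "\<bar>v t\<bar>"] le have "\<bar>v t\<bar> \<le> B * exp (2 * M * T) * 0"
    by blast
  then show ?thesis by simp
qed

lemma interval_measure_cut_swap:
  fixes f g :: "real \<Rightarrow> real"
  assumes f: "integrable (interval_measure T) f" and g: "integrable (interval_measure T) g"
  shows "(LINT t|interval_measure T. g t * (LINT s|interval_measure T. (if s < t then f s else 0))) =
         (LINT s|interval_measure T. f s * (LINT t|interval_measure T. (if s < t then g t else 0)))"
proof -
  let ?L = "interval_measure T"
  interpret L: finite_measure ?L by (rule finite_interval_measure)
  interpret pair_sigma_finite ?L ?L ..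
  have fst[measurable]: "fst \<in> ?L \<Otimes>\<^sub>M ?L \<rightarrow>\<^sub>M borel" and snd[measurable]: "snd \<in> ?L \<Otimes>\<^sub>M ?L \<rightarrow>\<^sub>M borel"
    using measurable_compose[OF measurable_fst measurable_interval_measure_ident]
      measurable_compose[OF measurable_snd measurable_interval_measure_ident] by simp_all
  have [measurable]: "f \<in> borel_measurable ?L" "g \<in> borel_measurable ?L" using f g by auto
  have prod: "integrable (?L \<Otimes>\<^sub>M ?L) (\<lambda>(t, s). g t * f s)"
    by (rule Fubini_integrable) (use f g in \<open>auto simp: abs_mult\<close>)
  have cut: "(\<lambda>(t, s). if s < t then g t * f s else 0) \<in> borel_measurable (?L \<Otimes>\<^sub>M ?L)"
    by measurable
  have "integrable (?L \<Otimes>\<^sub>M ?L) (\<lambda>(t, s). if s < t then g t * f s else 0)"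
    by (rule Bochner_Integration.integrable_bound[OF prod cut]) auto
  from Fubini_integral[OF this]
  have "(LINT s|?L. LINT t|?L. (if s < t then g t * f s else 0)) =
        (LINT t|?L. LINT s|?L. (if s < t then g t * f s else 0))" .
  moreover have "(LINT t|?L. (if s < t then g t * f s else 0)) = f s * (LINT t|?L. (if s < t then g t else 0))" for s
    unfolding integral_mult_right_zero[symmetric] by (rule Bochner_Integration.integral_cong) auto
  moreover have "(LINT s|?L. (if s < t then g t * f s else 0)) = g t * (LINT s|?L. (if s < t then f s else 0))" for t
    unfolding integral_mult_right_zero[symmetric] by (rule Bochner_Integration.integral_cong) auto
  ultimately show ?thesis by simp
qed

lemma interval_measure_cut_integrable:
  fixes f :: "real \<Rightarrow> real"
  assumes "integrable (interval_measure T) f"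
  shows "integrable (interval_measure T) (\<lambda>s. if s < t then f s else 0)"
    "integrable (interval_measure T) (\<lambda>s. if t < s then f s else 0)"
  using borel_measurable_integrable[OF assms]
  by (auto intro!: Bochner_Integration.integrable_bound[OF assms] interval_measure_cut_measurable)

lemma interval_measure_cut_abs_le:
  fixes f :: "real \<Rightarrow> real"
  assumes "integrable (interval_measure T) f"
  shows "\<bar>LINT s|interval_measure T. (if s < t then f s else 0)\<bar> \<le> (LINT s|interval_measure T. \<bar>f s\<bar>)"
proof -
  have "\<bar>LINT s|interval_measure T. (if s < t then f s else 0)\<bar> \<le> (LINT s|interval_measure T. \<bar>if s < t then f s else 0\<bar>)"
    by (rule integral_abs_bound)
  also have "\<dots> \<le> (LINT s|interval_measure T. \<bar>f s\<bar>)"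
    using assms by (intro integral_mono') auto
  finally show ?thesis .
qed

text \<open>
  The derivative is given on the open interval, where it may be unbounded near the ends.  The
  gauge integral has a fundamental theorem of calculus for this situation; integrability of \<open>v'\<close> converts the result
  into a Lebesgue integral.
\<close>
lemma interval_measure_FTC:
  fixes v v' :: "real \<Rightarrow> real"
  assumes cont: "continuous_on {0..T} v"
    and deriv: "\<And>t. t \<in> {0<..<T} \<Longrightarrow> (v has_real_derivative v' t) (at t)"
    and int: "integrable (interval_measure T) v'"
    and s: "0 \<le> s" "s \<le> T"
  shows "(LINT t|interval_measure T. (if s < t then v' t else 0)) = v T - v s"
proof -
  have i: "integrable lborel (\<lambda>t. indicator {0<..<T} t *\<^sub>R (if s < t then v' t else 0))"
    using interval_measure_cut_integrable(2)[OF int, of s] unfolding interval_measure_def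
    by (subst (asm) integrable_restrict_space) auto
  have eq: "(\<lambda>t. indicator {0<..<T} t *\<^sub>R (if s < t then v' t else 0)) = (\<lambda>t. if t \<in> {s<..<T} then v' t else 0)"
    using s by (auto simp: fun_eq_iff)
  have "(v' has_integral (v T - v s)) {s..T}"
    using s by (intro fundamental_theorem_of_calculus_interior)
      (auto intro!: continuous_on_subset[OF cont] deriv simp: has_real_derivative_iff_has_vector_derivative[symmetric])
  then have "(v' has_integral (v T - v s)) {s<..<T}"
    by (simp add: has_integral_Icc_iff_Ioo)
  then have 1: "((\<lambda>t. if t \<in> {s<..<T} then v' t else 0) has_integral (v T - v s)) UNIV"
    by (simp only: has_integral_restrict_UNIV)
  have "((\<lambda>t. if t \<in> {s<..<T} then v' t else 0) has_integral
      (LINT t|lborel. indicator {0<..<T} t *\<^sub>R (if s < t then v' t else 0))) UNIV"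
    using has_integral_integral_lborel[OF i] by (simp only: eq)
  from has_integral_unique[OF 1 this] show ?thesis
    unfolding interval_measure_def by (subst integral_restrict_space) auto
qed

text \<open>
  Integration by parts for \<open>u' = f - c u\<close>, \<open>u(0) = u\<^sub>0\<close>, against \<open>v\<close> with \<open>v(T) = 0\<close>.  Here \<open>u\<close> is known
  through its integral equation and \<open>v(s) = - \<integral>\<^sub>s\<^sup>T v' dt\<close>, so the product rule is replaced by
  exchanging the order of integration over the triangle \<open>s < t\<close>.
\<close>
lemma Volterra_duality:
  fixes f c u v v' :: "real \<Rightarrow> real"
  assumes f: "integrable (interval_measure T) f"
    and c: "\<And>s. s \<in> {0<..<T} \<Longrightarrow> \<bar>c s\<bar> \<le> M" and cm: "c \<in> borel_measurable (interval_measure T)"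
    and um: "u \<in> borel_measurable (interval_measure T)" and ub: "\<And>s. s \<in> {0<..<T} \<Longrightarrow> \<bar>u s\<bar> \<le> B"
    and ueq: "\<And>t. t \<in> {0<..<T} \<Longrightarrow>
      u t = u\<^sub>0 + (LINT s|interval_measure T. (if s < t then f s else 0))
              - (LINT s|interval_measure T. (if s < t then c s * u s else 0))"
    and T: "0 < T" and cont: "continuous_on {0..T} v" and vT: "v T = 0"
    and deriv: "\<And>t. t \<in> {0<..<T} \<Longrightarrow> (v has_real_derivative v' t) (at t)"
    and v': "integrable (interval_measure T) v'"
  shows "(LINT t|interval_measure T. u t * (- v' t + c t * v t)) =
         (LINT t|interval_measure T. f t * v t) + u\<^sub>0 * v 0"
proof -
  let ?L = "interval_measure T"
  interpret finite_measure ?L by (rule finite_interval_measure)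
  note [measurable] = cm um
  have FTC: "(LINT t|?L. (if s < t then v' t else 0)) = - v s" if "0 \<le> s" "s \<le> T" for s
    using interval_measure_FTC[OF cont deriv v' that] vT by simp
  have vm[measurable]: "v \<in> borel_measurable ?L"
  proof -
    have "continuous_on {0<..<T} v" by (rule continuous_on_subset[OF cont]) auto
    then show ?thesis unfolding interval_measure_def
      by (subst measurable_cong_sets[OF sets_restrict_space_cong[of lborel borel] refl])
        (auto intro: borel_measurable_continuous_on_restrict)
  qed
  have "bounded (v ` {0..T})"
    by (intro compact_imp_bounded compact_continuous_image cont) simp
  then obtain V where V: "\<And>s. s \<in> {0<..<T} \<Longrightarrow> \<bar>v s\<bar> \<le> V"
    by (fastforce simp: bounded_iff)
  have bnd: "integrable ?L (\<lambda>s. g s * w s)" if "integrable ?L g" "w \<in> borel_measurable ?L" "\<And>s. s \<in> {0<..<T} \<Longrightarrow> \<bar>w s\<bar> \<le> W"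
    for g w :: "real \<Rightarrow> real" and W
  proof (rule Bochner_Integration.integrable_bound)
    show "integrable ?L (\<lambda>s. W * g s)" using that by simp
    show "(\<lambda>s. g s * w s) \<in> borel_measurable ?L" using that by auto
    show "AE s in ?L. norm (g s * w s) \<le> norm (W * g s)"
    proof (rule AE_I2)
      fix s assume "s \<in> space ?L"
      then have "\<bar>w s\<bar> \<le> \<bar>W\<bar>" using that(3)[of s] by simp
      then show "norm (g s * w s) \<le> norm (W * g s)"
        by (simp add: abs_mult mult.commute[of "\<bar>W\<bar>"] mult_left_mono)
    qed
  qed
  have cu: "integrable ?L (\<lambda>s. c s * u s)"
    by (rule bnd[OF integrable_const_bound[OF _ cm, of M] um ub]) (use c in auto)
  have iR: "integrable ?L (\<lambda>s. f s - c s * u s)" using f cu by simp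
  have u: "u t = u\<^sub>0 + (LINT s|?L. (if s < t then f s - c s * u s else 0))" if "t \<in> {0<..<T}" for t
  proof -
    have "(LINT s|?L. (if s < t then f s - c s * u s else 0)) =
        (LINT s|?L. (if s < t then f s else 0) - (if s < t then c s * u s else 0))"
      by (rule Bochner_Integration.integral_cong) auto
    also have "\<dots> = (LINT s|?L. (if s < t then f s else 0)) - (LINT s|?L. (if s < t then c s * u s else 0))"
      by (intro Bochner_Integration.integral_diff interval_measure_cut_integrable f cu)
    finally show ?thesis using ueq[OF that] by simp
  qed
  have iuv': "integrable ?L (\<lambda>t. v' t * u t)" by (rule bnd[OF v' um ub])
  have "(LINT t|?L. v' t * u t) =
      (LINT t|?L. u\<^sub>0 * v' t + v' t * (LINT s|?L. (if s < t then f s - c s * u s else 0)))"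
    by (rule Bochner_Integration.integral_cong) (auto simp: u algebra_simps)
  also have "\<dots> = u\<^sub>0 * (LINT t|?L. v' t) + (LINT t|?L. v' t * (LINT s|?L. (if s < t then f s - c s * u s else 0)))"
  proof -
    have "integrable ?L (\<lambda>t. v' t * u t - u\<^sub>0 * v' t)" using iuv' v' by simp
    then have "integrable ?L (\<lambda>t. v' t * (LINT s|?L. (if s < t then f s - c s * u s else 0)))"
      by (rule Bochner_Integration.integrable_cong[THEN iffD1, rotated -1]) (auto simp: u algebra_simps)
    then show ?thesis using v' by simp
  qed
  also have "(LINT t|?L. v' t * (LINT s|?L. (if s < t then f s - c s * u s else 0))) =
      (LINT s|?L. (f s - c s * u s) * (LINT t|?L. (if s < t then v' t else 0)))"
    by (rule interval_measure_cut_swap[OF iR v'])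
  also have "\<dots> = (LINT s|?L. - ((f s - c s * u s) * v s))"
    by (rule Bochner_Integration.integral_cong) (auto simp: FTC)
  also have "\<dots> = - (LINT s|?L. f s * v s) + (LINT s|?L. (c s * u s) * v s)"
    using bnd[OF f vm V] bnd[OF cu vm V] by (simp add: left_diff_distrib)
  also have "(LINT t|?L. v' t) = - v 0"
  proof -
    have "(LINT t|?L. v' t) = (LINT t|?L. (if 0 < t then v' t else 0))"
      by (rule Bochner_Integration.integral_cong) auto
    then show ?thesis using FTC[of 0] T by simp
  qed
  finally have "(LINT t|?L. v' t * u t) = - u\<^sub>0 * v 0 - (LINT s|?L. f s * v s) + (LINT s|?L. (c s * u s) * v s)"
    by simp
  moreover have "(LINT t|?L. u t * (- v' t + c t * v t)) = (LINT t|?L. (c t * u t) * v t - v' t * u t)"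
    by (rule Bochner_Integration.integral_cong) (auto simp: algebra_simps)
  moreover have "\<dots> = (LINT s|?L. (c s * u s) * v s) - (LINT t|?L. v' t * u t)"
    by (intro Bochner_Integration.integral_diff iuv' bnd[OF cu vm V])
  ultimately show ?thesis by simp
qed

text \<open>
  The function \<open>\<eta>(t) = (T\<^sup>k\<^sup>+\<^sup>1 - t\<^sup>k\<^sup>+\<^sup>1) / (k + 1)\<close> satisfies \<open>- \<eta>' = t\<^sup>k\<close> and \<open>\<eta>(T) = 0\<close>, so the
  hypothesis says that \<open>w\<close> is orthogonal to \<open>- \<eta>' + c \<eta>\<close>.  Exchanging the integrals moves \<open>c\<close> onto the
  other side: \<open>w(t) + \<integral>\<^sub>0\<^sup>t c w ds\<close> is orthogonal to all monomials and hence zero.  The primitive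
  \<open>p\<close> of \<open>c w\<close> is bounded, although \<open>w\<close> need not be, and it solves the homogeneous Volterra equation.
\<close>
lemma Volterra_dual_uniqueness:
  fixes w c :: "real \<Rightarrow> real"
  assumes w: "integrable (interval_measure T) w"
    and M: "0 < M" and c: "\<And>s. s \<in> {0<..<T} \<Longrightarrow> \<bar>c s\<bar> \<le> M" and cm: "c \<in> borel_measurable (interval_measure T)"
    and orth: "\<And>k. (LINT t|interval_measure T. w t * (t ^ k + c t * ((T ^ Suc k - t ^ Suc k) / real (Suc k)))) = 0"
  shows "AE t in interval_measure T. w t = 0"
proof -
  let ?L = "interval_measure T"
  interpret finite_measure ?L by (rule finite_interval_measure)
  have wm[measurable]: "w \<in> borel_measurable ?L" using w by auto
  note [measurable] = cm
  have cw: "integrable ?L (\<lambda>s. c s * w s)"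
  proof (rule Bochner_Integration.integrable_bound)
    show "integrable ?L (\<lambda>s. M * w s)" using w by simp
    show "AE s in ?L. norm (c s * w s) \<le> norm (M * w s)"
      using c M by (intro AE_I2) (auto simp: abs_mult intro!: mult_right_mono)
  qed measurable
  define p where "p t = (LINT s|?L. (if s < t then c s * w s else 0))" for t
  have pb: "\<bar>p t\<bar> \<le> (LINT s|?L. \<bar>c s * w s\<bar>)" for t
    unfolding p_def by (rule interval_measure_cut_abs_le[OF cw])
  have fst[measurable]: "fst \<in> ?L \<Otimes>\<^sub>M ?L \<rightarrow>\<^sub>M borel" and snd[measurable]: "snd \<in> ?L \<Otimes>\<^sub>M ?L \<rightarrow>\<^sub>M borel"
    using measurable_compose[OF measurable_fst measurable_interval_measure_ident]
      measurable_compose[OF measurable_snd measurable_interval_measure_ident] by simp_all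
  have pm[measurable]: "p \<in> borel_measurable ?L"
    unfolding p_def by (rule borel_measurable_lebesgue_integral) measurable
  have ip: "integrable ?L p"
    by (rule integrable_const_bound[OF _ pm]) (auto intro!: AE_I2 pb)
  have tk: "integrable ?L (\<lambda>t. t ^ k)" for k
    by (rule integrable_const_bound[where B="\<bar>T\<bar> ^ k"]) (auto intro!: AE_I2 power_mono simp: power_abs)
  have power: "integrable ?L (\<lambda>t. t ^ k * g t)" if "integrable ?L g" for g :: "real \<Rightarrow> real" and k
  proof (rule Bochner_Integration.integrable_bound)
    show "integrable ?L (\<lambda>t. \<bar>T\<bar> ^ k * g t)" using that by simp
    show "AE t in ?L. norm (t ^ k * g t) \<le> norm (\<bar>T\<bar> ^ k * g t)"
      by (intro AE_I2) (auto simp: abs_mult power_abs intro!: mult_right_mono power_mono)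
  qed (use that in measurable)
  have mono: "(LINT t|?L. (w t + p t) * t ^ k) = 0" for k
  proof -
    have FTC: "(LINT t|?L. (if s < t then t ^ k else 0)) = (T ^ Suc k - s ^ Suc k) / real (Suc k)" if "s \<in> {0<..<T}" for s
    proof -
      have "(LINT t|?L. (if s < t then t ^ k else 0)) = T ^ Suc k / real (Suc k) - s ^ Suc k / real (Suc k)"
      proof (rule interval_measure_FTC[where v="\<lambda>t. t ^ Suc k / real (Suc k)"])
        show "((\<lambda>t. t ^ Suc k / real (Suc k)) has_real_derivative t ^ k) (at t)" for t
          by (rule derivative_eq_intros refl | simp)+
        show "continuous_on {0..T} (\<lambda>t. t ^ Suc k / real (Suc k))"
          by (intro continuous_intros) simp
      qed (use that tk in auto)
      then show ?thesis by (simp only: diff_divide_distrib)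
    qed
    have "(LINT t|?L. t ^ k * p t) = (LINT s|?L. (c s * w s) * (LINT t|?L. (if s < t then t ^ k else 0)))"
      unfolding p_def by (rule interval_measure_cut_swap[OF cw tk])
    also have "\<dots> = (LINT s|?L. (c s * w s) * ((T ^ Suc k - s ^ Suc k) / real (Suc k)))"
      by (rule Bochner_Integration.integral_cong) (auto simp: FTC simp del: power_Suc of_nat_Suc)
    finally have 1: "(LINT t|?L. t ^ k * p t) = (LINT s|?L. (c s * w s) * ((T ^ Suc k - s ^ Suc k) / real (Suc k)))" .
    have i2: "integrable ?L (\<lambda>s. (c s * w s) * ((T ^ Suc k - s ^ Suc k) / real (Suc k)))"
    proof -
      have "integrable ?L (\<lambda>s. (T ^ Suc k / real (Suc k)) * (c s * w s) - (1 / real (Suc k)) * (s ^ Suc k * (c s * w s)))"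
        by (intro Bochner_Integration.integrable_diff integrable_mult_right cw power)
      then show ?thesis by (simp add: field_simps del: power_Suc of_nat_Suc)
    qed
    have "(LINT t|?L. (w t + p t) * t ^ k) = (LINT t|?L. t ^ k * w t + t ^ k * p t)"
      by (simp add: algebra_simps)
    also have "\<dots> = (LINT t|?L. t ^ k * w t) + (LINT t|?L. t ^ k * p t)"
      by (intro Bochner_Integration.integral_add power w ip)
    also have "\<dots> = (LINT t|?L. t ^ k * w t + (c t * w t) * ((T ^ Suc k - t ^ Suc k) / real (Suc k)))"
      unfolding 1 by (intro Bochner_Integration.integral_add[symmetric] power w i2)
    also have "\<dots> = (LINT t|?L. w t * (t ^ k + c t * ((T ^ Suc k - t ^ Suc k) / real (Suc k))))"
      by (rule Bochner_Integration.integral_cong) (auto simp: algebra_simps simp del: power_Suc of_nat_Suc)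
    finally show ?thesis using orth by simp
  qed
  have "AE t in ?L. w t + p t = 0"
  proof (rule AE_zero_if_orthogonal_to_polynomials[of "{0<..<T}"])
    show "sets ?L = sets (restrict_space borel {0<..<T})"
      unfolding interval_measure_def by (intro sets_restrict_space_cong) simp
    show "integrable ?L (\<lambda>t. w t + p t)" using w ip by simp
    fix q :: "real \<Rightarrow> real" assume "real_polynomial_function q"
    then obtain a n where q: "q = (\<lambda>t. \<Sum>i\<le>n. a i * t ^ i)"
      by (auto simp: real_polynomial_function_iff_sum)
    have i: "integrable ?L (\<lambda>t. (w t + p t) * t ^ i)" for i
      using power[of "\<lambda>t. w t + p t" i] w ip by (simp add: mult.commute)
    have "(LINT t|?L. (w t + p t) * q t) = (LINT t|?L. (\<Sum>i\<le>n. a i * ((w t + p t) * t ^ i)))"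
      by (rule Bochner_Integration.integral_cong) (auto simp: q sum_distrib_left ac_simps)
    also have "\<dots> = (\<Sum>i\<le>n. a i * (LINT t|?L. (w t + p t) * t ^ i))"
      using i by (subst Bochner_Integration.integral_sum) auto
    finally show "(LINT t|?L. (w t + p t) * q t) = 0" by (simp add: mono)
  qed simp
  then have wp: "AE t in ?L. w t = - p t" by eventually_elim simp
  have "p t = 0" if "t \<in> {0<..<T}" for t
  proof (rule Volterra_homogeneous_zero[OF M c _ _ that])
    show "\<bar>p s\<bar> \<le> (LINT s|?L. \<bar>c s * w s\<bar>)" for s by (rule pb)
    fix t
    have "p t = (LINT s|?L. (if s < t then c s * - p s else 0))"
      unfolding p_def[of t] by (rule integral_cong_AE) (use wp in auto)
    also have "\<dots> = (LINT s|?L. - (if s < t then c s * p s else 0))"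
      by (rule Bochner_Integration.integral_cong) auto
    finally show "p t = - (LINT s|?L. (if s < t then c s * p s else 0))" by simp
  qed
  then have "AE t in ?L. p t = 0" by (intro AE_I2) simp
  with wp show ?thesis by eventually_elim simp
qed

section \<open>Volterra equations depending on a parameter\<close>

lemma (in finite_measure) square_of_integral_abs_le:
  assumes "f \<in> L2 M"
  shows "(LINT x|M. \<bar>f x\<bar>)\<^sup>2 \<le> measure M (space M) * (LINT x|M. (f x)\<^sup>2)"
proof -
  have abs: "(\<lambda>x. \<bar>f x\<bar>) \<in> L2 M" using assms by (auto simp: L2_def)
  have 1: "(\<lambda>x. 1) \<in> L2 M" by (rule L2_bounded[of _ 1]) auto
  have "\<bar>L2_inner M (\<lambda>x. 1) (\<lambda>x. \<bar>f x\<bar>)\<bar>\<^sup>2 \<le> (L2_norm M (\<lambda>x. 1) * L2_norm M (\<lambda>x. \<bar>f x\<bar>))\<^sup>2"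
    by (intro power_mono L2_Cauchy_Schwarz abs 1) simp
  then show ?thesis
    by (simp add: power_mult_distrib L2_norm_square) (simp add: L2_inner_def)
qed

text \<open>Joint measurability in time and parameter, which makes the solution for each \<open>x\<close> a function on the product.\<close>
lemma Volterra_term_measurable:
  fixes C H :: "real \<times> 'x \<Rightarrow> real"
  assumes [measurable]: "C \<in> borel_measurable (interval_measure T \<Otimes>\<^sub>M N)"
    "H \<in> borel_measurable (interval_measure T \<Otimes>\<^sub>M N)"
  shows "(\<lambda>(t, x). Volterra_term T (\<lambda>s. C (s, x)) (\<lambda>s. H (s, x)) n t)
    \<in> borel_measurable (interval_measure T \<Otimes>\<^sub>M N)"
proof (induction n)
  case 0
  then show ?case by simp
next
  case (Suc n)
  interpret L: finite_measure "interval_measure T" by (rule finite_interval_measure)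
  let ?P = "interval_measure T \<Otimes>\<^sub>M N"
  note [measurable] = Suc
  have [measurable]: "(\<lambda>z. fst (fst z)) \<in> ?P \<Otimes>\<^sub>M interval_measure T \<rightarrow>\<^sub>M borel"
    "snd \<in> ?P \<Otimes>\<^sub>M interval_measure T \<rightarrow>\<^sub>M borel"
    using measurable_compose[OF measurable_compose[OF measurable_fst measurable_fst] measurable_interval_measure_ident]
     measurable_compose[OF measurable_snd measurable_interval_measure_ident] by simp_all
  have swap: "(\<lambda>z. (snd z, snd (fst z))) \<in> ?P \<Otimes>\<^sub>M interval_measure T \<rightarrow>\<^sub>M ?P"
    by measurable
  have [measurable]: "(\<lambda>z. C (snd z, snd (fst z))) \<in> borel_measurable (?P \<Otimes>\<^sub>M interval_measure T)"
    by (rule measurable_compose[OF swap]) measurable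
  have [measurable]: "(\<lambda>z. Volterra_term T (\<lambda>s. C (s, snd (fst z))) (\<lambda>s. H (s, snd (fst z))) n (snd z))
      \<in> borel_measurable (?P \<Otimes>\<^sub>M interval_measure T)"
    using measurable_compose[OF swap Suc] by simp
  have "(\<lambda>(y, s). if s < fst y then C (s, snd y) * Volterra_term T (\<lambda>s. C (s, snd y)) (\<lambda>s. H (s, snd y)) n s else 0)
      \<in> borel_measurable (?P \<Otimes>\<^sub>M interval_measure T)"
    unfolding case_prod_beta' by measurable
  from L.borel_measurable_lebesgue_integral[OF this]
  show ?case by (simp add: case_prod_beta')
qed

lemma interval_measure_primitive_measurable:
  fixes F :: "real \<times> 'x \<Rightarrow> real"
  assumes F[measurable]: "F \<in> borel_measurable (interval_measure T \<Otimes>\<^sub>M N)"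
  shows "(\<lambda>(t, x). LINT s|interval_measure T. (if s < t then F (s, x) else 0))
    \<in> borel_measurable (interval_measure T \<Otimes>\<^sub>M N)"
  \<comment> \<open>With coefficient \<open>1\<close>, the first Neumann term is minus the primitive of \<open>F\<close>.\<close>
  using borel_measurable_uminus[OF Volterra_term_measurable[where n="Suc 0", of "\<lambda>_. 1", OF _ F]]
  by (simp add: case_prod_beta' cong: if_cong)

locale interval_product =
  fixes T :: real and N :: "'x measure"
  assumes T: "0 < T" and N: "finite_measure N"
begin

abbreviation "L \<equiv> interval_measure T"
abbreviation "P \<equiv> interval_measure T \<Otimes>\<^sub>M N"

sublocale L: finite_measure L by (rule finite_interval_measure)
sublocale N: finite_measure N by (rule N)
sublocale pair_sigma_finite L N ..
sublocale P: finite_measure P by (rule finite_measure_pair_measure) (rule L.finite_measure_axioms N)+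

lemma L2_slice:
  assumes "F \<in> L2 P"
  shows "AE x in N. (\<lambda>t. F (t, x)) \<in> L2 L"
proof -
  have [measurable]: "F \<in> borel_measurable P" using assms by (rule L2_measurable)
  have "AE x in N. integrable L (\<lambda>t. (F (t, x))\<^sup>2)"
    using L2_square_integrable[OF assms] by (intro AE_integrable_snd) (simp add: case_prod_beta')
  moreover have "AE x in N. (\<lambda>t. F (t, x)) \<in> borel_measurable L"
    by (intro AE_I2) measurable
  ultimately show ?thesis by eventually_elim (simp add: L2_def)
qed

text \<open>
  For almost every \<open>x\<close> the slice \<open>F(\<cdot>, x)\<close> is square-integrable, and then
  \<open>\<bar>U(t, x)\<bar> \<le> 2 exp (2 M T) B(x)\<close> with \<open>B(x) = \<bar>g(x)\<bar> + \<integral> \<bar>F(s, x)\<bar> ds\<close>.  Squaring, Cauchy-Schwarz in \<open>s\<close> and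
  integration over \<open>x\<close> give the \<open>L\<^sup>2\<close> bound.  The dependence of the constant on \<open>M\<close> and \<open>T\<close> alone is
  what the duality argument of the energy estimate needs.
\<close>
lemma Volterra_sol_family:
  assumes M: "0 < M" and C: "C \<in> borel_measurable P" "\<And>z. z \<in> space P \<Longrightarrow> \<bar>C z\<bar> \<le> M"
    and F: "F \<in> L2 P" and g: "g \<in> L2 N"
  obtains U where "U \<in> L2 P"
    "(L2_norm P U)\<^sup>2 \<le> 8 * T * (1 + T) * (exp (2 * M * T))\<^sup>2 * ((L2_norm P F)\<^sup>2 + (L2_norm N g)\<^sup>2)"
    "AE x in N. (\<exists>B. \<forall>t\<in>{0<..<T}. \<bar>U (t, x)\<bar> \<le> B) \<and>
      (\<forall>t\<in>{0<..<T}. U (t, x) = g x + (LINT s|L. (if s < t then F (s, x) else 0))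
              - (LINT s|L. (if s < t then C (s, x) * U (s, x) else 0)))"
proof -
  have Fm[measurable]: "F \<in> borel_measurable P" using F by (rule L2_measurable)
  have gm[measurable]: "g \<in> borel_measurable N" using g by (rule L2_measurable)
  define H where "H = (\<lambda>(t, x). g x + (LINT s|L. (if s < t then F (s, x) else 0)))"
  have Hm: "H \<in> borel_measurable P"
    unfolding H_def using interval_measure_primitive_measurable[OF Fm] by (simp add: case_prod_beta')
  define U where "U = (\<lambda>(t, x). Volterra_sol T (\<lambda>s. C (s, x)) (\<lambda>s. H (s, x)) t)"
  note tm = Volterra_term_measurable[OF C(1) Hm]
  have Um[measurable]: "U \<in> borel_measurable P"
    using borel_measurable_suminf[OF tm] by (simp add: U_def Volterra_sol_def case_prod_beta')
  define B where "B x = \<bar>g x\<bar> + (LINT s|L. \<bar>F (s, x)\<bar>)" for x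
  have slice: "\<bar>U (t, x)\<bar> \<le> 2 * exp (2 * M * T) * B x"
    "U (t, x) = H (t, x) - (LINT s|L. (if s < t then C (s, x) * U (s, x) else 0))"
    if x: "x \<in> space N" and Fx: "integrable L (\<lambda>s. F (s, x))" and t: "t \<in> {0<..<T}" for t x
  proof -
    have c: "\<bar>C (s, x)\<bar> \<le> M" if "s \<in> {0<..<T}" for s
      using C(2) that x by (simp add: space_pair_measure)
    have h: "\<bar>H (s, x)\<bar> \<le> B x" if "s \<in> {0<..<T}" for s
      using interval_measure_cut_abs_le[OF Fx, of s] by (simp add: H_def B_def)
    show "\<bar>U (t, x)\<bar> \<le> 2 * exp (2 * M * T) * B x"
      using Volterra_sol_le[where c="\<lambda>s. C (s, x)" and h="\<lambda>s. H (s, x)", OF M c h t]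
      by (simp add: U_def)
    have cm: "(\<lambda>s. C (s, x)) \<in> borel_measurable L"
      using C(1) x by measurable
    have vm: "Volterra_term T (\<lambda>s. C (s, x)) (\<lambda>s. H (s, x)) n \<in> borel_measurable L" for n
      using measurable_Pair1[OF tm x, of n] by simp
    show "U (t, x) = H (t, x) - (LINT s|L. (if s < t then C (s, x) * U (s, x) else 0))"
      using Volterra_sol_eq[where c="\<lambda>s. C (s, x)" and h="\<lambda>s. H (s, x)", OF M c h t cm vm]
      by (simp add: U_def cong: if_cong)
  qed
  \<comment> \<open>\<open>8\<close> is \<open>4\<close>, the square of the factor \<open>2\<close> in the bound of \<open>U\<close>, times \<open>2\<close> from \<open>(a + b)\<^sup>2 \<le> 2 a\<^sup>2 + 2 b\<^sup>2\<close>.\<close>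
  define k where "k = 8 * (exp (2 * M * T))\<^sup>2"
  have k0: "0 \<le> k" by (simp add: k_def)
  have mT: "measure L (space L) \<le> T"
    by (simp add: interval_measure_def measure_def emeasure_restrict_space) (use T in simp)
  have bound: "(U (t, x))\<^sup>2 \<le> k * ((g x)\<^sup>2 + T * (LINT s|L. (F (s, x))\<^sup>2))"
    if x: "x \<in> space N" and Fx: "(\<lambda>s. F (s, x)) \<in> L2 L" and t: "t \<in> {0<..<T}" for t x
  proof -
    have "\<bar>U (t, x)\<bar>\<^sup>2 \<le> (2 * exp (2 * M * T) * B x)\<^sup>2"
      using slice(1)[OF x L.L2_integrable[OF Fx] t] by (rule power_mono) simp
    also have "\<dots> = (exp (2 * M * T))\<^sup>2 * 4 * (B x)\<^sup>2"
      by (simp add: power_mult_distrib)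
    also have "(B x)\<^sup>2 \<le> 2 * (g x)\<^sup>2 + 2 * (LINT s|L. \<bar>F (s, x)\<bar>)\<^sup>2"
      using sum_squares_bound[of "\<bar>g x\<bar>" "LINT s|L. \<bar>F (s, x)\<bar>"] by (simp add: B_def power2_sum)
    also have "(LINT s|L. \<bar>F (s, x)\<bar>)\<^sup>2 \<le> T * (LINT s|L. (F (s, x))\<^sup>2)"
      by (rule order_trans[OF L.square_of_integral_abs_le[OF Fx]]) (intro mult_right_mono mT, simp)
    finally show ?thesis by (simp add: k_def algebra_simps)
  qed
  have sliceF: "AE x in N. (\<lambda>s. F (s, x)) \<in> L2 L" by (rule L2_slice[OF F])
  define e where "e = k * T * ((LINT x|N. (g x)\<^sup>2) + T * (LINT z|P. (F z)\<^sup>2))"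
  have e0: "0 \<le> e" using k0 T by (simp add: e_def)
  have iP: "integrable P (\<lambda>(s, x). (F (s, x))\<^sup>2)"
    using L2_square_integrable[OF F] by (simp add: case_prod_beta')
  have iF: "integrable N (\<lambda>x. LINT s|L. (F (s, x))\<^sup>2)"
    by (rule integrable_snd[OF iP])
  have eF: "(LINT x|N. LINT s|L. (F (s, x))\<^sup>2) = (LINT z|P. (F z)\<^sup>2)"
    using integral_snd[OF iP] by (simp add: case_prod_beta')
  have ig: "integrable N (\<lambda>x. (g x)\<^sup>2)" by (rule L2_square_integrable[OF g])
  have "(\<integral>\<^sup>+z. ennreal ((U z)\<^sup>2) \<partial>P) = (\<integral>\<^sup>+x. (\<integral>\<^sup>+t. ennreal ((U (t, x))\<^sup>2) \<partial>L) \<partial>N)"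
    by (subst nn_integral_snd[symmetric]) (auto simp: case_prod_beta')
  also have "\<dots> \<le> (\<integral>\<^sup>+x. ennreal (T * (k * ((g x)\<^sup>2 + T * (LINT s|L. (F (s, x))\<^sup>2)))) \<partial>N)"
  proof (rule nn_integral_mono_AE)
    show "AE x in N. (\<integral>\<^sup>+t. ennreal ((U (t, x))\<^sup>2) \<partial>L) \<le> ennreal (T * (k * ((g x)\<^sup>2 + T * (LINT s|L. (F (s, x))\<^sup>2))))"
      using sliceF AE_space
    proof eventually_elim
      case (elim x)
      let ?K = "k * ((g x)\<^sup>2 + T * (LINT s|L. (F (s, x))\<^sup>2))"
      have "(\<integral>\<^sup>+t. ennreal ((U (t, x))\<^sup>2) \<partial>L) \<le> (\<integral>\<^sup>+t. ennreal ?K \<partial>L)"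
        using bound[OF elim(2,1)] by (intro nn_integral_mono ennreal_leI) simp
      also have "\<dots> = ennreal ?K * ennreal (measure L (space L))"
        by (simp add: L.emeasure_eq_measure)
      also have "\<dots> \<le> ennreal ?K * ennreal T"
        by (intro mult_left_mono ennreal_leI mT) simp
      also have "\<dots> = ennreal (T * ?K)"
        using T k0 by (subst ennreal_mult[symmetric]) (auto simp: mult.commute)
      finally show ?case .
    qed
  qed
  also have "\<dots> = ennreal (LINT x|N. T * (k * ((g x)\<^sup>2 + T * (LINT s|L. (F (s, x))\<^sup>2))))"
    using T k0 ig iF by (intro nn_integral_eq_integral) (auto intro!: AE_I2)
  also have "(LINT x|N. T * (k * ((g x)\<^sup>2 + T * (LINT s|L. (F (s, x))\<^sup>2)))) = e"
    using ig iF by (simp add: eF e_def)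
  also have "ennreal e = ennreal ((sqrt e)\<^sup>2)" using e0 by simp
  finally have UL2: "U \<in> L2 P" and Un: "L2_norm P U \<le> sqrt e"
    using L2_norm_le_iff[OF Um, of "sqrt e"] e0 by simp_all
  show thesis
  proof (rule that[OF UL2])
    let ?E = "(exp (2 * M * T))\<^sup>2"
    have "(L2_norm P U)\<^sup>2 \<le> (sqrt e)\<^sup>2"
      using Un L2_norm_nonneg by (rule power_mono)
    also have "\<dots> = k * T * ((L2_norm N g)\<^sup>2 + T * (L2_norm P F)\<^sup>2)"
      using e0 by (simp add: e_def L2_norm_square)
    also have "\<dots> \<le> k * T * ((1 + T) * ((L2_norm P F)\<^sup>2 + (L2_norm N g)\<^sup>2))"
      using k0 T by (intro mult_left_mono) (auto simp: algebra_simps)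
    finally show "(L2_norm P U)\<^sup>2 \<le> 8 * T * (1 + T) * (exp (2 * M * T))\<^sup>2 * ((L2_norm P F)\<^sup>2 + (L2_norm N g)\<^sup>2)"
      unfolding k_def by (simp only: ac_simps)
    show "AE x in N. (\<exists>B. \<forall>t\<in>{0<..<T}. \<bar>U (t, x)\<bar> \<le> B) \<and>
      (\<forall>t\<in>{0<..<T}. U (t, x) = g x + (LINT s|L. (if s < t then F (s, x) else 0))
              - (LINT s|L. (if s < t then C (s, x) * U (s, x) else 0)))"
      using sliceF AE_space
    proof eventually_elim
      case (elim x)
      note s = slice[OF elim(2) L.L2_integrable[OF elim(1)]]
      have "\<exists>B. \<forall>t\<in>{0<..<T}. \<bar>U (t, x)\<bar> \<le> B" using s(1) by blast
      then show ?case using s(2) by (simp add: H_def)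
    qed
  qed
qed

lemma Volterra_duality_family:
  assumes C: "C \<in> borel_measurable P" "\<And>z. z \<in> space P \<Longrightarrow> \<bar>C z\<bar> \<le> M"
    and F: "F \<in> L2 P" and g: "g \<in> L2 N" and U: "U \<in> L2 P"
    and slice: "AE x in N. (\<exists>B. \<forall>t\<in>{0<..<T}. \<bar>U (t, x)\<bar> \<le> B) \<and>
      (\<forall>t\<in>{0<..<T}. U (t, x) = g x + (LINT s|L. (if s < t then F (s, x) else 0))
              - (LINT s|L. (if s < t then C (s, x) * U (s, x) else 0)))"
    and V: "V \<in> L2 P" and V0: "(\<lambda>x. V (0, x)) \<in> L2 N" and V': "V' \<in> L2 P"
    and cont: "\<And>x. x \<in> space N \<Longrightarrow> continuous_on {0..T} (\<lambda>t. V (t, x))"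
    and VT: "\<And>x. x \<in> space N \<Longrightarrow> V (T, x) = 0"
    and deriv: "\<And>t x. x \<in> space N \<Longrightarrow> t \<in> {0<..<T} \<Longrightarrow> ((\<lambda>t. V (t, x)) has_real_derivative V' (t, x)) (at t)"
  shows "L2_inner P U (\<lambda>z. - V' z + C z * V z) = L2_inner P F V + L2_inner N g (\<lambda>x. V (0, x))"
proof -
  have [measurable]: "F \<in> borel_measurable P" "U \<in> borel_measurable P" "V \<in> borel_measurable P" "V' \<in> borel_measurable P"
    using F U V V' by (auto intro: L2_measurable)
  note [measurable] = C(1)
  have CV: "(\<lambda>z. - V' z + C z * V z) \<in> L2 P"
    using L2_diff[OF L2_mult_bounded[OF V C(1), of M] V'] C(2) by (simp add: AE_I2)
  have i1: "integrable P (\<lambda>(t, x). U (t, x) * (- V' (t, x) + C (t, x) * V (t, x)))"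
    using L2_mult_integrable[OF U CV] by (simp add: case_prod_beta')
  have i2: "integrable P (\<lambda>(t, x). F (t, x) * V (t, x))"
    using L2_mult_integrable[OF F V] by (simp add: case_prod_beta')
  have "L2_inner P U (\<lambda>z. - V' z + C z * V z) =
      (LINT x|N. LINT t|L. U (t, x) * (- V' (t, x) + C (t, x) * V (t, x)))"
    using integral_snd[OF i1] by (simp add: L2_inner_def case_prod_beta')
  also have "\<dots> = (LINT x|N. (LINT t|L. F (t, x) * V (t, x)) + g x * V (0, x))"
  proof (rule integral_cong_AE)
    show "AE x in N. (LINT t|L. U (t, x) * (- V' (t, x) + C (t, x) * V (t, x))) =
        (LINT t|L. F (t, x) * V (t, x)) + g x * V (0, x)"
      using slice L2_slice[OF F] L2_slice[OF V'] AE_space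
    proof eventually_elim
      case (elim x)
      then obtain B where B: "\<And>t. t \<in> {0<..<T} \<Longrightarrow> \<bar>U (t, x)\<bar> \<le> B" by blast
      show ?case
      proof (rule Volterra_duality[OF L.L2_integrable[OF elim(2)] _ _ _ B _ T cont VT deriv L.L2_integrable[OF elim(3)]])
        show "\<bar>C (s, x)\<bar> \<le> M" if "s \<in> {0<..<T}" for s
          using C(2) elim(4) that by (simp add: space_pair_measure)
        show "(\<lambda>t. C (t, x)) \<in> borel_measurable L" "(\<lambda>t. U (t, x)) \<in> borel_measurable L"
          using elim(4) by measurable
      qed (use elim in auto)
    qed
    show "(\<lambda>x. LINT t|L. U (t, x) * (- V' (t, x) + C (t, x) * V (t, x))) \<in> borel_measurable N"
      using integrable_snd[OF i1] by auto
    show "(\<lambda>x. (LINT t|L. F (t, x) * V (t, x)) + g x * V (0, x)) \<in> borel_measurable N"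
      using integrable_snd[OF i2] L2_mult_integrable[OF g V0] by auto
  qed
  also have "\<dots> = (LINT x|N. LINT t|L. F (t, x) * V (t, x)) + (LINT x|N. g x * V (0, x))"
    using integrable_snd[OF i2] L2_mult_integrable[OF g V0] by simp
  also have "\<dots> = L2_inner P F V + L2_inner N g (\<lambda>x. V (0, x))"
    using integral_snd[OF i2] by (simp add: L2_inner_def case_prod_beta')
  finally show ?thesis .
qed

end

text \<open>
  Testing with products separates the variables: orthogonality to all polynomials \<open>q\<close> in \<open>x\<close> removes the
  integral over \<open>x\<close>, for each \<open>k\<close> outside a null set.  As there are countably many \<open>k\<close>, almost every slice
  \<open>W(\<cdot>, x)\<close> falls under the one-dimensional uniqueness lemma.
\<close>
lemma Volterra_dual_uniqueness_family:
  fixes N :: "'x::euclidean_space measure" and W C :: "real \<times> 'x \<Rightarrow> real"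
  assumes "interval_product T N" and D: "bounded D" "sets N = sets (restrict_space borel D)"
    and M: "0 < M" and C: "C \<in> borel_measurable (interval_measure T \<Otimes>\<^sub>M N)"
      "\<And>z. z \<in> space (interval_measure T \<Otimes>\<^sub>M N) \<Longrightarrow> \<bar>C z\<bar> \<le> M"
    and W: "W \<in> L2 (interval_measure T \<Otimes>\<^sub>M N)"
    and orth: "\<And>k q. real_polynomial_function q \<Longrightarrow>
      (LINT (t, x)|(interval_measure T \<Otimes>\<^sub>M N).
        W (t, x) * ((t ^ k + C (t, x) * ((T ^ Suc k - t ^ Suc k) / real (Suc k))) * q x)) = 0"
  shows "AE z in (interval_measure T \<Otimes>\<^sub>M N). W z = 0"
proof -
  interpret interval_product T N by fact
  have space: "space N = D"
    using sets_eq_imp_space_eq[OF D(2)] by (simp add: space_restrict_space)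
  have Wm[measurable]: "W \<in> borel_measurable P" using W by (rule L2_measurable)
  note [measurable] = C(1)
  have [measurable]: "fst \<in> P \<rightarrow>\<^sub>M borel"
    using measurable_compose[OF measurable_fst measurable_interval_measure_ident] by simp
  let ?K = "\<lambda>k t x. t ^ k + C (t, x) * ((T ^ Suc k - t ^ Suc k) / real (Suc k))"
  have i: "integrable P (\<lambda>(t, x). W (t, x) * ?K k t x)" for k
  proof -
    have "(\<lambda>z. fst z ^ k + C z * ((T ^ Suc k - fst z ^ Suc k) / real (Suc k))) \<in> L2 P"
    proof (rule P.L2_bounded)
      show "AE z in P. \<bar>fst z ^ k + C z * ((T ^ Suc k - fst z ^ Suc k) / real (Suc k))\<bar>
          \<le> T ^ k + M * (T ^ Suc k / real (Suc k))"
      proof (rule AE_I2)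
        fix z assume z: "z \<in> space P"
        then have t: "0 < fst z" "fst z < T" by (auto simp: space_pair_measure)
        have "fst z ^ k \<le> T ^ k" "fst z ^ Suc k \<le> T ^ Suc k" "0 \<le> fst z ^ k" "0 \<le> fst z ^ Suc k"
          using t by (auto intro!: power_mono simp del: power_Suc)
        then have "\<bar>fst z ^ k\<bar> \<le> T ^ k" and "\<bar>(T ^ Suc k - fst z ^ Suc k) / real (Suc k)\<bar> \<le> T ^ Suc k / real (Suc k)"
          by (auto simp: divide_right_mono abs_of_nonneg simp del: power_Suc of_nat_Suc)
        then show "\<bar>fst z ^ k + C z * ((T ^ Suc k - fst z ^ Suc k) / real (Suc k))\<bar>
          \<le> T ^ k + M * (T ^ Suc k / real (Suc k))"
          using C(2)[OF z] M unfolding abs_mult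
          by (intro order_trans[OF abs_triangle_ineq] add_mono) (auto simp only: abs_mult intro!: mult_mono)
      qed
    qed measurable
    from L2_mult_integrable[OF W this] show ?thesis by (simp add: case_prod_beta')
  qed
  define G where "G k x = (LINT t|L. W (t, x) * ?K k t x)" for k x
  have iG: "integrable N (G k)" for k
    unfolding G_def[abs_def] by (rule integrable_snd[OF i])
  have "AE x in N. G k x = 0" for k
  proof (rule AE_zero_if_orthogonal_to_polynomials[OF D iG])
    fix q :: "'x \<Rightarrow> real" assume q: "real_polynomial_function q"
    have qc: "continuous_on UNIV q"
      using q by (simp add: continuous_on_polymonial_function real_polynomial_function_eq)
    have "q \<in> borel_measurable borel" using qc by (rule borel_measurable_continuous_onI)
    then have qm: "q \<in> borel_measurable N"
      unfolding measurable_cong_sets[OF D(2) refl] by (rule measurable_restrict_space1)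
    have "bounded (q ` closure D)"
      using D by (intro compact_imp_bounded compact_continuous_image continuous_on_subset[OF qc]) auto
    then obtain B where B: "\<And>x. x \<in> closure D \<Longrightarrow> \<bar>q x\<bar> \<le> B"
      unfolding bounded_iff by auto
    have iq: "integrable P (\<lambda>(t, x). W (t, x) * (?K k t x * q x))"
    proof (rule Bochner_Integration.integrable_bound)
      show "integrable P (\<lambda>z. B * (case z of (t, x) \<Rightarrow> W (t, x) * ?K k t x))"
        by (intro integrable_mult_right i)
      have "(\<lambda>z. (case z of (t, x) \<Rightarrow> W (t, x) * ?K k t x) * q (snd z)) \<in> borel_measurable P"
        by (intro borel_measurable_times borel_measurable_integrable[OF i] measurable_compose[OF measurable_snd qm])
      then show "(\<lambda>(t, x). W (t, x) * (?K k t x * q x)) \<in> borel_measurable P"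
        by (simp add: case_prod_beta' mult.assoc del: power_Suc of_nat_Suc)
      show "AE z in P. norm (case z of (t, x) \<Rightarrow> W (t, x) * (?K k t x * q x))
          \<le> norm (B * (case z of (t, x) \<Rightarrow> W (t, x) * ?K k t x))"
      proof (rule AE_I2)
        fix z assume "z \<in> space P"
        then have "snd z \<in> closure D" using closure_subset[of D] by (auto simp: space_pair_measure space)
        then have "\<bar>q (snd z)\<bar> \<le> \<bar>B\<bar>" using B by (meson abs_ge_self order_trans)
        then have "\<bar>W z * ?K k (fst z) (snd z)\<bar> * \<bar>q (snd z)\<bar> \<le> \<bar>W z * ?K k (fst z) (snd z)\<bar> * \<bar>B\<bar>"
          by (intro mult_left_mono) auto
        then show "norm (case z of (t, x) \<Rightarrow> W (t, x) * (?K k t x * q x))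
          \<le> norm (B * (case z of (t, x) \<Rightarrow> W (t, x) * ?K k t x))"
          by (simp add: case_prod_beta' abs_mult ac_simps del: power_Suc of_nat_Suc)
      qed
    qed
    have "(LINT x|N. G k x * q x) = (LINT x|N. LINT t|L. W (t, x) * (?K k t x * q x))"
    proof (rule Bochner_Integration.integral_cong[OF refl])
      fix x
      show "G k x * q x = (LINT t|L. W (t, x) * (?K k t x * q x))"
        unfolding G_def by (subst integral_mult_left_zero[symmetric]) (simp only: mult.assoc)
    qed
    also have "\<dots> = 0" using integral_snd[OF iq] orth[OF q] by simp
    finally show "(LINT x|N. G k x * q x) = 0" .
  qed
  then have all: "AE x in N. \<forall>k. G k x = 0" by (simp add: AE_all_countable)
  have ae: "AE x in N. AE t in L. W (t, x) = 0"
    using all L2_slice[OF W] AE_space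
  proof eventually_elim
    case (elim x)
    show ?case
    proof (rule Volterra_dual_uniqueness[OF L.L2_integrable[OF elim(2)] M, of "\<lambda>t. C (t, x)"])
      show "\<bar>C (s, x)\<bar> \<le> M" if "s \<in> {0<..<T}" for s
        using C(2) elim(3) that by (simp add: space_pair_measure)
      show "(\<lambda>t. C (t, x)) \<in> borel_measurable L" using elim(3) by measurable
    qed (use elim(1) in \<open>simp only: G_def\<close>)
  qed
  have "{z \<in> space P. W (fst z, snd z) = 0} \<in> sets P" by measurable
  from AE_commute[OF this] ae have "AE t in L. AE x in N. W (t, x) = 0" by simp
  moreover have "{z \<in> space P. W z = 0} \<in> sets P" by measurable
  ultimately show ?thesis by (intro AE_pair_measure)
qed

section \<open>Variational solutions on the cylinder\<close>

text \<open>
  Lebesgue-measurable functions on \<open>Q\<close> need not be measurable for the product of the factors, so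
  Fubini's theorem is applied to Borel representatives.  The passage between the two is the passage
  between a measure and its completion.
\<close>
lemma lebesgue_on_eq_completion:
  fixes S :: "'a::euclidean_space set"
  assumes S: "S \<in> sets borel"
  shows "lebesgue_on S = completion (restrict_space lborel S)"
proof (rule measure_eqI)
  let ?R = "restrict_space lborel S"
  have Sl: "S \<inter> space lebesgue \<in> sets lebesgue" "S \<inter> space lborel \<in> sets lborel" using S by auto
  have R: "B \<in> sets ?R \<longleftrightarrow> B \<subseteq> S \<and> B \<in> sets borel" for B
    using sets_restrict_space_iff[OF Sl(2)] by simp
  have split: "\<exists>B N N'. A = B \<union> N \<and> B \<subseteq> S \<and> B \<in> sets borel \<and> N \<subseteq> N' \<and> N' \<in> null_sets lborel \<and> N' \<subseteq> S"
    if "A \<in> sets (lebesgue_on S)" for A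
  proof -
    have A: "A \<in> sets lebesgue" "A \<subseteq> S"
      using that sets_restrict_space_iff[OF Sl(1)] by auto
    from A(1) obtain B N N' where *: "A = B \<union> N" "N \<subseteq> N'" "N' \<in> null_sets lborel" "B \<in> sets lborel"
      by (rule sets_completionE)
    have "N' \<inter> S \<in> null_sets lborel" using *(3) S by (intro null_set_Int2) auto
    then show ?thesis using * A by (intro exI[of _ B] exI[of _ N] exI[of _ "N' \<inter> S"]) auto
  qed
  have null: "N' \<in> null_sets ?R" if "N' \<in> null_sets lborel" "N' \<subseteq> S" for N'
    using that S by (subst null_sets_restrict_space) auto
  show sets: "sets (lebesgue_on S) = sets (completion ?R)"
  proof (intro equalityI subsetI)
    fix A assume "A \<in> sets (lebesgue_on S)"
    from split[OF this] show "A \<in> sets (completion ?R)"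
      by (metis R null sets_completionI)
  next
    fix A assume "A \<in> sets (completion ?R)"
    then obtain B N N' where *: "A = B \<union> N" "N \<subseteq> N'" "N' \<in> null_sets ?R" "B \<in> sets ?R"
      by (rule sets_completionE)
    then have "N' \<in> null_sets lborel" "N' \<subseteq> S" using S by (simp_all add: null_sets_restrict_space)
    then have "A \<in> sets lebesgue"
      using * R by (intro sets_completionI[OF *(1,2)]) auto
    moreover have "A \<subseteq> S" using * R[of B] \<open>N' \<subseteq> S\<close> by blast
    ultimately show "A \<in> sets (lebesgue_on S)" using sets_restrict_space_iff[OF Sl(1)] by simp
  qed
  fix A assume "A \<in> sets (lebesgue_on S)"
  from split[OF this] obtain B N N' where *: "A = B \<union> N" "B \<subseteq> S" "B \<in> sets borel" "N \<subseteq> N'"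
    "N' \<in> null_sets lborel" "N' \<subseteq> S" by blast
  have AS: "A \<subseteq> S" using * by auto
  have n1: "N \<in> null_sets lebesgue"
    using null_sets_completion_subset[OF *(4) null_sets_completionI[OF *(5)]] .
  have n2: "N \<in> null_sets (completion ?R)"
    using null_sets_completion_subset[OF *(4) null_sets_completionI[OF null[OF *(5,6)]]] .
  have BR: "B \<in> sets ?R" using * R by simp
  have "emeasure (lebesgue_on S) A = emeasure lebesgue A"
    using AS S by (intro emeasure_restrict_space) auto
  also have "\<dots> = emeasure lebesgue B"
    unfolding *(1) using *(3) n1 by (intro emeasure_Un_null_set) auto
  also have "\<dots> = emeasure ?R B"
    using *(2,3) S by (simp add: emeasure_restrict_space)
  also have "\<dots> = emeasure (completion ?R) B" using BR by simp
  also have "\<dots> = emeasure (completion ?R) A"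
    unfolding *(1) using BR n2 by (intro emeasure_Un_null_set[symmetric]) auto
  finally show "emeasure (lebesgue_on S) A = emeasure (completion ?R) A" .
qed

lemma restrict_space_cylinder:
  fixes D :: "'a::euclidean_space set"
  assumes D: "D \<in> sets borel"
  shows "interval_measure T \<Otimes>\<^sub>M restrict_space lborel D = restrict_space lborel (cylinder T D)"
proof (rule pair_measure_eqI)
  let ?N = "restrict_space lborel D"
  interpret L: finite_measure "interval_measure T" by (rule finite_interval_measure)
  show "sigma_finite_measure (interval_measure T)" ..
  show "sigma_finite_measure ?N"
    using D by (intro sigma_finite_measure_restrict_space) (auto simp: lborel.sigma_finite_measure_axioms)
  have cyl: "cylinder T D \<in> sets borel"
    unfolding cylinder_def using D by (intro borel_Times) auto
  then have cyl': "cylinder T D \<inter> space lborel \<in> sets lborel" by simp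
  have L: "A \<in> sets (interval_measure T) \<longleftrightarrow> A \<subseteq> {0<..<T} \<and> A \<in> sets borel" for A
    unfolding interval_measure_def by (subst sets_restrict_space_iff) auto
  have N: "B \<in> sets ?N \<longleftrightarrow> B \<subseteq> D \<and> B \<in> sets borel" for B
    using D by (subst sets_restrict_space_iff) auto
  have id: "(\<lambda>z. (fst z, snd z)) \<in> interval_measure T \<Otimes>\<^sub>M ?N \<rightarrow>\<^sub>M borel"
    unfolding borel_prod[symmetric]
  proof (rule measurable_Pair)
    show "fst \<in> interval_measure T \<Otimes>\<^sub>M ?N \<rightarrow>\<^sub>M borel"
      using measurable_compose[OF measurable_fst measurable_interval_measure_ident] by simp
    have "(\<lambda>x. x) \<in> ?N \<rightarrow>\<^sub>M borel" by (rule measurable_restrict_space1) simp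
    then show "snd \<in> interval_measure T \<Otimes>\<^sub>M ?N \<rightarrow>\<^sub>M borel"
      by (rule measurable_compose[OF measurable_snd])
  qed
  show "sets (interval_measure T \<Otimes>\<^sub>M ?N) = sets (restrict_space lborel (cylinder T D))"
  proof (intro equalityI sets_pair_in_sets subsetI)
    fix A B assume "A \<in> sets (interval_measure T)" "B \<in> sets ?N"
    then have "A \<times> B \<subseteq> cylinder T D" "A \<times> B \<in> sets borel"
      using L N by (auto simp: cylinder_def intro!: borel_Times)
    then show "A \<times> B \<in> sets (restrict_space lborel (cylinder T D))"
      using sets_restrict_space_iff[OF cyl'] by simp
  next
    fix A assume "A \<in> sets (restrict_space lborel (cylinder T D))"
    then have A: "A \<subseteq> cylinder T D" "A \<in> sets borel"
      using sets_restrict_space_iff[OF cyl'] by auto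
    have "(\<lambda>z. (fst z, snd z)) -` A \<inter> space (interval_measure T \<Otimes>\<^sub>M ?N) = A"
      using A(1) by (auto simp: space_pair_measure cylinder_def space_restrict_space)
    then show "A \<in> sets (interval_measure T \<Otimes>\<^sub>M ?N)"
      using measurable_sets[OF id A(2)] by simp
  qed
  fix A B assume A: "A \<in> sets (interval_measure T)" and B: "B \<in> sets ?N"
  have "emeasure (interval_measure T) A * emeasure ?N B = emeasure lborel A * emeasure lborel B"
    using A B L N D by (simp add: interval_measure_def emeasure_restrict_space)
  also have "\<dots> = emeasure lborel (A \<times> B)"
    using A B L N by (subst lborel_prod[symmetric], subst lborel.emeasure_pair_measure_Times) auto
  also have "\<dots> = emeasure (restrict_space lborel (cylinder T D)) (A \<times> B)"
    using cyl A B L N by (subst emeasure_restrict_space) (auto simp: cylinder_def)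
  finally show "emeasure (interval_measure T) A * emeasure ?N B =
      emeasure (restrict_space lborel (cylinder T D)) (A \<times> B)" .
qed

lemma real_polynomial_function_C1:
  fixes q :: "'b::real_normed_vector \<Rightarrow> real"
  assumes "real_polynomial_function q"
  shows "\<exists>q'. (\<forall>x. (q has_derivative blinfun_apply (q' x)) (at x)) \<and> continuous_on UNIV q'"
  using assms
proof induction
  case (linear f)
  then have "\<forall>x. (f has_derivative blinfun_apply (Blinfun f)) (at x)"
    by (simp add: bounded_linear_Blinfun_apply bounded_linear_imp_has_derivative)
  then show ?case by (intro exI[of _ "\<lambda>_. Blinfun f"]) simp
next
  case (const c)
  show ?case by (intro exI[of _ "\<lambda>_. 0"]) (simp add: zero_blinfun.rep_eq)
next
  case (add f g)
  then obtain f' g' where "\<forall>x. (f has_derivative blinfun_apply (f' x)) (at x)" "continuous_on UNIV f'"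
    "\<forall>x. (g has_derivative blinfun_apply (g' x)) (at x)" "continuous_on UNIV g'" by blast
  then show ?case
    by (intro exI[of _ "\<lambda>x. f' x + g' x"])
      (auto simp: plus_blinfun.rep_eq intro!: continuous_intros has_derivative_add)
next
  case (mult f g)
  then obtain f' g' where *: "\<And>x. (f has_derivative blinfun_apply (f' x)) (at x)" "continuous_on UNIV f'"
    "\<And>x. (g has_derivative blinfun_apply (g' x)) (at x)" "continuous_on UNIV g'" by blast
  have c: "continuous_on UNIV f" "continuous_on UNIV g"
    using mult.hyps by (simp_all add: continuous_on_polymonial_function real_polynomial_function_eq)
  have "((\<lambda>x. f x * g x) has_derivative blinfun_apply (f x *\<^sub>R g' x + g x *\<^sub>R f' x)) (at x)" for x
    using has_derivative_mult[OF *(1)[of x] *(3)[of x]]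
    by (simp add: plus_blinfun.rep_eq scaleR_blinfun.rep_eq mult.commute)
  then show ?case using c *
    by (intro exI[of _ "\<lambda>x. f x *\<^sub>R g' x + g x *\<^sub>R f' x"]) (auto intro!: continuous_intros)
qed

lemma L2_completion_iff:
  assumes "f \<in> borel_measurable M"
  shows "f \<in> L2 (completion M) \<longleftrightarrow> f \<in> L2 M"
  using assms by (simp add: L2_def measurable_completion integrable_completion)

lemma L2_inner_completion:
  assumes "f \<in> borel_measurable M" "g \<in> borel_measurable M"
  shows "L2_inner (completion M) f g = L2_inner M f g"
  using assms by (simp add: L2_inner_def integral_completion)

lemma L2_norm_completion:
  "f \<in> borel_measurable M \<Longrightarrow> L2_norm (completion M) f = L2_norm M f"
  by (simp add: L2_norm_def L2_inner_completion)

lemma L2_inner_cong_AE: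
  assumes "f \<in> borel_measurable M" "f' \<in> borel_measurable M" "g \<in> borel_measurable M" "g' \<in> borel_measurable M"
    and "AE x in M. f x = f' x" "AE x in M. g x = g' x"
  shows "L2_inner M f g = L2_inner M f' g'"
proof -
  have "AE x in M. f x * g x = f' x * g' x"
    using assms(5,6) by eventually_elim simp
  then show ?thesis unfolding L2_inner_def
    using assms by (intro integral_cong_AE) auto
qed

lemma L2_norm_cong_AE:
  assumes "f \<in> borel_measurable M" "f' \<in> borel_measurable M" "AE x in M. f x = f' x"
  shows "L2_norm M f = L2_norm M f'"
  unfolding L2_norm_def using assms by (intro arg_cong[where f=sqrt] L2_inner_cong_AE)

lemma L2_completion_representative:
  assumes "f \<in> L2 (completion M)"
  obtains f' where "f' \<in> L2 M" "f' \<in> L2 (completion M)" "AE x in completion M. f x = f' x"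
    "L2_norm (completion M) f = L2_norm M f'"
proof -
  have fm: "f \<in> borel_measurable (completion M)" using assms by (rule L2_measurable)
  then obtain f' where f': "f' \<in> borel_measurable M" "AE x in M. f x = f' x"
    using completion_ex_borel_measurable_real by blast
  have ae: "AE x in completion M. f x = f' x" by (rule AE_completion[OF f'(2)])
  have L: "f' \<in> L2 (completion M)"
    by (rule L2_cong_AE[OF assms measurable_completion[OF f'(1)] ae])
  show thesis
    using that[of f'] L f'(1) ae L2_norm_cong_AE[OF fm measurable_completion[OF f'(1)] ae]
    by (simp add: L2_completion_iff L2_norm_completion)
qed

locale space_time_cylinder =
  fixes T :: real and D :: "'a::euclidean_space set"
  assumes T: "0 < T" and D: "open D" "bounded D"
begin

abbreviation "Q \<equiv> cylinder T D"
abbreviation "N \<equiv> restrict_space lborel D"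

lemma finite_N: "finite_measure N"
proof (rule finite_measureI)
  have "emeasure lborel D < \<infinity>" using D(2) by (rule emeasure_bounded_finite)
  then show "emeasure N (space N) \<noteq> \<infinity>"
    using D(1) by (simp add: space_restrict_space emeasure_restrict_space)
qed

sublocale interval_product T N
  by (rule interval_product.intro[OF T finite_N])

lemma borel_D: "D \<in> sets borel" using D(1) by simp

lemma borel_Q: "Q \<in> sets borel"
  unfolding cylinder_def using borel_D by (intro borel_Times) auto

lemma P_eq: "P = restrict_space lborel Q"
  by (rule restrict_space_cylinder[OF borel_D])

lemma lebesgue_on_Q: "lebesgue_on Q = completion P"
  unfolding P_eq by (rule lebesgue_on_eq_completion[OF borel_Q])

lemma lebesgue_on_D: "lebesgue_on D = completion N"
  by (rule lebesgue_on_eq_completion[OF borel_D])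

lemma space_P: "space P = Q"
  by (simp add: P_eq space_restrict_space)

lemma finite_lebesgue_on_Q: "finite_measure (lebesgue_on Q)"
  unfolding lebesgue_on_Q using P.emeasure_finite by (intro finite_measureI) simp

lemma finite_lebesgue_on_D: "finite_measure (lebesgue_on D)"
  unfolding lebesgue_on_D using N.emeasure_finite by (intro finite_measureI) simp

lemma closure_Q: "closure Q = {0..T} \<times> closure D"
  unfolding cylinder_def closure_Times using T by simp

lemma compact_closure_Q: "compact (closure Q)"
  unfolding closure_Q using D by (intro compact_Times) auto

lemma borel_measurable_P_continuous:
  fixes V :: "real \<times> 'a \<Rightarrow> real"
  assumes "continuous_on Q V"
  shows "V \<in> borel_measurable P"
  unfolding P_eq using borel_measurable_continuous_on_restrict[OF assms]
  by (subst measurable_cong_sets[OF sets_restrict_space_cong[of lborel borel] refl]) auto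

lemma borel_measurable_N_continuous:
  fixes v :: "'a \<Rightarrow> real"
  assumes "continuous_on D v"
  shows "v \<in> borel_measurable N"
  using borel_measurable_continuous_on_restrict[OF assms]
  by (subst measurable_cong_sets[OF sets_restrict_space_cong[of lborel borel] refl]) auto

lemma closure_Q_slice:
  assumes "continuous_on (closure Q) V" and "x \<in> closure D"
  shows "continuous_on {0..T} (\<lambda>t. V (t, x))"
  using assms(2) by (intro continuous_on_compose2[OF assms(1)] continuous_intros) (auto simp: closure_Q)

end

locale damped_evolution = space_time_cylinder T D
  for T :: real and D :: "'a::euclidean_space set" +
  fixes C :: "real \<times> 'a \<Rightarrow> real" and M :: real
  assumes M: "0 < M"
    and C: "C \<in> borel_measurable (lebesgue_on (cylinder T D))" "AE z in lebesgue_on (cylinder T D). \<bar>C z\<bar> \<le> M"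
begin

text \<open>Truncating a Borel representative at height \<open>M\<close> makes the bound hold at every point.\<close>
lemma bounded_representative:
  obtains C' where "C' \<in> borel_measurable P" "\<And>z. \<bar>C' z\<bar> \<le> M" "AE z in P. C z = C' z"
proof -
  obtain C0 where C0: "C0 \<in> borel_measurable P" "AE z in P. C z = C0 z"
    using C(1) completion_ex_borel_measurable_real[of C P] unfolding lebesgue_on_Q by blast
  let ?C' = "\<lambda>z. max (- M) (min M (C0 z))"
  have "AE z in P. \<bar>C z\<bar> \<le> M" using C(2) unfolding lebesgue_on_Q by (simp add: AE_completion_iff)
  with C0(2) have "AE z in P. C z = ?C' z" by eventually_elim auto
  moreover have "\<bar>?C' z\<bar> \<le> M" for z using M by auto
  moreover have "?C' \<in> borel_measurable P" using C0(1) by measurable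
  ultimately show thesis using that by blast
qed

lemma C1_plusD:
  assumes "V \<in> C1_plus T D C"
  shows "continuous_on (closure Q) V"
    "\<And>t x. (t, x) \<in> Q \<Longrightarrow> ((\<lambda>s. V (s, x)) has_real_derivative deriv (\<lambda>s. V (s, x)) t) (at t)"
    "continuous_on Q (\<lambda>(t, x). deriv (\<lambda>s. V (s, x)) t)"
    "\<And>x. x \<in> closure D \<Longrightarrow> V (T, x) = 0"
    "Bstar0 C V \<in> L2 (lebesgue_on Q)"
proof -
  show "continuous_on (closure Q) V" "\<And>x. x \<in> closure D \<Longrightarrow> V (T, x) = 0" "Bstar0 C V \<in> L2 (lebesgue_on Q)"
    using assms by (auto simp: C1_plus_def)
  obtain V' where V': "\<And>z. z \<in> Q \<Longrightarrow> (V has_derivative blinfun_apply (V' z)) (at z)" "continuous_on Q V'"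
    using assms by (auto simp: C1_plus_def C1_on_def)
  have d: "((\<lambda>s. V (s, x)) has_real_derivative blinfun_apply (V' (t, x)) (1, 0)) (at t)"
    if "(t, x) \<in> Q" for t x
  proof -
    have "((\<lambda>s. (s, x)) has_derivative (\<lambda>h. (h, 0))) (at t)"
      by (auto intro!: derivative_eq_intros)
    then have "((\<lambda>s. V (s, x)) has_derivative (\<lambda>h. blinfun_apply (V' (t, x)) (h, 0))) (at t)"
      using V'(1)[OF that] by (rule has_derivative_compose)
    moreover have "(\<lambda>h. blinfun_apply (V' (t, x)) (h, 0)) = (*) (blinfun_apply (V' (t, x)) (1, 0))"
    proof
      fix h :: real
      have "blinfun_apply (V' (t, x)) (h *\<^sub>R (1, 0)) = h *\<^sub>R blinfun_apply (V' (t, x)) (1, 0)"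
        by (rule blinfun.scaleR_right)
      then show "blinfun_apply (V' (t, x)) (h, 0) = blinfun_apply (V' (t, x)) (1, 0) * h"
        by (simp add: mult.commute)
    qed
    ultimately show ?thesis by (simp add: has_field_derivative_def)
  qed
  then have eq: "deriv (\<lambda>s. V (s, x)) t = blinfun_apply (V' (t, x)) (1, 0)" if "(t, x) \<in> Q" for t x
    using that by (intro DERIV_imp_deriv)
  show "((\<lambda>s. V (s, x)) has_real_derivative deriv (\<lambda>s. V (s, x)) t) (at t)" if "(t, x) \<in> Q" for t x
    using d[OF that] eq[OF that] by simp
  have "continuous_on Q (\<lambda>z. blinfun_apply (V' z) (1, 0))"
    by (intro continuous_intros V')
  then show "continuous_on Q (\<lambda>(t, x). deriv (\<lambda>s. V (s, x)) t)"
    by (rule continuous_on_eq) (auto simp: eq)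
qed

lemma C1_plus_diff:
  assumes V: "V \<in> C1_plus T D C" and W: "W \<in> C1_plus T D C"
  shows "(\<lambda>z. V z - W z) \<in> C1_plus T D C"
    "\<And>z. z \<in> Q \<Longrightarrow> Bstar0 C (\<lambda>z. V z - W z) z = Bstar0 C V z - Bstar0 C W z"
proof -
  show eq: "Bstar0 C (\<lambda>z. V z - W z) z = Bstar0 C V z - Bstar0 C W z" if "z \<in> Q" for z
  proof -
    obtain t x where z: "z = (t, x)" by (cases z)
    have "((\<lambda>s. V (s, x) - W (s, x)) has_real_derivative deriv (\<lambda>s. V (s, x)) t - deriv (\<lambda>s. W (s, x)) t) (at t)"
      using C1_plusD(2)[OF V] C1_plusD(2)[OF W] that z by (intro DERIV_diff) auto
    then have "deriv (\<lambda>s. V (s, x) - W (s, x)) t = deriv (\<lambda>s. V (s, x)) t - deriv (\<lambda>s. W (s, x)) t"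
      by (rule DERIV_imp_deriv)
    then show ?thesis by (simp add: Bstar0_def z right_diff_distrib)
  qed
  have "C1_on Q (\<lambda>z. V z - W z)"
  proof -
    obtain V' where V': "\<And>z. z \<in> Q \<Longrightarrow> (V has_derivative blinfun_apply (V' z)) (at z)" "continuous_on Q V'"
      using V by (auto simp: C1_plus_def C1_on_def)
    obtain W' where W': "\<And>z. z \<in> Q \<Longrightarrow> (W has_derivative blinfun_apply (W' z)) (at z)" "continuous_on Q W'"
      using W by (auto simp: C1_plus_def C1_on_def)
    show ?thesis unfolding C1_on_def
      using V' W' by (intro exI[of _ "\<lambda>z. V' z - W' z"])
        (auto simp: minus_blinfun.rep_eq intro!: has_derivative_diff continuous_intros)
  qed
  moreover have "Bstar0 C (\<lambda>z. V z - W z) \<in> L2 (lebesgue_on Q)"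
  proof (rule L2_cong_AE)
    show i: "(\<lambda>z. Bstar0 C V z - Bstar0 C W z) \<in> L2 (lebesgue_on Q)"
      by (intro L2_diff C1_plusD(5) V W)
    show "AE z in lebesgue_on Q. Bstar0 C V z - Bstar0 C W z = Bstar0 C (\<lambda>z. V z - W z) z"
      using eq by (intro AE_I2) simp
    show "Bstar0 C (\<lambda>z. V z - W z) \<in> borel_measurable (lebesgue_on Q)"
      using L2_measurable[OF i] eq by (subst measurable_cong) auto
  qed
  ultimately show "(\<lambda>z. V z - W z) \<in> C1_plus T D C"
    using C1_plusD(1,4)[OF V] C1_plusD(1,4)[OF W] by (auto simp: C1_plus_def intro!: continuous_intros)
qed

lemma
  assumes "V \<in> C1_plus T D C"
  shows C1_plus_L2_P: "V \<in> L2 P"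
    and C1_plus_trace_L2_N: "(\<lambda>x. V (0, x)) \<in> L2 N"
    and C1_plus_L2: "V \<in> L2 (lebesgue_on Q)"
    and C1_plus_trace_L2: "(\<lambda>x. V (0, x)) \<in> L2 (lebesgue_on D)"
proof -
  note cont = C1_plusD(1)[OF assms]
  have "bounded (V ` closure Q)"
    by (intro compact_imp_bounded compact_continuous_image cont compact_closure_Q)
  then obtain B where B: "\<And>z. z \<in> closure Q \<Longrightarrow> \<bar>V z\<bar> \<le> B"
    by (fastforce simp: bounded_iff)
  have m1: "V \<in> borel_measurable P"
    by (intro borel_measurable_P_continuous continuous_on_subset[OF cont] closure_subset)
  show 1: "V \<in> L2 P"
    using closure_subset[of Q] B by (intro P.L2_bounded[OF m1, of B] AE_I2) (auto simp: space_P)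
  have "continuous_on D (\<lambda>x. V (0, x))"
    using T closure_subset[of D] by (intro continuous_on_compose2[OF cont] continuous_intros) (auto simp: closure_Q)
  then have m2: "(\<lambda>x. V (0, x)) \<in> borel_measurable N" by (rule borel_measurable_N_continuous)
  show 2: "(\<lambda>x. V (0, x)) \<in> L2 N"
    using closure_subset[of D] T
    B by (intro N.L2_bounded[OF m2, of B] AE_I2) (auto simp: space_restrict_space closure_Q)
  show "V \<in> L2 (lebesgue_on Q)" unfolding lebesgue_on_Q using 1 m1 by (simp add: L2_completion_iff)
  show "(\<lambda>x. V (0, x)) \<in> L2 (lebesgue_on D)" unfolding lebesgue_on_D using 2 m2 by (simp add: L2_completion_iff)
qed

definition energy_const :: real where
  "energy_const = 8 * T * (1 + T) * (exp (2 * M * T))\<^sup>2"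

text \<open>
  The solution operator is bounded with a constant independent of the data.  The variational
  identity is stated for classical test functions; its extension to the completion needs the energy
  estimate below, which itself rests on this lemma.
\<close>
lemma weak_solution:
  assumes F: "F \<in> L2 (lebesgue_on Q)" and g: "g \<in> L2 (lebesgue_on D)"
  obtains U where "U \<in> L2 (lebesgue_on Q)"
    "(L2_norm (lebesgue_on Q) U)\<^sup>2 \<le> energy_const * ((L2_norm (lebesgue_on Q) F)\<^sup>2 + (L2_norm (lebesgue_on D) g)\<^sup>2)"
    "\<And>V. V \<in> C1_plus T D C \<Longrightarrow> L2_inner (lebesgue_on Q) U (Bstar0 C V) =
      L2_inner (lebesgue_on Q) F V + L2_inner (lebesgue_on D) g (\<lambda>x. V (0, x))"
proof -
  obtain C' where C': "C' \<in> borel_measurable P" "\<And>z. \<bar>C' z\<bar> \<le> M" "AE z in P. C z = C' z"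
    by (rule bounded_representative) blast
  obtain F' where F': "F' \<in> L2 P" "F' \<in> L2 (completion P)" "AE z in completion P. F z = F' z"
    "L2_norm (completion P) F = L2_norm P F'"
    using F unfolding lebesgue_on_Q by (rule L2_completion_representative)
  obtain g' where g': "g' \<in> L2 N" "g' \<in> L2 (completion N)" "AE x in completion N. g x = g' x"
    "L2_norm (completion N) g = L2_norm N g'"
    using g unfolding lebesgue_on_D by (rule L2_completion_representative)
  obtain U where U: "U \<in> L2 P"
    "(L2_norm P U)\<^sup>2 \<le> energy_const * ((L2_norm P F')\<^sup>2 + (L2_norm N g')\<^sup>2)"
    "AE x in N. (\<exists>B. \<forall>t\<in>{0<..<T}. \<bar>U (t, x)\<bar> \<le> B) \<and>
      (\<forall>t\<in>{0<..<T}. U (t, x) = g' x + (LINT s|L. (if s < t then F' (s, x) else 0))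
              - (LINT s|L. (if s < t then C' (s, x) * U (s, x) else 0)))"
    unfolding energy_const_def by (rule Volterra_sol_family[OF M C'(1,2) F'(1) g'(1)])
  note Um = L2_measurable[OF U(1)]
  show thesis
  proof (rule that)
    show "U \<in> L2 (lebesgue_on Q)" unfolding lebesgue_on_Q using U(1) Um by (simp add: L2_completion_iff)
    show "(L2_norm (lebesgue_on Q) U)\<^sup>2 \<le> energy_const * ((L2_norm (lebesgue_on Q) F)\<^sup>2 + (L2_norm (lebesgue_on D) g)\<^sup>2)"
      unfolding lebesgue_on_Q lebesgue_on_D F'(4) g'(4) using U(2) Um by (simp add: L2_norm_completion)
    fix V assume V: "V \<in> C1_plus T D C"
    define V' where "V' = (\<lambda>(t, x). deriv (\<lambda>s. V (s, x)) t)"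
    let ?B = "\<lambda>z. - V' z + C' z * V z"
    have V'm: "V' \<in> borel_measurable P"
      unfolding V'_def by (rule borel_measurable_P_continuous[OF C1_plusD(3)[OF V]])
    note VL = C1_plus_L2_P[OF V]
    have Bm: "?B \<in> borel_measurable P"
      using V'm C'(1) L2_measurable[OF VL] by measurable
    have ae: "AE z in completion P. Bstar0 C V z = ?B z"
      using AE_completion[OF C'(3)] by eventually_elim (auto simp: Bstar0_def V'_def)
    have "?B \<in> L2 (completion P)"
      using L2_cong_AE[OF C1_plusD(5)[OF V, unfolded lebesgue_on_Q] measurable_completion[OF Bm] ae] .
    then have BL: "?B \<in> L2 P" using Bm by (simp add: L2_completion_iff)
    have "(\<lambda>z. C' z * V z - ?B z) \<in> L2 P"
      by (intro L2_diff L2_mult_bounded[OF VL C'(1), of M] BL) (simp add: C'(2))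
    then have V'L: "V' \<in> L2 P" by simp
    have "L2_inner (lebesgue_on Q) U (Bstar0 C V) = L2_inner (completion P) U ?B"
      unfolding lebesgue_on_Q
      by (rule L2_inner_cong_AE[OF measurable_completion[OF Um] measurable_completion[OF Um]
            L2_measurable[OF C1_plusD(5)[OF V, unfolded lebesgue_on_Q]] measurable_completion[OF Bm] _ ae]) simp
    also have "\<dots> = L2_inner P U ?B"
      by (rule L2_inner_completion[OF Um Bm])
    also have "\<dots> = L2_inner P F' V + L2_inner N g' (\<lambda>x. V (0, x))"
    proof (rule Volterra_duality_family[OF C'(1,2) F'(1) g'(1) U(1) U(3) VL C1_plus_trace_L2_N[OF V] V'L])
      fix x assume "x \<in> space N"
      then have x: "x \<in> D" by (simp add: space_restrict_space)
      then have xc: "x \<in> closure D" using closure_subset by blast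
      show "continuous_on {0..T} (\<lambda>t. V (t, x))" by (rule closure_Q_slice[OF C1_plusD(1)[OF V] xc])
      show "V (T, x) = 0" by (rule C1_plusD(4)[OF V xc])
      show "((\<lambda>t. V (t, x)) has_real_derivative V' (t, x)) (at t)" if "t \<in> {0<..<T}" for t
        using C1_plusD(2)[OF V, of t x] x that by (simp add: V'_def cylinder_def)
    qed
    also have "L2_inner P F' V = L2_inner (completion P) F' V"
      by (rule L2_inner_completion[symmetric]) (intro L2_measurable F' VL)+
    also have "\<dots> = L2_inner (completion P) F V"
    proof (rule L2_inner_cong_AE)
      show "AE z in completion P. F' z = F z" using F'(3) by eventually_elim simp
    qed (use F F'(2) VL in \<open>auto simp: lebesgue_on_Q intro: L2_measurable measurable_completion\<close>)
    also have "L2_inner N g' (\<lambda>x. V (0, x)) = L2_inner (completion N) g' (\<lambda>x. V (0, x))"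
      by (rule L2_inner_completion[symmetric]) (intro L2_measurable g' C1_plus_trace_L2_N V)+
    also have "\<dots> = L2_inner (completion N) g (\<lambda>x. V (0, x))"
    proof (rule L2_inner_cong_AE)
      show "AE x in completion N. g' x = g x" using g'(3) by eventually_elim simp
    qed (use g g'(2) C1_plus_trace_L2_N[OF V] in \<open>auto simp: lebesgue_on_D intro: L2_measurable measurable_completion\<close>)
    finally show "L2_inner (lebesgue_on Q) U (Bstar0 C V) =
      L2_inner (lebesgue_on Q) F V + L2_inner (lebesgue_on D) g (\<lambda>x. V (0, x))"
      by (simp only: lebesgue_on_Q lebesgue_on_D)
  qed
qed

text \<open>
  Coercivity of \<open>B\<^sup>*\<close> by duality.  Let \<open>U\<close> solve the problem with data \<open>F = V\<close> and
  \<open>U\<^sub>0 = V(0, \<cdot>)\<close>.  Then \<open>\<parallel>V\<parallel>\<^sup>2 + \<parallel>V(0, \<cdot>)\<parallel>\<^sup>2 = \<langle>U, B\<^sup>* V\<rangle> \<le> \<parallel>U\<parallel> \<parallel>B\<^sup>* V\<parallel>\<close>, and \<open>\<parallel>U\<parallel>\<^sup>2\<close> is at most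
  a constant times the left-hand side.
\<close>
lemma energy_estimate:
  assumes V: "V \<in> C1_plus T D C"
  shows "L2_norm (lebesgue_on Q) V \<le> sqrt energy_const * star_norm T D C V"
    "L2_norm (lebesgue_on D) (\<lambda>x. V (0, x)) \<le> sqrt energy_const * star_norm T D C V"
proof -
  define a b s where "a = L2_norm (lebesgue_on Q) V" and "b = L2_norm (lebesgue_on D) (\<lambda>x. V (0, x))"
    and "s = star_norm T D C V"
  have pos: "0 \<le> a" "0 \<le> b" "0 \<le> s" by (simp_all add: a_def b_def s_def star_norm_def L2_norm_nonneg)
  have k: "0 \<le> energy_const" using T by (simp add: energy_const_def)
  obtain U where U: "U \<in> L2 (lebesgue_on Q)"
    "(L2_norm (lebesgue_on Q) U)\<^sup>2 \<le> energy_const * (a\<^sup>2 + b\<^sup>2)"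
    "L2_inner (lebesgue_on Q) U (Bstar0 C V) =
      L2_inner (lebesgue_on Q) V V + L2_inner (lebesgue_on D) (\<lambda>x. V (0, x)) (\<lambda>x. V (0, x))"
    unfolding a_def b_def by (rule weak_solution[OF C1_plus_L2[OF V] C1_plus_trace_L2[OF V]]) (use V in blast)
  have "a\<^sup>2 + b\<^sup>2 = L2_inner (lebesgue_on Q) U (Bstar0 C V)"
    unfolding U(3) using L2_norm_square[of "lebesgue_on Q" V] L2_norm_square[of "lebesgue_on D" "\<lambda>x. V (0, x)"]
    by (simp add: a_def b_def L2_inner_def power2_eq_square)
  also have "\<dots> \<le> L2_norm (lebesgue_on Q) U * s"
    using L2_Cauchy_Schwarz[OF U(1) C1_plusD(5)[OF V]] by (simp add: s_def star_norm_def)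
  finally have "(a\<^sup>2 + b\<^sup>2)\<^sup>2 \<le> (L2_norm (lebesgue_on Q) U * s)\<^sup>2"
    by (intro power_mono) auto
  also have "\<dots> \<le> (energy_const * (a\<^sup>2 + b\<^sup>2)) * s\<^sup>2"
    unfolding power_mult_distrib using U(2) by (intro mult_right_mono) auto
  finally have "(a\<^sup>2 + b\<^sup>2) * (a\<^sup>2 + b\<^sup>2) \<le> (a\<^sup>2 + b\<^sup>2) * (energy_const * s\<^sup>2)"
    by (simp add: power2_eq_square ac_simps)
  then have le: "a\<^sup>2 + b\<^sup>2 \<le> energy_const * s\<^sup>2"
  proof (cases "a\<^sup>2 + b\<^sup>2 = 0")
    case False
    then have "0 < a\<^sup>2 + b\<^sup>2" by (simp add: sum_power2_gt_zero_iff)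
    then show ?thesis
      using \<open>(a\<^sup>2 + b\<^sup>2) * (a\<^sup>2 + b\<^sup>2) \<le> (a\<^sup>2 + b\<^sup>2) * (energy_const * s\<^sup>2)\<close> by (simp only: mult_le_cancel_left_pos)
  qed (use k in simp)
  have sq: "energy_const * s\<^sup>2 = (sqrt energy_const * s)\<^sup>2"
    using k by (simp add: power_mult_distrib)
  have "a\<^sup>2 \<le> (sqrt energy_const * s)\<^sup>2" "b\<^sup>2 \<le> (sqrt energy_const * s)\<^sup>2"
    using le sq zero_le_power2[of a] zero_le_power2[of b] by linarith+
  then show "L2_norm (lebesgue_on Q) V \<le> sqrt energy_const * star_norm T D C V"
    "L2_norm (lebesgue_on D) (\<lambda>x. V (0, x)) \<le> sqrt energy_const * star_norm T D C V"
    using k pos unfolding a_def b_def s_def by (auto intro: power2_le_imp_le)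
qed

abbreviation test_function :: "nat \<Rightarrow> ('a \<Rightarrow> real) \<Rightarrow> real \<times> 'a \<Rightarrow> real" where
  "test_function k q \<equiv> (\<lambda>(t, x). (T ^ Suc k - t ^ Suc k) / real (Suc k) * q x)"

lemma monomial_test_function:
  assumes q: "real_polynomial_function q"
  shows "test_function k q \<in> C1_plus T D C"
    "Bstar0 C (test_function k q) = (\<lambda>(t, x). (t ^ k + C (t, x) * ((T ^ Suc k - t ^ Suc k) / real (Suc k))) * q x)"
proof -
  let ?V = "test_function k q"
  have d: "((\<lambda>t. (T ^ Suc k - t ^ Suc k) / real (Suc k) * q x) has_real_derivative - (t ^ k * q x)) (at t)" for t x
    by (auto intro!: derivative_eq_intros simp del: power_Suc of_nat_Suc)
  show eq: "Bstar0 C ?V = (\<lambda>(t, x). (t ^ k + C (t, x) * ((T ^ Suc k - t ^ Suc k) / real (Suc k))) * q x)"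
  proof
    fix z :: "real \<times> 'a"
    obtain t x where z: "z = (t, x)" by (cases z)
    have "Bstar0 C ?V z = t ^ k * q x + C (t, x) * ((T ^ Suc k - t ^ Suc k) / real (Suc k) * q x)"
      by (simp only: Bstar0_def z prod.case DERIV_imp_deriv[OF d] minus_minus)
    then show "Bstar0 C ?V z = (case z of (t, x) \<Rightarrow> (t ^ k + C (t, x) * ((T ^ Suc k - t ^ Suc k) / real (Suc k))) * q x)"
      by (simp only: z prod.case distrib_right mult.assoc)
  qed
  have poly: "real_polynomial_function ?V"
  proof -
    have t: "real_polynomial_function (fst :: real \<times> 'a \<Rightarrow> real)"
      by (rule real_polynomial_function.intros(1)) (rule bounded_linear_fst)
    have "polynomial_function (snd :: real \<times> 'a \<Rightarrow> 'a)"
      by (rule polynomial_function_bounded_linear) (rule bounded_linear_snd)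
    from real_polynomial_function_compose[OF this q]
    have "real_polynomial_function (\<lambda>z :: real \<times> 'a. q (snd z))" by (simp add: o_def)
    then have "real_polynomial_function (\<lambda>z. (T ^ Suc k - fst z ^ Suc k) / real (Suc k) * q (snd z))"
      by (intro real_polynomial_function.intros(4) real_polynomial_function_divide real_polynomial_function_diff
          real_polynomial_function.intros(2) real_polynomial_function_power t)
    then show ?thesis by (simp add: case_prod_beta' del: power_Suc of_nat_Suc)
  qed
  have cont: "continuous_on S ?V" for S
    using poly by (simp add: continuous_on_polymonial_function real_polynomial_function_eq)
  have "C1_on Q ?V"
    using real_polynomial_function_C1[OF poly] unfolding C1_on_def by (meson continuous_on_subset subset_UNIV)
  moreover have "Bstar0 C ?V \<in> L2 (lebesgue_on Q)"
  proof -
    interpret Q: finite_measure "lebesgue_on Q" by (rule finite_lebesgue_on_Q)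
    have L2c: "f \<in> L2 (lebesgue_on Q)" if "continuous_on (closure Q) f" for f :: "real \<times> 'a \<Rightarrow> real"
    proof -
      have "bounded (f ` closure Q)"
        by (intro compact_imp_bounded compact_continuous_image that compact_closure_Q)
      then obtain B where "\<And>z. z \<in> closure Q \<Longrightarrow> \<bar>f z\<bar> \<le> B"
        by (fastforce simp: bounded_iff)
      then show ?thesis
        using closure_subset[of Q] unfolding lebesgue_on_Q
        by (intro finite_measure.L2_bounded[OF finite_lebesgue_on_Q[unfolded lebesgue_on_Q]] measurable_completion
            borel_measurable_P_continuous continuous_on_subset[OF that] AE_I2) (auto simp: space_P)
    qed
    have qc: "continuous_on S q" for S
      using q by (simp add: continuous_on_polymonial_function real_polynomial_function_eq)
    have "continuous_on (closure Q) (\<lambda>z. fst z ^ k * q (snd z))"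
      by (intro continuous_intros continuous_on_compose2[OF qc[of UNIV]]) auto
    from L2_add[OF L2c[OF this] L2_mult_bounded[OF L2c[OF cont] C]]
    show ?thesis unfolding eq by (simp add: case_prod_beta' algebra_simps del: power_Suc of_nat_Suc)
  qed
  ultimately show "?V \<in> C1_plus T D C"
    using cont by (auto simp: C1_plus_def)
qed

text \<open>
  In other words, \<open>B\<^sup>*\<close> maps the classical test functions onto a dense subspace of \<open>L\<^sup>2(Q)\<close>; the span of the products of a
  polynomial in \<open>t\<close> and one in \<open>x\<close> is already mapped densely.
\<close>
lemma orthogonal_to_range_zero:
  assumes W: "W \<in> L2 (lebesgue_on Q)"
    and orth: "\<And>V. V \<in> C1_plus T D C \<Longrightarrow> L2_inner (lebesgue_on Q) W (Bstar0 C V) = 0"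
  shows "AE z in lebesgue_on Q. W z = 0"
proof -
  obtain C' where C': "C' \<in> borel_measurable P" "\<And>z. \<bar>C' z\<bar> \<le> M" "AE z in P. C z = C' z"
    by (rule bounded_representative) blast
  obtain W' where W': "W' \<in> L2 P" "W' \<in> L2 (completion P)" "AE z in completion P. W z = W' z"
    "L2_norm (completion P) W = L2_norm P W'"
    using W unfolding lebesgue_on_Q by (rule L2_completion_representative)
  have "AE z in P. W' z = 0"
  proof (rule Volterra_dual_uniqueness_family[OF interval_product_axioms D(2) _ M C'(1,2) W'(1)])
    show "sets N = sets (restrict_space borel D)" by (intro sets_restrict_space_cong) simp
    fix k and q :: "'a \<Rightarrow> real" assume q: "real_polynomial_function q"
    let ?V = "test_function k q"
    let ?B = "\<lambda>(t, x). (t ^ k + C' (t, x) * ((T ^ Suc k - t ^ Suc k) / real (Suc k))) * q x"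
    note V = monomial_test_function[OF q, of k]
    have qc: "continuous_on UNIV q"
      using q by (simp add: continuous_on_polymonial_function real_polynomial_function_eq)
    have "continuous_on Q (\<lambda>z. fst z ^ k * q (snd z))"
      by (intro continuous_intros continuous_on_compose2[OF qc]) auto
    then have "(\<lambda>z. fst z ^ k * q (snd z)) \<in> borel_measurable P" by (rule borel_measurable_P_continuous)
    then have "(\<lambda>z. fst z ^ k * q (snd z) + C' z * ?V z) \<in> borel_measurable P"
      by (rule borel_measurable_add[OF _ borel_measurable_times[OF C'(1) L2_measurable[OF C1_plus_L2_P[OF V(1)]]]])
    then have Bm: "?B \<in> borel_measurable P"
      by (simp add: case_prod_beta' algebra_simps del: power_Suc of_nat_Suc)
    have "0 = L2_inner (completion P) W (Bstar0 C ?V)"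
      using orth[OF V(1)] by (simp only: lebesgue_on_Q)
    also have "\<dots> = L2_inner (completion P) W' ?B"
    proof (rule L2_inner_cong_AE)
      show "AE z in completion P. Bstar0 C ?V z = ?B z"
        unfolding V(2) using AE_completion[OF C'(3)] by eventually_elim auto
      show "Bstar0 C ?V \<in> borel_measurable (completion P)"
        using L2_measurable[OF C1_plusD(5)[OF V(1)]] by (simp only: lebesgue_on_Q)
      show "W \<in> borel_measurable (completion P)" using L2_measurable[OF W] by (simp only: lebesgue_on_Q)
    qed (intro W' L2_measurable[OF W'(2)] measurable_completion Bm)+
    also have "\<dots> = L2_inner P W' ?B"
      by (rule L2_inner_completion[OF L2_measurable[OF W'(1)] Bm])
    also have "\<dots> = (LINT (t, x)|P. W' (t, x) * ((t ^ k + C' (t, x) * ((T ^ Suc k - t ^ Suc k) / real (Suc k))) * q x))"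
      unfolding L2_inner_def by (simp add: case_prod_beta' del: power_Suc of_nat_Suc)
    finally show "(LINT (t, x)|P. W' (t, x) * ((t ^ k + C' (t, x) * ((T ^ Suc k - t ^ Suc k) / real (Suc k))) * q x)) = 0"
      by simp
  qed
  from AE_completion[OF this] W'(3) show ?thesis
    unfolding lebesgue_on_Q by eventually_elim simp
qed

text \<open>
  An element of the completion is a Cauchy sequence for \<open>\<parallel>B\<^sup>* V\<parallel>\<close>.  By the energy estimate the
  functions themselves and their traces are Cauchy as well, so all three limits exist and
  the identity for the members of the sequence carries over.
\<close>
theorem variational_solution_exists:
  assumes F: "F \<in> L2 (lebesgue_on Q)" and g: "g \<in> L2 (lebesgue_on D)"
  shows "\<exists>U. variational_solution T D C F g U"
proof -
  interpret Q: finite_measure "lebesgue_on Q" by (rule finite_lebesgue_on_Q)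
  interpret D: finite_measure "lebesgue_on D" by (rule finite_lebesgue_on_D)
  obtain U where U: "U \<in> L2 (lebesgue_on Q)"
    and eq: "\<And>V. V \<in> C1_plus T D C \<Longrightarrow> L2_inner (lebesgue_on Q) U (Bstar0 C V) =
      L2_inner (lebesgue_on Q) F V + L2_inner (lebesgue_on D) g (\<lambda>x. V (0, x))"
    by (rule weak_solution[OF F g]) blast
  have "L2_inner (lebesgue_on Q) U (Bstar T D C Vs) =
      L2_inner (lebesgue_on Q) F (Y_embed T D Vs) + L2_inner (lebesgue_on D) g (Y_trace D Vs)"
    if Vs: "Vs \<in> Yspace T D C" for Vs
  proof -
    have V: "Vs n \<in> C1_plus T D C" for n using Vs by (simp add: Yspace_def)
    define d where "d m n = (\<lambda>z. Vs m z - Vs n z)" for m n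
    have d: "d m n \<in> C1_plus T D C" for m n unfolding d_def by (rule C1_plus_diff(1)[OF V V])
    have cau: "\<forall>\<epsilon>>0. \<exists>K. \<forall>m\<ge>K. \<forall>n\<ge>K. star_norm T D C (d m n) < \<epsilon>"
      using Vs by (simp add: Yspace_def d_def)
    have k: "0 \<le> sqrt energy_const" using T by (simp add: energy_const_def)
    have cauchy: "\<forall>\<epsilon>>0. \<exists>K. \<forall>m\<ge>K. \<forall>n\<ge>K. p m n < \<epsilon>"
      if p: "\<And>m n. p m n \<le> sqrt energy_const * star_norm T D C (d m n)" for p :: "nat \<Rightarrow> nat \<Rightarrow> real"
    proof (intro allI impI)
      fix e :: real assume "0 < e"
      moreover have "0 < sqrt energy_const + 1" using k by linarith
      ultimately have "0 < e / (sqrt energy_const + 1)" by (rule divide_pos_pos)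
      with cau obtain K where K: "\<forall>m\<ge>K. \<forall>n\<ge>K. star_norm T D C (d m n) < e / (sqrt energy_const + 1)" by blast
      have "p m n < e" if "m \<ge> K" "n \<ge> K" for m n
      proof -
        have "star_norm T D C (d m n) * (sqrt energy_const + 1) < e"
          using K that k by (simp add: pos_less_divide_eq add_nonneg_pos)
        moreover have "0 \<le> star_norm T D C (d m n)" by (simp add: star_norm_def L2_norm_nonneg)
        ultimately show ?thesis using p[of m n] by (simp add: algebra_simps)
      qed
      then show "\<exists>K. \<forall>m\<ge>K. \<forall>n\<ge>K. p m n < e" by blast
    qed
    have c1: "\<forall>\<epsilon>>0. \<exists>K. \<forall>m\<ge>K. \<forall>n\<ge>K. L2_norm (lebesgue_on Q) (\<lambda>z. Bstar0 C (Vs m) z - Bstar0 C (Vs n) z) < \<epsilon>"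
    proof -
      have "L2_norm (lebesgue_on Q) (\<lambda>z. Bstar0 C (Vs m) z - Bstar0 C (Vs n) z) = star_norm T D C (d m n)" for m n
        unfolding star_norm_def d_def L2_norm_def L2_inner_def
        by (intro arg_cong[where f=sqrt] Bochner_Integration.integral_cong) (auto simp: C1_plus_diff(2)[OF V V])
      then show ?thesis using cau by simp
    qed
    have c2: "\<forall>\<epsilon>>0. \<exists>K. \<forall>m\<ge>K. \<forall>n\<ge>K. L2_norm (lebesgue_on Q) (\<lambda>z. Vs m z - Vs n z) < \<epsilon>"
      using energy_estimate(1)[OF d] by (intro cauchy) (simp add: d_def)
    have c3: "\<forall>\<epsilon>>0. \<exists>K. \<forall>m\<ge>K. \<forall>n\<ge>K. L2_norm (lebesgue_on D) (\<lambda>x. Vs m (0, x) - Vs n (0, x)) < \<epsilon>"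
      using energy_estimate(2)[OF d] by (intro cauchy) (simp add: d_def)
    note l1 = Q.L2_lim_Cauchy[of "\<lambda>n. Bstar0 C (Vs n)", OF C1_plusD(5)[OF V] c1]
    note l2 = Q.L2_lim_Cauchy[of Vs, OF C1_plus_L2[OF V] c2]
    note l3 = D.L2_lim_Cauchy[of "\<lambda>n x. Vs n (0, x)", OF C1_plus_trace_L2[OF V] c3]
    have "(\<lambda>n. L2_inner (lebesgue_on Q) U (Bstar0 C (Vs n))) \<longlonglongrightarrow> L2_inner (lebesgue_on Q) U (Bstar T D C Vs)"
      unfolding Bstar_def by (rule L2_inner_tendsto[OF U C1_plusD(5)[OF V] l1])
    moreover have "(\<lambda>n. L2_inner (lebesgue_on Q) F (Vs n) + L2_inner (lebesgue_on D) g (\<lambda>x. Vs n (0, x)))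
       \<longlonglongrightarrow> L2_inner (lebesgue_on Q) F (Y_embed T D Vs) + L2_inner (lebesgue_on D) g (Y_trace D Vs)"
      unfolding Y_embed_def Y_trace_def
      by (intro tendsto_add L2_inner_tendsto[OF F C1_plus_L2[OF V] l2] L2_inner_tendsto[OF g C1_plus_trace_L2[OF V] l3])
    ultimately show ?thesis
      unfolding eq[OF V] by (rule LIMSEQ_unique)
  qed
  then have "variational_solution T D C F g U"
    unfolding variational_solution_def using U by (simp add: L2_inner_def[of "lebesgue_on D"])
  then show ?thesis by (intro exI[of _ U])
qed

text \<open>
  A classical test function enters the completion as a constant sequence, on which the extended
  operator agrees with \<open>B\<^sup>*\<close> a.e.
\<close>
theorem variational_solution_unique:
  assumes "variational_solution T D C F g U" "variational_solution T D C F g U'"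
  shows "AE z in lebesgue_on Q. U z = U' z"
proof -
  interpret Q: finite_measure "lebesgue_on Q" by (rule finite_lebesgue_on_Q)
  have U: "U \<in> L2 (lebesgue_on Q)" "U' \<in> L2 (lebesgue_on Q)"
    using assms by (simp_all add: variational_solution_def)
  have "AE z in lebesgue_on Q. U z - U' z = 0"
  proof (rule orthogonal_to_range_zero[OF L2_diff[OF U]])
    fix V assume V: "V \<in> C1_plus T D C"
    have "star_norm T D C (\<lambda>z. V z - V z) = 0"
      by (simp add: star_norm_def L2_norm_def L2_inner_def Bstar0_def case_prod_beta')
    then have Y: "(\<lambda>n. V) \<in> Yspace T D C" using V by (simp add: Yspace_def)
    let ?B = "Bstar T D C (\<lambda>n. V)"
    have B: "?B \<in> L2 (lebesgue_on Q)" "AE z in lebesgue_on Q. ?B z = Bstar0 C V z"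
      unfolding Bstar_def using Q.L2_lim_const[OF C1_plusD(5)[OF V]] by simp_all
    have "L2_inner (lebesgue_on Q) U ?B = L2_inner (lebesgue_on Q) U' ?B"
      using assms Y unfolding variational_solution_def by simp
    moreover have "L2_inner (lebesgue_on Q) (\<lambda>z. U z - U' z) ?B = L2_inner (lebesgue_on Q) U ?B - L2_inner (lebesgue_on Q) U' ?B"
      unfolding L2_inner_def left_diff_distrib
      by (intro Bochner_Integration.integral_diff L2_mult_integrable U B)
    moreover have "L2_inner (lebesgue_on Q) (\<lambda>z. U z - U' z) (Bstar0 C V) = L2_inner (lebesgue_on Q) (\<lambda>z. U z - U' z) ?B"
    proof (rule L2_inner_cong_AE)
      show "AE z in lebesgue_on Q. Bstar0 C V z = ?B z" using B(2) by eventually_elim simp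
    qed (intro L2_measurable L2_diff U B C1_plusD(5)[OF V] | simp)+
    ultimately show "L2_inner (lebesgue_on Q) (\<lambda>z. U z - U' z) (Bstar0 C V) = 0" by simp
  qed
  then show ?thesis by eventually_elim simp
qed

end

section \<open>Push-forward under the flow\<close>

text \<open>
  The image under \<open>\<Phi>\<close> of the measure with density \<open>U\<close> is absolutely continuous with respect to the image
  of \<open>M\<close>; \<open>u\<close> is its Radon-Nikodym derivative.  For square-integrability, let \<open>w = min u n\<close>.  Then
    \<open>\<integral> w\<^sup>2 \<le> \<integral> u w = \<integral> U (w \<circ> \<Phi>) \<le> 1/2 \<integral> U\<^sup>2 + 1/2 \<integral> w\<^sup>2\<close>,
  where the last integral is finite and can be absorbed; let \<open>n \<rightarrow> \<infinity>\<close>.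
\<close>
lemma pushforward_conditional_expectation_nonneg:
  assumes M: "finite_measure M" and \<Phi>: "\<Phi> \<in> M \<rightarrow>\<^sub>M R"
    and U: "U \<in> L2 M" and pos: "\<And>x. 0 \<le> U x"
  obtains u where "u \<in> L2 (distr M R \<Phi>)"
    "\<And>\<phi>. \<phi> \<in> borel_measurable R \<Longrightarrow>
      (LINT y|distr M R \<Phi>. u y * \<phi> y) = (LINT x|M. U x * \<phi> (\<Phi> x))"
proof -
  interpret M: finite_measure M by (rule M)
  let ?\<sigma> = "distr M R \<Phi>" and ?d = "density M (\<lambda>x. ennreal (U x))"
  let ?\<nu> = "distr ?d R \<Phi>"
  interpret S: finite_measure ?\<sigma> by (rule M.finite_measure_distr[OF \<Phi>])
  note [measurable] = \<Phi>
  have Um[measurable]: "U \<in> borel_measurable M" using U by (rule L2_measurable)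
  have fin: "finite_measure ?\<nu>"
  proof (rule finite_measure.finite_measure_distr)
    have "(\<integral>\<^sup>+x. ennreal (U x) \<partial>M) < \<infinity>"
      using M.L2_integrable[OF U] pos by (simp add: integrable_iff_bounded)
    then show "finite_measure ?d"
      by (intro finite_measureI) (simp add: emeasure_density cong: nn_integral_cong)
  qed simp
  have ac: "absolutely_continuous ?\<sigma> ?\<nu>"
    unfolding absolutely_continuous_def
  proof
    fix A assume "A \<in> null_sets ?\<sigma>"
    then have A: "A \<in> sets R" "emeasure M (\<Phi> -` A \<inter> space M) = 0"
      by (auto simp: null_sets_def emeasure_distr)
    have "\<Phi> -` A \<inter> space M \<in> null_sets M" using A by (auto intro: measurable_sets)
    then have "emeasure ?d (\<Phi> -` A \<inter> space M) = 0"
      using absolutely_continuousI_density[of "\<lambda>x. ennreal (U x)" M]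
      by (auto simp: absolutely_continuous_def null_sets_def)
    then show "A \<in> null_sets ?\<nu>" using A(1) by (simp add: null_sets_def emeasure_distr)
  qed
  obtain u where um: "u \<in> borel_measurable ?\<sigma>" and uRN: "AE x in ?\<sigma>. RN_deriv ?\<sigma> ?\<nu> x = ennreal (u x)"
    and u0: "\<And>x. 0 \<le> u x"
    using S.real_RN_deriv[OF fin ac] by auto
  have \<nu>: "?\<nu> = density ?\<sigma> (\<lambda>x. ennreal (u x))"
  proof -
    have "?\<nu> = density ?\<sigma> (RN_deriv ?\<sigma> ?\<nu>)"
      using S.density_RN_deriv[OF ac] by simp
    also have "\<dots> = density ?\<sigma> (\<lambda>x. ennreal (u x))"
      using uRN um by (intro density_cong) auto
    finally show ?thesis .
  qed
  have um'[measurable]: "u \<in> borel_measurable R" using um by simp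
  have eq: "(LINT y|?\<sigma>. u y * \<phi> y) = (LINT x|M. U x * \<phi> (\<Phi> x))" if [measurable]: "\<phi> \<in> borel_measurable R" for \<phi>
  proof -
    have "(LINT y|?\<sigma>. u y * \<phi> y) = (LINT y|density ?\<sigma> (\<lambda>x. ennreal (u x)). \<phi> y)"
      using u0 by (subst integral_real_density) auto
    also have "\<dots> = (LINT y|?\<nu>. \<phi> y)" by (simp only: \<nu>)
    also have "\<dots> = (LINT x|?d. \<phi> (\<Phi> x))" by (subst integral_distr) auto
    also have "\<dots> = (LINT x|M. U x * \<phi> (\<Phi> x))" using pos by (subst integral_real_density) auto
    finally show ?thesis .
  qed
  have nneq: "(\<integral>\<^sup>+y. ennreal (u y) * \<phi> y \<partial>?\<sigma>) = (\<integral>\<^sup>+x. ennreal (U x) * \<phi> (\<Phi> x) \<partial>M)"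
    if [measurable]: "\<phi> \<in> borel_measurable R" for \<phi> :: "_ \<Rightarrow> ennreal"
  proof -
    have "(\<integral>\<^sup>+y. ennreal (u y) * \<phi> y \<partial>?\<sigma>) = (\<integral>\<^sup>+y. \<phi> y \<partial>density ?\<sigma> (\<lambda>x. ennreal (u x)))"
      by (subst nn_integral_density) auto
    also have "\<dots> = (\<integral>\<^sup>+y. \<phi> y \<partial>?\<nu>)" by (simp only: \<nu>)
    also have "\<dots> = (\<integral>\<^sup>+x. \<phi> (\<Phi> x) \<partial>?d)" by (subst nn_integral_distr) auto
    also have "\<dots> = (\<integral>\<^sup>+x. ennreal (U x) * \<phi> (\<Phi> x) \<partial>M)" by (subst nn_integral_density) auto
    finally show ?thesis .
  qed
  define a where "a = L2_norm M U"
  have aU: "(\<integral>\<^sup>+x. ennreal ((U x)\<^sup>2) \<partial>M) \<le> ennreal (a\<^sup>2)"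
    using L2_norm_le_iff[OF Um, of a] U by (simp add: a_def L2_norm_nonneg)
  have trunc: "(\<integral>\<^sup>+y. ennreal ((min (u y) (real n))\<^sup>2) \<partial>?\<sigma>) \<le> ennreal (a\<^sup>2)" for n
  proof -
    let ?w = "\<lambda>y. min (u y) (real n)"
    let ?x = "(\<integral>\<^sup>+y. ennreal ((?w y)\<^sup>2) \<partial>?\<sigma>)"
    have w0: "0 \<le> ?w y" for y using u0 by simp
    have "?x \<le> (\<integral>\<^sup>+y. ennreal ((real n)\<^sup>2) \<partial>?\<sigma>)"
      using w0 by (intro nn_integral_mono ennreal_leI power_mono) auto
    also have "\<dots> < \<infinity>" using S.emeasure_finite[of "space R"] by (simp add: ennreal_mult_eq_top_iff less_top[symmetric])
    finally have xfin: "?x < \<infinity>" .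
    have "?x \<le> (\<integral>\<^sup>+y. ennreal (u y) * ennreal (?w y) \<partial>?\<sigma>)"
      using w0 u0 by (intro nn_integral_mono) (auto simp: ennreal_mult[symmetric] power2_eq_square intro!: ennreal_leI mult_right_mono)
    also have "\<dots> = (\<integral>\<^sup>+x. ennreal (U x) * ennreal (?w (\<Phi> x)) \<partial>M)"
      by (rule nneq) measurable
    finally have 1: "?x \<le> (\<integral>\<^sup>+x. ennreal (U x) * ennreal (?w (\<Phi> x)) \<partial>M)" .
    have "?x + ?x \<le> 2 * (\<integral>\<^sup>+x. ennreal (U x) * ennreal (?w (\<Phi> x)) \<partial>M)"
      using add_mono[OF 1 1] by (simp add: mult_2)
    also have "\<dots> = (\<integral>\<^sup>+x. 2 * (ennreal (U x) * ennreal (?w (\<Phi> x))) \<partial>M)"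
      by (subst nn_integral_cmult) auto
    also have "\<dots> \<le> (\<integral>\<^sup>+x. ennreal ((U x)\<^sup>2) + ennreal ((?w (\<Phi> x))\<^sup>2) \<partial>M)"
    proof (rule nn_integral_mono)
      fix x
      have "2 * (U x * ?w (\<Phi> x)) \<le> (U x)\<^sup>2 + (?w (\<Phi> x))\<^sup>2"
        using sum_squares_bound[of "U x" "?w (\<Phi> x)"] by simp
      then have "ennreal (2 * (U x * ?w (\<Phi> x))) \<le> ennreal ((U x)\<^sup>2 + (?w (\<Phi> x))\<^sup>2)" by (rule ennreal_leI)
      then show "2 * (ennreal (U x) * ennreal (?w (\<Phi> x))) \<le> ennreal ((U x)\<^sup>2) + ennreal ((?w (\<Phi> x))\<^sup>2)"
        using pos w0 by (simp add: ennreal_mult)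
    qed
    also have "\<dots> = (\<integral>\<^sup>+x. ennreal ((U x)\<^sup>2) \<partial>M) + (\<integral>\<^sup>+x. ennreal ((?w (\<Phi> x))\<^sup>2) \<partial>M)"
      by (rule nn_integral_add) measurable
    also have "(\<integral>\<^sup>+x. ennreal ((?w (\<Phi> x))\<^sup>2) \<partial>M) = ?x"
      by (subst nn_integral_distr) auto
    also have "(\<integral>\<^sup>+x. ennreal ((U x)\<^sup>2) \<partial>M) + ?x \<le> ennreal (a\<^sup>2) + ?x"
      by (intro add_mono aU) simp
    finally have "?x + ?x \<le> ?x + ennreal (a\<^sup>2)" by (simp add: add.commute)
    then show ?thesis using xfin by (subst (asm) ennreal_add_left_cancel_le) auto
  qed
  have "(\<integral>\<^sup>+y. ennreal ((u y)\<^sup>2) \<partial>?\<sigma>) = (\<integral>\<^sup>+y. liminf (\<lambda>n. ennreal ((min (u y) (real n))\<^sup>2)) \<partial>?\<sigma>)"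
  proof (rule nn_integral_cong)
    fix y
    obtain K :: nat where K: "u y \<le> real K" using real_arch_simple by blast
    have "\<forall>\<^sub>F n in sequentially. ennreal ((min (u y) (real n))\<^sup>2) = ennreal ((u y)\<^sup>2)"
      using eventually_ge_at_top[of K] by eventually_elim (use K in \<open>simp add: min_absorb1\<close>)
    then have "(\<lambda>n. ennreal ((min (u y) (real n))\<^sup>2)) \<longlonglongrightarrow> ennreal ((u y)\<^sup>2)"
      by (rule tendsto_eventually)
    then show "ennreal ((u y)\<^sup>2) = liminf (\<lambda>n. ennreal ((min (u y) (real n))\<^sup>2))"
      by (rule lim_imp_Liminf[OF sequentially_bot, symmetric])
  qed
  also have "\<dots> \<le> liminf (\<lambda>n. \<integral>\<^sup>+y. ennreal ((min (u y) (real n))\<^sup>2) \<partial>?\<sigma>)"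
    by (rule nn_integral_liminf) simp
  also have "\<dots> \<le> liminf (\<lambda>n. ennreal (a\<^sup>2))"
    by (intro Liminf_mono always_eventually allI trunc)
  also have "\<dots> = ennreal (a\<^sup>2)" by (rule Liminf_const[OF trivial_limit_sequentially])
  finally have "u \<in> L2 ?\<sigma>"
    using L2_norm_le_iff[OF um, of a] by (simp add: a_def L2_norm_nonneg)
  then show thesis using that eq by blast
qed

lemma pushforward_conditional_expectation:
  fixes \<Phi> :: "'x \<Rightarrow> 'y"
  assumes M: "finite_measure M" and \<Phi>: "\<Phi> \<in> M \<rightarrow>\<^sub>M R" and U: "U \<in> L2 M"
  obtains u where "u \<in> L2 (distr M R \<Phi>)"
    "\<And>\<phi> B. \<phi> \<in> borel_measurable R \<Longrightarrow> (\<And>y. y \<in> space R \<Longrightarrow> \<bar>\<phi> y\<bar> \<le> B) \<Longrightarrow>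
      (LINT y|distr M R \<Phi>. u y * \<phi> y) = (LINT x|M. U x * \<phi> (\<Phi> x))"
proof -
  interpret M: finite_measure M by (rule M)
  interpret S: finite_measure "distr M R \<Phi>" by (rule M.finite_measure_distr[OF \<Phi>])
  have Um: "U \<in> borel_measurable M" using U by (rule L2_measurable)
  have L2b: "f \<in> L2 M" if "f \<in> borel_measurable M" "\<And>x. \<bar>f x\<bar> \<le> \<bar>U x\<bar>" for f
  proof -
    have "integrable M (\<lambda>x. (f x)\<^sup>2)"
      using that by (intro Bochner_Integration.integrable_bound[OF L2_square_integrable[OF U]])
        (auto simp: abs_le_square_iff)
    then show ?thesis using that by (simp add: L2_def)
  qed
  have U12: "(\<lambda>x. max 0 (U x)) \<in> L2 M" "(\<lambda>x. max 0 (- U x)) \<in> L2 M"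
    using Um by (auto intro!: L2b)
  obtain u1 where u1: "u1 \<in> L2 (distr M R \<Phi>)" "\<And>\<phi>. \<phi> \<in> borel_measurable R \<Longrightarrow>
      (LINT y|distr M R \<Phi>. u1 y * \<phi> y) = (LINT x|M. max 0 (U x) * \<phi> (\<Phi> x))"
    by (rule pushforward_conditional_expectation_nonneg[OF M \<Phi> U12(1)]) auto
  obtain u2 where u2: "u2 \<in> L2 (distr M R \<Phi>)" "\<And>\<phi>. \<phi> \<in> borel_measurable R \<Longrightarrow>
      (LINT y|distr M R \<Phi>. u2 y * \<phi> y) = (LINT x|M. max 0 (- U x) * \<phi> (\<Phi> x))"
    by (rule pushforward_conditional_expectation_nonneg[OF M \<Phi> U12(2)]) auto
  show thesis
  proof (rule that[OF L2_diff[OF u1(1) u2(1)]])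
    fix \<phi> :: "'y \<Rightarrow> real" and B assume \<phi>: "\<phi> \<in> borel_measurable R" and B: "\<And>y. y \<in> space R \<Longrightarrow> \<bar>\<phi> y\<bar> \<le> B"
    have L1: "\<phi> \<in> L2 (distr M R \<Phi>)"
      using \<phi> B by (intro S.L2_bounded[of _ B]) (auto intro!: AE_I2)
    have L2: "(\<lambda>x. \<phi> (\<Phi> x)) \<in> L2 M"
      using measurable_compose[OF \<Phi> \<phi>] B measurable_space[OF \<Phi>] by (intro M.L2_bounded[of _ B]) (auto intro!: AE_I2)
    have "(LINT y|distr M R \<Phi>. (u1 y - u2 y) * \<phi> y) =
        (LINT x|M. max 0 (U x) * \<phi> (\<Phi> x)) - (LINT x|M. max 0 (- U x) * \<phi> (\<Phi> x))"
      unfolding left_diff_distrib u1(2)[OF \<phi>, symmetric] u2(2)[OF \<phi>, symmetric]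
      by (intro Bochner_Integration.integral_diff L2_mult_integrable u1 u2 L1)
    also have "\<dots> = (LINT x|M. max 0 (U x) * \<phi> (\<Phi> x) - max 0 (- U x) * \<phi> (\<Phi> x))"
      by (intro Bochner_Integration.integral_diff[symmetric] L2_mult_integrable U12 L2)
    also have "\<dots> = (LINT x|M. U x * \<phi> (\<Phi> x))"
      by (rule Bochner_Integration.integral_cong) (auto simp: max_def)
    finally show "(LINT y|distr M R \<Phi>. (u1 y - u2 y) * \<phi> y) = (LINT x|M. U x * \<phi> (\<Phi> x))" .
  qed
qed

lemma absolutely_continuous_curve_continuous:
  assumes "absolutely_continuous_curve a b \<gamma>"
  shows "continuous_on {a..b} \<gamma>"
  unfolding continuous_on_iff
proof (intro ballI allI impI)
  fix t e :: real assume t: "t \<in> {a..b}" and "0 < e"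
  then obtain d where "0 < d" and d: "\<And>J. finite J \<Longrightarrow> (\<forall>(p, q)\<in>J. a \<le> p \<and> p \<le> q \<and> q \<le> b) \<Longrightarrow>
      disjoint_family_on (\<lambda>(p, q). {p<..<q}) J \<Longrightarrow> (\<Sum>(p, q)\<in>J. q - p) < d \<Longrightarrow>
      (\<Sum>(p, q)\<in>J. dist (\<gamma> p) (\<gamma> q)) < e"
    using assms unfolding absolutely_continuous_curve_def by meson
  have "dist (\<gamma> s) (\<gamma> t) < e" if "s \<in> {a..b}" "dist s t < d" for s
    using d[of "{(s, t)}"] d[of "{(t, s)}"] that t
    by (cases "s \<le> t") (auto simp: disjoint_family_on_def dist_real_def dist_commute)
  then show "\<exists>d>0. \<forall>s\<in>{a..b}. dist s t < d \<longrightarrow> dist (\<gamma> s) (\<gamma> t) < e"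
    using \<open>0 < d\<close> by blast
qed

text \<open>
  Rounding \<open>t\<close> down to multiples of \<open>1 / (n + 1)\<close> leaves countably many times, so each rounded map is jointly
  measurable; continuity in \<open>t\<close> gives pointwise convergence.
\<close>
lemma Caratheodory_measurable:
  fixes X :: "real \<Rightarrow> 'x \<Rightarrow> 'c::metric_space"
  assumes m: "\<And>t. t \<in> {0..T} \<Longrightarrow> X t \<in> borel_measurable N"
    and c: "\<And>x. x \<in> space N \<Longrightarrow> continuous_on {0..T} (\<lambda>t. X t x)"
  shows "(\<lambda>z. X (fst z) (snd z)) \<in> borel_measurable (interval_measure T \<Otimes>\<^sub>M N)"
proof -
  let ?P = "interval_measure T \<Otimes>\<^sub>M N"
  let ?r = "\<lambda>n t. real_of_int \<lfloor>t * real (Suc n)\<rfloor> / real (Suc n)"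
  have [measurable]: "fst \<in> ?P \<rightarrow>\<^sub>M borel"
    by (rule measurable_compose[OF measurable_fst measurable_interval_measure_ident])
  have r: "0 \<le> ?r n t" "?r n t \<le> t" "t - 1 / real (Suc n) \<le> ?r n t" if "0 < t" for n t
  proof -
    show "0 \<le> ?r n t" using that by simp
    show "?r n t \<le> t" by (subst pos_divide_le_eq) auto
    have "t * real (Suc n) - 1 \<le> real_of_int \<lfloor>t * real (Suc n)\<rfloor>" by linarith
    then have "(t * real (Suc n) - 1) / real (Suc n) \<le> ?r n t"
      by (rule divide_right_mono) simp
    then show "t - 1 / real (Suc n) \<le> ?r n t" by (simp add: diff_divide_distrib del: of_nat_Suc)
  qed
  have rI: "?r n (fst z) \<in> {0..T}" if "z \<in> space ?P" for n z
    using r(1,2)[of "fst z" n] that by (auto simp: space_pair_measure simp del: of_nat_Suc)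
  show ?thesis
  proof (cases "0 < T")
    case False
    then have "space ?P = {}" by (simp add: space_pair_measure)
    then show ?thesis by (simp add: measurable_def)
  next
    case True
    have meas: "(\<lambda>z. X (?r n (fst z)) (snd z)) \<in> borel_measurable ?P" for n
    proof -
      \<comment> \<open>\<open>X\<close> is measurable only at times in \<open>{0..T}\<close>; multiples outside do not occur and are sent to \<open>0\<close>.\<close>
      let ?f = "\<lambda>(i::int) z. X (if real_of_int i / real (Suc n) \<in> {0..T} then real_of_int i / real (Suc n) else 0) (snd z)"
      have "(\<lambda>z. ?f \<lfloor>fst z * real (Suc n)\<rfloor> z) \<in> borel_measurable ?P"
      proof (rule measurable_compose_countable[where f="?f" and g="\<lambda>z. \<lfloor>fst z * real (Suc n)\<rfloor>"])
        show "?f i \<in> borel_measurable ?P" for i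
          using True by (intro measurable_compose[OF measurable_snd m]) auto
        show "(\<lambda>z. \<lfloor>fst z * real (Suc n)\<rfloor>) \<in> ?P \<rightarrow>\<^sub>M count_space UNIV" by measurable
      qed
      also have "?this \<longleftrightarrow> (\<lambda>z. X (?r n (fst z)) (snd z)) \<in> borel_measurable ?P"
        by (rule measurable_cong) (simp only: rI if_True)
      finally show ?thesis .
    qed
    have conv: "(\<lambda>n. X (?r n (fst z)) (snd z)) \<longlonglongrightarrow> X (fst z) (snd z)" if zP: "z \<in> space ?P" for z
    proof -
      from zP have z: "0 < fst z" "fst z < T" "snd z \<in> space N" by (auto simp: space_pair_measure)
      have lim: "(\<lambda>n. ?r n (fst z)) \<longlonglongrightarrow> fst z"
      proof (rule tendsto_sandwich)
        have "(\<lambda>n. fst z - 1 / real (Suc n)) \<longlonglongrightarrow> fst z - 0"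
          by (intro tendsto_diff tendsto_const LIMSEQ_inverse_real_of_nat[unfolded inverse_eq_divide])
        then show "(\<lambda>n. fst z - 1 / real (Suc n)) \<longlonglongrightarrow> fst z" by simp
        show "\<forall>\<^sub>F n in sequentially. fst z - 1 / real (Suc n) \<le> ?r n (fst z)"
          by (intro always_eventually allI r(3) z)
        show "\<forall>\<^sub>F n in sequentially. ?r n (fst z) \<le> fst z"
          by (intro always_eventually allI r(2) z)
      qed simp
      have "\<forall>n. ?r n (fst z) \<in> {0..T}" using rI[OF zP] by blast
      moreover have "fst z \<in> {0..T}" using z by auto
      ultimately show ?thesis
        by (intro continuous_on_tendsto_compose[OF c[OF z(3)] lim] always_eventually)
    qed
    show ?thesis by (rule borel_measurable_LIMSEQ_metric[OF meas conv])
  qed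
qed

locale measurable_flow = space_time_cylinder T D
  for T :: real and D :: "'a::euclidean_space set" +
  fixes X :: "real \<Rightarrow> 'a \<Rightarrow> 'a"
  assumes X_in: "\<And>t x. t \<in> {0..T} \<Longrightarrow> x \<in> closure D \<Longrightarrow> X t x \<in> closure D"
    and X_meas: "\<And>t. t \<in> {0..T} \<Longrightarrow> X t \<in> borel_measurable (restrict_space borel (closure D))"
    and X_cont: "\<And>x. x \<in> closure D \<Longrightarrow> continuous_on {0..T} (\<lambda>t. X t x)"
begin

abbreviation "K \<equiv> closure (cylinder T D)"
abbreviation "R \<equiv> restrict_space borel (closure (cylinder T D))"

definition flow_map :: "real \<times> 'a \<Rightarrow> real \<times> 'a" where
  "flow_map = (\<lambda>(t, x). (t, X t x))"

lemma X_meas_N: "t \<in> {0..T} \<Longrightarrow> X t \<in> borel_measurable N"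
  using measurable_restrict_mono[OF X_meas closure_subset]
  by (subst measurable_cong_sets[OF sets_restrict_space_cong[of lborel borel] refl]) auto

lemma flow_map_measurable_P: "flow_map \<in> P \<rightarrow>\<^sub>M R"
proof (rule measurable_restrict_space2)
  show "flow_map \<in> space P \<rightarrow> K"
  proof
    fix z assume "z \<in> space P"
    then have "0 \<le> fst z" "fst z \<le> T" "snd z \<in> closure D"
      using closure_subset[of D] by (auto simp: space_P cylinder_def)
    then show "flow_map z \<in> K"
      using X_in[of "fst z" "snd z"] by (auto simp: closure_Q flow_map_def case_prod_beta')
  qed
  have "(\<lambda>z. (fst z, X (fst z) (snd z))) \<in> P \<rightarrow>\<^sub>M borel"
    unfolding borel_prod[symmetric]
  proof (rule measurable_Pair)
    show "fst \<in> P \<rightarrow>\<^sub>M borel"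
      by (rule measurable_compose[OF measurable_fst measurable_interval_measure_ident])
    show "(\<lambda>z. X (fst z) (snd z)) \<in> borel_measurable P"
      using closure_subset[of D]
      by (intro Caratheodory_measurable X_meas_N X_cont) (auto simp: space_restrict_space)
  qed
  then show "flow_map \<in> P \<rightarrow>\<^sub>M borel"
    by (simp add: flow_map_def case_prod_beta')
qed

lemma flow_map_measurable: "flow_map \<in> lebesgue_on (cylinder T D) \<rightarrow>\<^sub>M R"
  unfolding lebesgue_on_Q by (rule measurable_completion[OF flow_map_measurable_P])

text \<open>
  Slicing the product measure of a preimage under the flow map at time \<open>t\<close> gives
  \<open>\<rho>(t, A\<^sub>t)\<close>.  The two descriptions of the time integral differ by the endpoints \<open>0\<close> and \<open>T\<close>, a
  null set.  Since the set function is thereby identified with a measure, the countable additivity required by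
  \<^const>\<open>measure_of\<close> comes for free.
\<close>
lemma spacetime_measure_eq: "spacetime_measure T D X = distr (lebesgue_on (cylinder T D)) R flow_map"
proof -
  let ?m = "distr (lebesgue_on (cylinder T D)) R flow_map"
  have spR: "space R = K" by (simp add: space_restrict_space)
  have slice: "(\<integral>\<^sup>+ t. emeasure (pushforward_density D X t) (Pair t -` A) \<partial>lebesgue_on {0..T}) = emeasure ?m A"
    if A: "A \<in> sets R" for A
  proof -
    have AK: "A \<in> sets borel" using A by (auto simp: sets_restrict_space)
    define S where "S = flow_map -` A \<inter> space P"
    have S: "S \<in> sets P" unfolding S_def using flow_map_measurable_P A by (rule measurable_sets)
    have eq: "emeasure (pushforward_density D X t) (Pair t -` A) = emeasure N (Pair t -` S)"
      if t: "t \<in> {0<..<T}" for t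
    proof -
      have tX: "X t \<in> borel_measurable (lebesgue_on D)"
        unfolding lebesgue_on_D using t by (intro measurable_completion X_meas_N) auto
      have "Pair t \<in> borel \<rightarrow>\<^sub>M (borel :: (real \<times> 'a) measure)"
        by (rule borel_measurable_continuous_onI) (intro continuous_intros)
      from measurable_sets[OF this AK] have PA: "Pair t -` A \<in> sets borel" by simp
      have "emeasure (pushforward_density D X t) (Pair t -` A) = emeasure (completion N) (X t -` (Pair t -` A) \<inter> D)"
        unfolding pushforward_density_def using tX PA by (subst emeasure_distr) (auto simp: lebesgue_on_D[symmetric])
      also have "X t -` (Pair t -` A) \<inter> D = Pair t -` S"
        using t by (auto simp: S_def space_P cylinder_def flow_map_def)
      also have "emeasure (completion N) (Pair t -` S) = emeasure N (Pair t -` S)"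
        using sets_Pair1[OF S] by simp
      finally show ?thesis .
    qed
    let ?g = "\<lambda>t. emeasure (pushforward_density D X t) (Pair t -` A)"
    have ae: "AE t in lebesgue. t \<noteq> 0 \<and> t \<noteq> T"
      by (intro AE_completion AE_conjI) (auto intro: AE_lborel_singleton)
    have "(\<integral>\<^sup>+ t. ?g t \<partial>lebesgue_on {0..T}) = (\<integral>\<^sup>+ t. ?g t * indicator {0..T} t \<partial>lebesgue)"
      by (subst nn_integral_restrict_space) auto
    also have "\<dots> = (\<integral>\<^sup>+ t. ?g t * indicator {0<..<T} t \<partial>lebesgue)"
      by (rule nn_integral_cong_AE) (use ae in eventually_elim, auto simp: indicator_def)
    also have "\<dots> = (\<integral>\<^sup>+ t. ?g t \<partial>lebesgue_on {0<..<T})"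
      by (subst nn_integral_restrict_space) auto
    also have "lebesgue_on {0<..<T} = completion (interval_measure T)"
      unfolding interval_measure_def by (rule lebesgue_on_eq_completion) simp
    also have "(\<integral>\<^sup>+ t. ?g t \<partial>completion (interval_measure T)) = (\<integral>\<^sup>+ t. emeasure N (Pair t -` S) \<partial>interval_measure T)"
      unfolding nn_integral_completion by (rule nn_integral_cong) (simp add: eq)
    also have "\<dots> = emeasure P S"
      by (rule N.emeasure_pair_measure_alt[OF S, symmetric])
    also have "\<dots> = emeasure (completion P) S" using S by simp
    also have "\<dots> = emeasure ?m A"
      using A flow_map_measurable by (subst emeasure_distr) (auto simp: S_def lebesgue_on_Q)
    finally show ?thesis .
  qed
  have "spacetime_measure T D X = measure_of K (sets R) (emeasure ?m)"
    unfolding spacetime_measure_def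
  proof (rule measure_of_eq)
    show "sets R \<subseteq> Pow K" using sets.space_closed[of R] spR by simp
    fix A assume "A \<in> sigma_sets K (sets R)"
    then have "A \<in> sets R" using sets.sigma_sets_eq[of R] spR by simp
    then show "(\<integral>\<^sup>+ t. emeasure (pushforward_density D X t) (Pair t -` A) \<partial>lebesgue_on {0..T}) = emeasure ?m A"
      by (rule slice)
  qed
  also have "\<dots> = ?m"
    using measure_of_of_measure[of ?m] spR by simp
  finally show ?thesis .
qed

end

theorem theorem4p5:
  fixes T :: real
    and D :: "'a::euclidean_space set"
    and b :: "real \<times> 'a \<Rightarrow> 'a"
    and X :: "real \<Rightarrow> 'a \<Rightarrow> 'a"
    and c f :: "real \<times> 'a \<Rightarrow> real"
    and u\<^sub>0 :: "'a \<Rightarrow> real"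
  assumes "T > 0"
    and "bounded_Lipschitz_domain D"
    and "b \<in> Linfty (lebesgue_on (closure (cylinder T D)))"
    and "\<And>t x. t \<in> {0..T} \<Longrightarrow> x \<in> closure D \<Longrightarrow> X t x \<in> closure D"
    and "\<And>t. t \<in> {0..T} \<Longrightarrow> X t \<in> borel_measurable (restrict_space borel (closure D))"
    and "\<And>x. x \<in> closure D \<Longrightarrow> Filippov_solution T (closure D) b x (\<lambda>t. X t x)"
    and "forward_untangled T (closure D) X"
    and "c \<in> Linfty (spacetime_measure T D X)"
    and "AE z in spacetime_measure T D X. c z \<ge> 0"
    and "f \<in> L2 (spacetime_measure T D X)"
    and "u\<^sub>0 \<in> L2 (lebesgue_on D)"
  shows "\<exists>u. flow_solution T D X c f u\<^sub>0 u \<and>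
           (\<forall>v. flow_solution T D X c f u\<^sub>0 v \<longrightarrow> (AE z in spacetime_measure T D X. v z = u z))"
proof -
  have D: "open D" "bounded D" using assms(2) by (simp_all add: bounded_Lipschitz_domain_def)
  interpret measurable_flow T D X
  proof
    show "continuous_on {0..T} (\<lambda>t. X t x)" if "x \<in> closure D" for x
      using assms(6)[OF that] by (auto simp: Filippov_solution_def intro: absolutely_continuous_curve_continuous)
  qed (use assms D in auto)
  let ?Q = "lebesgue_on (cylinder T D)"
  define C F where "C = (\<lambda>(t, x). c (t, X t x))" and "F = (\<lambda>(t, x). f (t, X t x))"
  have CF: "C = (\<lambda>z. c (flow_map z))" "F = (\<lambda>z. f (flow_map z))"
    by (auto simp: C_def F_def flow_map_def)
  note \<sigma> = spacetime_measure_eq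
  have cm: "c \<in> borel_measurable R" using assms(8) by (simp add: \<sigma> Linfty_def)
  obtain M0 where "AE z in spacetime_measure T D X. norm (c z) \<le> M0"
    using assms(8) by (auto simp: Linfty_def)
  then have M0: "AE z in ?Q. norm (c (flow_map z)) \<le> M0"
    unfolding \<sigma> by (rule AE_distrD[OF flow_map_measurable])
  \<comment> \<open>Positive, because the contraction estimate divides by \<open>M\<close>.\<close>
  define M where "M = max 1 M0"
  interpret damped_evolution T D C M
  proof
    show "C \<in> borel_measurable ?Q" unfolding CF by (rule measurable_compose[OF flow_map_measurable cm])
    show "AE z in ?Q. \<bar>C z\<bar> \<le> M" using M0 unfolding CF M_def by eventually_elim auto
  qed (use assms(1) D in \<open>auto simp: M_def\<close>)
  interpret Q: finite_measure ?Q by (rule finite_lebesgue_on_Q)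
  have fm: "f \<in> borel_measurable R" using assms(10) by (simp add: \<sigma> L2_def)
  have F: "F \<in> L2 ?Q"
    using assms(10) measurable_compose[OF flow_map_measurable fm] flow_map_measurable fm
    by (simp add: \<sigma> L2_def CF integrable_distr_eq)
  obtain U where U: "variational_solution T D C F u\<^sub>0 U"
    using variational_solution_exists[OF F assms(11)] by blast
  then have UL: "U \<in> L2 ?Q" by (simp add: variational_solution_def)
  obtain u where uL: "u \<in> L2 (distr ?Q R flow_map)" and ueq: "\<And>\<phi> B. \<phi> \<in> borel_measurable R \<Longrightarrow>
      (\<And>y. y \<in> space R \<Longrightarrow> \<bar>\<phi> y\<bar> \<le> B) \<Longrightarrow>
      (LINT y|distr ?Q R flow_map. u y * \<phi> y) = (LINT x|?Q. U x * \<phi> (flow_map x))"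
    by (rule pushforward_conditional_expectation[OF Q.finite_measure_axioms flow_map_measurable UL]) blast
  have test: "\<phi> \<in> borel_measurable R" "\<exists>B. \<forall>y\<in>space R. \<bar>\<phi> y\<bar> \<le> B"
    if "continuous_on K \<phi>" for \<phi> :: "real \<times> 'a \<Rightarrow> real"
  proof -
    show "\<phi> \<in> borel_measurable R" by (rule borel_measurable_continuous_on_restrict[OF that])
    have "bounded (\<phi> ` K)" by (intro compact_imp_bounded compact_continuous_image that compact_closure_Q)
    then show "\<exists>B. \<forall>y\<in>space R. \<bar>\<phi> y\<bar> \<le> B"
      by (auto simp: bounded_iff space_restrict_space)
  qed
  have usol: "flow_solution T D X c f u\<^sub>0 u"
    unfolding flow_solution_def C_def[symmetric] F_def[symmetric]
  proof (intro conjI exI[of _ U] allI impI U)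
    show "u \<in> L2 (spacetime_measure T D X)" using uL by (simp only: \<sigma>)
    fix \<phi> :: "real \<times> 'a \<Rightarrow> real" assume "continuous_on K \<phi>"
    note \<phi> = test[OF this]
    from \<phi>(2) obtain B where "\<And>y. y \<in> space R \<Longrightarrow> \<bar>\<phi> y\<bar> \<le> B" by blast
    from ueq[OF \<phi>(1) this]
    show "(LINT z|spacetime_measure T D X. u z * \<phi> z) = (LINT (t, x)|?Q. U (t, x) * \<phi> (t, X t x))"
      by (simp add: \<sigma> flow_map_def case_prod_beta')
  qed
  have "AE z in spacetime_measure T D X. v z = u z" if v: "flow_solution T D X c f u\<^sub>0 v" for v
  proof -
    obtain U' where U': "variational_solution T D C F u\<^sub>0 U'"
      and veq: "\<And>\<phi>. continuous_on K \<phi> \<Longrightarrow>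
        (LINT z|spacetime_measure T D X. v z * \<phi> z) = (LINT (t, x)|?Q. U' (t, x) * \<phi> (t, X t x))"
      using v unfolding flow_solution_def C_def[symmetric] F_def[symmetric] by blast
    obtain U'' where U'': "variational_solution T D C F u\<^sub>0 U''"
      and ueq': "\<And>\<phi>. continuous_on K \<phi> \<Longrightarrow>
        (LINT z|spacetime_measure T D X. u z * \<phi> z) = (LINT (t, x)|?Q. U'' (t, x) * \<phi> (t, X t x))"
      using usol unfolding flow_solution_def C_def[symmetric] F_def[symmetric] by blast
    have vL: "v \<in> L2 (distr ?Q R flow_map)" using v by (simp add: flow_solution_def \<sigma>)
    have U'm: "U' \<in> borel_measurable ?Q" and U''m: "U'' \<in> borel_measurable ?Q"
      using U' U'' by (auto simp: variational_solution_def L2_def)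
    interpret S: finite_measure "distr ?Q R flow_map"
      by (rule Q.finite_measure_distr[OF flow_map_measurable])
    \<comment> \<open>The variational solutions behind \<open>v\<close> and \<open>u\<close> may differ on a null set, which the integrals do not see.\<close>
    have "AE z in distr ?Q R flow_map. v z - u z = 0"
    proof (rule AE_zero_if_orthogonal_to_polynomials)
      show "bounded K" using compact_closure_Q by (rule compact_imp_bounded)
      show "sets (distr ?Q R flow_map) = sets (restrict_space borel K)" by simp
      show "integrable (distr ?Q R flow_map) (\<lambda>z. v z - u z)"
        by (intro Bochner_Integration.integrable_diff S.L2_integrable vL uL)
      fix p :: "real \<times> 'a \<Rightarrow> real" assume "real_polynomial_function p"
      then have pc: "continuous_on K p"
        by (simp add: continuous_on_polymonial_function real_polynomial_function_eq)
      note p = test[OF pc]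
      from p(2) obtain B where B: "\<And>y. y \<in> space R \<Longrightarrow> \<bar>p y\<bar> \<le> B" by blast
      have pL: "p \<in> L2 (distr ?Q R flow_map)"
        using p(1) B by (intro S.L2_bounded[of _ B]) (auto intro!: AE_I2)
      have "(LINT z|distr ?Q R flow_map. v z * p z) = (LINT z|?Q. U' z * p (flow_map z))"
        using veq[OF pc] by (simp add: \<sigma> flow_map_def case_prod_beta')
      also have "\<dots> = (LINT z|?Q. U'' z * p (flow_map z))"
      proof (rule integral_cong_AE)
        show "AE z in ?Q. U' z * p (flow_map z) = U'' z * p (flow_map z)"
          using variational_solution_unique[OF U' U''] by eventually_elim simp
      qed (intro borel_measurable_times U'm U''m measurable_compose[OF flow_map_measurable p(1)])+
      also have "\<dots> = (LINT z|distr ?Q R flow_map. u z * p z)"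
        using ueq'[OF pc] by (simp add: \<sigma> flow_map_def case_prod_beta')
      finally show "(LINT z|distr ?Q R flow_map. (v z - u z) * p z) = 0"
        unfolding left_diff_distrib
        by (subst Bochner_Integration.integral_diff[OF L2_mult_integrable[OF vL pL] L2_mult_integrable[OF uL pL]]) simp
    qed
    then show ?thesis unfolding \<sigma> by eventually_elim simp
  qed
  with usol show ?thesis by blast
qed

end
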